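(* Let $\rho_1,\rho_2,\rho_3>0$, and let $\tilde F:\mathbb{R}^{d_1}\times\mathbb{R}^{d_2}\times\mathbb{R}^{d_3}\to\mathbb{R}\cup\{+\infty\}$, $\tilde F(x,y,c)=G(x,y,c)+H(c)+\Phi(c)$, be the objective function defined in the context. Let $u^k=(x^k,y^k,c^k)$, $k\in\mathbb{N}$, be a sequence generated from an initial point $(x^0,y^0,c^0)$ by the proximal alternating minimization iteration $$ \begin{cases} x^{k+1}\in\arg\min_{x}\ \tilde F(x,y^k,c^k)+\frac{\rho_1}{2}\|x-x^k\|_2^2,\\ y^{k+1}\in\arg\min_{y}\ \tilde F(x^{k+1},y,c^k)+\frac{\rho_2}{2}\|y-y^k\|_2^2,\\ c^{k+1}\in\arg\min_{c}\ \tilde F(x^{k+1},y^{k+1},c)+\frac{\rho_3}{2}\|c-c^k\|_2^2 . \end{cases} $$ Assume that the sequence $(u^k)_{k\in\mathbb{N}}$ is bounded. Then it converges to a critical point of $\tilde F$, i.e. to a point $\bar u$ with $0\in\partial\tilde F(\bar u)$.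
   Context: Throughout, $m,n,p,q,v$ are positive integers with $v>p$. Variable product: for $\mathbf{a},\mathbf{b}\in\mathbb{R}^p$, $\mathbf{a}\odot_v\mathbf{b}\in\mathbb{R}^p$ is given by $(\mathbf{a}\odot_v\mathbf{b})(k)=\sum\{\mathbf{a}(i)\mathbf{b}(j): i,j\in\{1,\dots,p\},\ i+j-k-1\equiv 0 \pmod v\}$, $k=1,\dots,p$. Variable T-product: a tensor $\mathcal{A}\in\mathbb{R}^{m\times q\times p}$ is regarded as a matrix $(\mathbf{a}_{il})$ whose entries are the vectors $\mathbf{a}_{il}=\mathcal{A}(i,l,:)\in\mathbb{R}^p$. For $\mathcal{A}=(\mathbf{a}_{il})\in\mathbb{R}^{m\times q\times p}$ and $\mathcal{B}=(\mathbf{b}_{lj})\in\mathbb{R}^{q\times n\times p}$, $\mathcal{A}*_v\mathcal{B}=(\mathbf{c}_{ij})\in\mathbb{R}^{m\times n\times p}$ with $\mathbf{c}_{ij}=\sum_{l=1}^q\mathbf{a}_{il}\odot_v\mathbf{b}_{lj}$. Vectorization: let $d_1=mqp$, $d_2=qnp$, $d_3=mnp$, $d=d_1+d_2+d_3$. $\mathbb{V}_1:\mathbb{R}^{m\times q\times p}\to\mathbb{R}^{d_1}$, $\mathbb{V}_2:\mathbb{R}^{q\times n\times p}\to\mathbb{R}^{d_2}$, $\mathbb{V}_3:\mathbb{R}^{m\times n\times p}\to\mathbb{R}^{d_3}$ are the vectorization bijections $\mathcal{A}\mapsto\mathcal{A}(:)$ (listing all entries of the tensor in a fixed order), and $\mathbb{I}:\{1,\dots,m\}\times\{1,\dots,n\}\times\{1,\dots,p\}\to\{1,\dots,mnp\}$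 is the corresponding index bijection, so $\mathcal{A}(i_1,i_2,i_3)=[\mathbb{V}_3(\mathcal{A})](\mathbb{I}(i_1,i_2,i_3))$ for every $\mathcal A\in\mathbb{R}^{m\times n\times p}$. Data: $\mathcal{G}\in\mathbb{R}^{m\times n\times p}$ is the observed tensor, $\Omega\subseteq\{1,\dots,m\}\times\{1,\dots,n\}\times\{1,\dots,p\}$ is the set of observed indices, and $\alpha_1,\alpha_2\ge 0$ are regularization parameters. Difference tensors: $L_m\in\mathbb{R}^{m\times m}$ is the matrix whose first row is zero and whose $i$-th row, $i=2,\dots,m$, has $-1$ in column $i-1$, $1$ in column $i$, and zeros elsewhere; $L_n\in\mathbb{R}^{n\times n}$ is defined likewise and $L_n^*$ is its transpose. $\mathcal{D}_1\in\mathbb{R}^{m\times m\times p}$ has first frontal slice $\mathcal{D}_1(:,:,1)=L_m$ and all other frontal slices zero; $\mathcal{D}_2\in\mathbb{R}^{n\times n\times p}$ has first frontal slice $\mathcal{D}_2(:,:,1)=L_n^*$ and all other frontal slices zero. Objective: for $x\in\mathbb{R}^{d_1}$, $y\in\mathbb{R}^{d_2}$, $c\in\mathbb{R}^{d_3}$, $$G(x,y,c)=\tfrac12\big\|\mathbb{V}_1^{-1}(x)*_v\mathbb{V}_2^{-1}(y)-\mathbb{V}_3^{-1}(c)\big\|_{\ell_2}^2,$$ $$H(c)=\alpha_1\|\mathcal{D}_1*_v\mathbb{V}_3^{-1}(c)\|_{\ell_1}+\alpha_2\|\mathbb{V}_3^{-1}(c)*_v\mathcal{D}_2\|_{\ell_1},$$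 where $\|\cdot\|_{\ell_2}$ is the square root of the sum of squares of all entries and $\|\cdot\|_{\ell_1}$ is the sum of absolute values of all entries; and $\Phi(c)=0$ if $c\in\tilde S$, $\Phi(c)=+\infty$ if $c\notin\tilde S$, where $$\tilde S=\{w\in\mathbb{R}^{d_3}: w(i)=[\mathbb{V}_3(\mathcal{G})](i)\text{ for } i\in\mathbb{I}(\Omega),\ w(i)\in[0,1]\text{ for } i\notin\mathbb{I}(\Omega)\}.$$ $\partial$ denotes the limiting (Mordukhovich) subdifferential: for a proper lower semicontinuous $f:\mathbb{R}^N\to\mathbb{R}\cup\{+\infty\}$ and $x$ with $f(x)<\infty$, the Fréchet subdifferential $\hat\partial f(x)$ is the set of $w$ with $\liminf_{z\to x,z\neq x}\frac{f(z)-f(x)-\langle w,z-x\rangle}{\|z-x\|_2}\ge 0$, and $\partial f(x)$ is the set of limits of sequences $w^j\in\hat\partial f(x^j)$ with $x^j\to x$, $f(x^j)\to f(x)$ (with $\partial f(x)=\emptyset$ if $f(x)=+\infty$). *)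

theory Defs
  imports "HOL-Analysis.Analysis" "HOL-Number_Theory.Cong"
begin

section \<open>Third-order tensors\<close>

text \<open>
  The sizes \<open>m\<close>, \<open>n\<close>, \<open>p\<close>, \<open>q\<close> are natural numbers and indices start at 1.  An element of
  \<open>R^p\<close> is a function on \<open>nat\<close> that vanishes outside \<open>{1..p}\<close>, and an element of
  \<open>R^(m x n x p)\<close> is a function of three indices that vanishes outside \<open>tensor_idx m n p\<close>.
\<close>

type_synonym tensor = "nat \<Rightarrow> nat \<Rightarrow> nat \<Rightarrow> real"

definition tensor_idx :: "nat \<Rightarrow> nat \<Rightarrow> nat \<Rightarrow> (nat \<times> nat \<times> nat) set" where
  "tensor_idx m n p = {1..m} \<times> {1..n} \<times> {1..p}"

definition tensors :: "nat \<Rightarrow> nat \<Rightarrow> nat \<Rightarrow> tensor set" where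
  "tensors m n p = {A. \<forall>i j k. (i, j, k) \<notin> tensor_idx m n p \<longrightarrow> A i j k = 0}"

definition tensor_l1 :: "nat \<Rightarrow> nat \<Rightarrow> nat \<Rightarrow> tensor \<Rightarrow> real" where
  "tensor_l1 m n p A = (\<Sum>(i, j, k) \<in> tensor_idx m n p. \<bar>A i j k\<bar>)"

definition tensor_l2 :: "nat \<Rightarrow> nat \<Rightarrow> nat \<Rightarrow> tensor \<Rightarrow> real" where
  "tensor_l2 m n p A = sqrt (\<Sum>(i, j, k) \<in> tensor_idx m n p. (A i j k)\<^sup>2)"

definition var_prod :: "nat \<Rightarrow> nat \<Rightarrow> (nat \<Rightarrow> real) \<Rightarrow> (nat \<Rightarrow> real) \<Rightarrow> (nat \<Rightarrow> real)" where
  "var_prod p v a b = (\<lambda>k. if k \<in> {1..p} then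
     (\<Sum>(i, j) \<in> {(i, j). i \<in> {1..p} \<and> j \<in> {1..p} \<and>
                    [int i + int j - int k - 1 = 0] (mod int v)}. a i * b j) else 0)"

text \<open>
  The variable T-product of an \<open>m x q x p\<close> tensor and a \<open>q x n x p\<close> tensor; \<open>A i l\<close> is the
  tube \<open>A(i,l,:)\<close>.
\<close>

definition var_tprod ::
  "nat \<Rightarrow> nat \<Rightarrow> nat \<Rightarrow> nat \<Rightarrow> nat \<Rightarrow> tensor \<Rightarrow> tensor \<Rightarrow> tensor" where
  "var_tprod m q n p v A B = (\<lambda>i j k. if i \<in> {1..m} \<and> j \<in> {1..n} then
     (\<Sum>l = 1..q. var_prod p v (A i l) (B l j) k) else 0)"

lemma var_tprod_in_tensors: "var_tprod m q n p v A B \<in> tensors m n p"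
  by (auto simp: tensors_def tensor_idx_def var_tprod_def var_prod_def)

definition diff_mat :: "nat \<Rightarrow> nat \<Rightarrow> nat \<Rightarrow> real" where
  "diff_mat m i j = (if i \<in> {2..m} then if j = i - 1 then -1 else if j = i then 1 else 0 else 0)"

definition diff_tensor1 :: "nat \<Rightarrow> tensor" where
  "diff_tensor1 m = (\<lambda>i j k. if k = 1 then diff_mat m i j else 0)"

definition diff_tensor2 :: "nat \<Rightarrow> tensor" where
  "diff_tensor2 n = (\<lambda>i j k. if k = 1 then diff_mat n j i else 0)"

lemma diff_tensor_in_tensors:
  assumes "p > 0"
  shows "diff_tensor1 m \<in> tensors m m p" "diff_tensor2 n \<in> tensors n n p"
  using assms
  by (auto simp: tensors_def tensor_idx_def diff_tensor1_def diff_tensor2_def diff_mat_def)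


section \<open>Vectorization\<close>

text \<open>
  The coordinates of the vectorized tensor are indexed by a finite type \<open>'d\<close>.  The order in
  which the entries are listed is an arbitrary bijection \<open>e\<close> from \<open>tensor_idx m n p\<close> onto
  \<open>'d\<close>, which forces \<open>'d\<close> to have \<open>m * n * p\<close> elements.
\<close>

definition vectorize ::
  "nat \<Rightarrow> nat \<Rightarrow> nat \<Rightarrow> (nat \<times> nat \<times> nat \<Rightarrow> 'd::finite) \<Rightarrow> tensor \<Rightarrow> real ^ 'd" where
  "vectorize m n p e A =
     (\<chi> s. case inv_into (tensor_idx m n p) e s of (i, j, k) \<Rightarrow> A i j k)"

definition unvectorize ::
  "nat \<Rightarrow> nat \<Rightarrow> nat \<Rightarrow> (nat \<times> nat \<times> nat \<Rightarrow> 'd::finite) \<Rightarrow> real ^ 'd \<Rightarrow> tensor" where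
  "unvectorize m n p e x =
     (\<lambda>i j k. if (i, j, k) \<in> tensor_idx m n p then x $ e (i, j, k) else 0)"

lemma vectorize_nth:
  assumes "bij_betw e (tensor_idx m n p) UNIV" "(i, j, k) \<in> tensor_idx m n p"
  shows "vectorize m n p e A $ e (i, j, k) = A i j k"
  using assms by (simp add: vectorize_def bij_betw_inv_into_left)

lemma unvectorize_vectorize:
  assumes "bij_betw e (tensor_idx m n p) UNIV" "A \<in> tensors m n p"
  shows "unvectorize m n p e (vectorize m n p e A) = A"
  using assms by (auto simp: unvectorize_def vectorize_nth tensors_def fun_eq_iff)

lemma vectorize_unvectorize:
  assumes "bij_betw e (tensor_idx m n p) UNIV"
  shows "vectorize m n p e (unvectorize m n p e x) = x"
proof -
  have "vectorize m n p e (unvectorize m n p e x) $ s = x $ s" for s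
  proof -
    obtain i j k where "(i, j, k) \<in> tensor_idx m n p" "s = e (i, j, k)"
      using assms by (force simp: bij_betw_def)
    then show ?thesis
      using assms by (simp add: vectorize_nth) (simp add: unvectorize_def)
  qed
  then show ?thesis
    by (simp add: vec_eq_iff)
qed

lemma bij_betw_vectorize:
  assumes "bij_betw e (tensor_idx m n p) UNIV"
  shows "bij_betw (vectorize m n p e) (tensors m n p) UNIV"
proof (rule bij_betw_byWitness[where f' = "unvectorize m n p e"])
  show "\<forall>A \<in> tensors m n p. unvectorize m n p e (vectorize m n p e A) = A"
    using assms by (simp add: unvectorize_vectorize)
  show "\<forall>x \<in> UNIV. vectorize m n p e (unvectorize m n p e x) = x"
    using assms by (simp add: vectorize_unvectorize)
  show "range (unvectorize m n p e) \<subseteq> tensors m n p"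
    by (auto simp: unvectorize_def tensors_def)
qed simp

lemma card_vectorize_index:
  fixes e :: "nat \<times> nat \<times> nat \<Rightarrow> 'd::finite"
  assumes "bij_betw e (tensor_idx m n p) UNIV"
  shows "CARD('d) = m * n * p"
  using bij_betw_same_card[OF assms] by (simp add: tensor_idx_def)


section \<open>Objective function\<close>

text \<open>\<open>fit_term\<close>, \<open>reg_term\<close> and \<open>box_ind\<close> are the summands \<open>G\<close>, \<open>H\<close> and \<open>\<Phi>\<close>.\<close>

definition fit_term ::
  "nat \<Rightarrow> nat \<Rightarrow> nat \<Rightarrow> nat \<Rightarrow> nat \<Rightarrow>
   (nat \<times> nat \<times> nat \<Rightarrow> 'd1::finite) \<Rightarrow> (nat \<times> nat \<times> nat \<Rightarrow> 'd2::finite) \<Rightarrow>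
   (nat \<times> nat \<times> nat \<Rightarrow> 'd3::finite) \<Rightarrow>
   real ^ 'd1 \<Rightarrow> real ^ 'd2 \<Rightarrow> real ^ 'd3 \<Rightarrow> real" where
  "fit_term m n p q v e1 e2 e3 x y c =
     1 / 2 * (tensor_l2 m n p (\<lambda>i j k.
        var_tprod m q n p v (unvectorize m q p e1 x) (unvectorize q n p e2 y) i j k
        - unvectorize m n p e3 c i j k))\<^sup>2"

definition reg_term ::
  "nat \<Rightarrow> nat \<Rightarrow> nat \<Rightarrow> nat \<Rightarrow> (nat \<times> nat \<times> nat \<Rightarrow> 'd3::finite) \<Rightarrow> real \<Rightarrow> real \<Rightarrow>
   real ^ 'd3 \<Rightarrow> real" where
  "reg_term m n p v e3 \<alpha>1 \<alpha>2 c =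
     \<alpha>1 * tensor_l1 m n p (var_tprod m m n p v (diff_tensor1 m) (unvectorize m n p e3 c))
   + \<alpha>2 * tensor_l1 m n p (var_tprod m n n p v (unvectorize m n p e3 c) (diff_tensor2 n))"

definition feasible_box ::
  "nat \<Rightarrow> nat \<Rightarrow> nat \<Rightarrow> (nat \<times> nat \<times> nat \<Rightarrow> 'd3::finite) \<Rightarrow> tensor \<Rightarrow>
   (nat \<times> nat \<times> nat) set \<Rightarrow> (real ^ 'd3) set" where
  "feasible_box m n p e3 G \<Omega> =
     {w. (\<forall>s \<in> e3 ` \<Omega>. w $ s = vectorize m n p e3 G $ s) \<and>
         (\<forall>s. s \<notin> e3 ` \<Omega> \<longrightarrow> w $ s \<in> {0..1})}"

definition box_ind ::
  "nat \<Rightarrow> nat \<Rightarrow> nat \<Rightarrow> (nat \<times> nat \<times> nat \<Rightarrow> 'd3::finite) \<Rightarrow> tensor \<Rightarrow>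
   (nat \<times> nat \<times> nat) set \<Rightarrow> real ^ 'd3 \<Rightarrow> ereal" where
  "box_ind m n p e3 G \<Omega> c = (if c \<in> feasible_box m n p e3 G \<Omega> then 0 else \<infinity>)"

definition objective ::
  "nat \<Rightarrow> nat \<Rightarrow> nat \<Rightarrow> nat \<Rightarrow> nat \<Rightarrow>
   (nat \<times> nat \<times> nat \<Rightarrow> 'd1::finite) \<Rightarrow> (nat \<times> nat \<times> nat \<Rightarrow> 'd2::finite) \<Rightarrow>
   (nat \<times> nat \<times> nat \<Rightarrow> 'd3::finite) \<Rightarrow>
   tensor \<Rightarrow> (nat \<times> nat \<times> nat) set \<Rightarrow> real \<Rightarrow> real \<Rightarrow>
   (real ^ 'd1) \<times> (real ^ 'd2) \<times> (real ^ 'd3) \<Rightarrow> ereal" where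
  "objective m n p q v e1 e2 e3 G \<Omega> \<alpha>1 \<alpha>2 = (\<lambda>(x, y, c).
     ereal (fit_term m n p q v e1 e2 e3 x y c) + ereal (reg_term m n p v e3 \<alpha>1 \<alpha>2 c)
     + box_ind m n p e3 G \<Omega> c)"


section \<open>Limiting subdifferential\<close>

text \<open>
  Intended for functions that never take the value \<open>-\<infinity>\<close>; then every difference below is
  well defined in \<open>ereal\<close>, since the value at the base point is finite.
\<close>

definition frechet_subdiff :: "('a::euclidean_space \<Rightarrow> ereal) \<Rightarrow> 'a \<Rightarrow> 'a set" where
  "frechet_subdiff f x = {w. f x < \<infinity> \<and>
     0 \<le> Liminf (at x) (\<lambda>z. (f z - f x - ereal (w \<bullet> (z - x))) / ereal (norm (z - x)))}"

definition limiting_subdiff :: "('a::euclidean_space \<Rightarrow> ereal) \<Rightarrow> 'a \<Rightarrow> 'a set" where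
  "limiting_subdiff f x = {w. f x < \<infinity> \<and>
     (\<exists>ws xs. (\<forall>j. ws j \<in> frechet_subdiff f (xs j)) \<and> xs \<longlonglongrightarrow> x \<and>
              (\<lambda>j. f (xs j)) \<longlonglongrightarrow> f x \<and> ws \<longlonglongrightarrow> w)}"

end

theory Submission
  imports Defs "HOL-Library.Landau_Symbols" "HOL-Computational_Algebra.Polynomial"
begin

text \<open>
  The heart of the matter is the Lojasiewicz gradient inequality for a polynomial \<open>f\<close>, which can be
  had without semialgebraic geometry.  If it fails, there are bounded points \<open>w\<^sub>k\<close> with
  \<open>t\<^sub>k = f w\<^sub>k\<close> tending to \<open>0\<close> from above and \<open>|grad f w\<^sub>k| \<le> t\<^sub>k powr (1 - e)\<close> eventually, for every
  \<open>e > 0\<close>.  Replace \<open>w\<^sub>k\<close> by a minimizer \<open>u\<^sub>k\<close> of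
  \<open>(f u - t\<^sub>k)^2 + t\<^sub>k^2 |grad f u|^2 + t\<^sub>k^4 (sum of u\<^sub>b^(2d+2))\<close>, where \<open>d\<close> bounds the degrees of \<open>f\<close>
  and its first two derivatives.  The critical point equations have leading terms \<open>u\<^sub>b^(2d+1)\<close>, so up
  to a power of \<open>t\<^sub>k\<close> every polynomial in \<open>u\<^sub>k\<close> is a combination of finitely many monomials with
  coefficients in \<open>R[t\<^sub>k]\<close>: the points \<open>u\<^sub>k\<close> behave as if they lay on an algebraic curve over \<open>R(t)\<close>.
  Along an ultrafilter all these functions are comparable to powers \<open>t powr r\<close> with \<open>r\<close> in a discrete
  group, hence they have expansions in powers of a uniformizer \<open>\<pi>\<close>, comparable to \<open>t powr s\<close>.
  If \<open>X\<close> is a sufficiently long truncation of the expansion of \<open>u\<^sub>k\<close>, then \<open>f (X \<pi>)\<close> is a polynomial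
  in \<open>\<pi>\<close> comparable to \<open>t\<close>, so its derivative is comparable to \<open>t powr (1 - s)\<close>; but the chain rule
  bounds that derivative by a multiple of \<open>|grad f (X \<pi>)|\<close>, which is much smaller.

  The objective is continuous on its domain and polynomial on each cell of a hyperplane arrangement.
  In directions parallel to the cell a subgradient coincides with the gradient of that polynomial, so
  the inequality carries over to subgradients of the objective.  Sufficient decrease and the relative
  error bound of the iteration then make the lengths of the steps summable.
\<close>


section \<open>Homogeneous systems, ultrafilters, polynomial gradients\<close>

text \<open>Gaussian elimination by cross-multiplication: a row with a nonzero pivot removes one
  unknown from the other rows without division, so the solution stays in the domain. It is applied
  with coefficients in R[t].\<close>

lemma homogeneous_system_nontrivial_solution:
  fixes A :: "'i \<Rightarrow> 'j \<Rightarrow> 'a::idom"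
  assumes "finite I" "finite J" "card I < card J"
  shows "\<exists>x. (\<exists>j\<in>J. x j \<noteq> 0) \<and> (\<forall>i\<in>I. (\<Sum>j\<in>J. A i j * x j) = 0)"
  using assms
proof (induction I arbitrary: J A rule: finite_induct)
  case empty
  then obtain j where "j \<in> J" by fastforce
  then show ?case by (intro exI[of _ "\<lambda>_. 1"]) auto
next
  case (insert i0 I)
  show ?case
  proof (cases "\<forall>j\<in>J. A i0 j = 0")
    case True
    have "card I < card J"
      using insert by simp
    with insert.IH[OF insert.prems(1)] obtain x where
      "\<exists>j\<in>J. x j \<noteq> 0" "\<forall>i\<in>I. (\<Sum>j\<in>J. A i j * x j) = 0" by blast
    then show ?thesis
      using True by (intro exI[of _ x]) auto
  next
    case False
    then obtain j0 where j0: "j0 \<in> J" "A i0 j0 \<noteq> 0" by blast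
    define J' where "J' = J - {j0}"
    have J': "finite J'" "card I < card J'" "J = insert j0 J'" "j0 \<notin> J'"
      using insert j0 by (auto simp: J'_def)
    obtain x where x: "\<exists>j\<in>J'. x j \<noteq> 0"
      "\<forall>i\<in>I. (\<Sum>j\<in>J'. (A i0 j0 * A i j - A i j0 * A i0 j) * x j) = 0"
      using insert.IH[OF J'(1,2), of "\<lambda>i j. A i0 j0 * A i j - A i j0 * A i0 j"] by blast
    \<comment> \<open>The solution of the reduced system is scaled by the pivot; the coordinate
      \<open>j0\<close> then gets the value that solves row \<open>i0\<close>.\<close>
    define y where "y = (\<lambda>j. if j = j0 then - (\<Sum>j\<in>J'. A i0 j * x j) else A i0 j0 * x j)"
    have y0: "y j0 = - (\<Sum>j\<in>J'. A i0 j * x j)" by (simp add: y_def)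
    have yJ: "(\<Sum>j\<in>J'. A i j * y j) = (\<Sum>j\<in>J'. A i j * (A i0 j0 * x j))" for i
      by (rule sum.cong) (use J' in \<open>auto simp: y_def\<close>)
    have split: "(\<Sum>j\<in>J. A i j * y j) =
        (\<Sum>j\<in>J'. (A i0 j0 * A i j - A i j0 * A i0 j) * x j)" for i
    proof -
      have "(\<Sum>j\<in>J. A i j * y j) = A i j0 * y j0 + (\<Sum>j\<in>J'. A i j * y j)"
        using J' by simp
      also have "\<dots> = (\<Sum>j\<in>J'. A i j * (A i0 j0 * x j)) - (\<Sum>j\<in>J'. A i j0 * (A i0 j * x j))"
        by (simp add: y0 yJ sum_distrib_left)
      finally show ?thesis
        by (simp add: sum_subtractf[symmetric] algebra_simps)
    qed
    have "\<exists>j\<in>J. y j \<noteq> 0"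
      using x(1) j0 J' by (auto simp: y_def)
    moreover have "\<forall>i\<in>insert i0 I. (\<Sum>j\<in>J. A i j * y j) = 0"
      using x(2) by (auto simp: split)
    ultimately show ?thesis by blast
  qed
qed

section \<open>Ultrafilters refining a filter\<close>

text \<open>Zorn's lemma for the proper filters below \<open>F\<close>, ordered by
  \<open>\<ge>\<close>. The infimum of a nonempty chain is proper because an event is eventual there
  only if it is eventual at some member of the chain.\<close>

lemma ultrafilter_below:
  assumes "F \<noteq> (bot :: 'a filter)"
  shows "\<exists>U\<le>F. U \<noteq> bot \<and> (\<forall>P. eventually P U \<or> eventually (\<lambda>x. \<not> P x) U)"
proof -
  define S where "S = {G. G \<noteq> bot \<and> G \<le> F}"
  have "\<exists>U\<in>S. \<forall>G\<in>S. U \<ge> G \<longrightarrow> G = U"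
  proof (rule predicate_Zorn)
    show "partial_order_on S (relation_of (\<ge>) S)"
      by (auto simp: partial_order_on_def preorder_on_def relation_of_def refl_on_def trans_def
            antisym_def)
    fix C assume C: "C \<in> Chains (relation_of (\<ge>) S)"
    then have sub: "C \<subseteq> S" and ch: "\<And>a b. a \<in> C \<Longrightarrow> b \<in> C \<Longrightarrow> a \<le> b \<or> b \<le> a"
      by (auto simp: Chains_def relation_of_def)
    show "\<exists>u\<in>S. \<forall>a\<in>C. u \<le> a"
    proof (cases "C = {}")
      case True
      then show ?thesis using assms by (auto simp: S_def)
    next
      case False
      have "eventually P (Inf C) \<longleftrightarrow> (\<exists>b\<in>C. eventually P b)" for P
      proof (rule eventually_Inf_base[OF False])
        fix G H assume GH: "G \<in> C" "H \<in> C"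
        then show "\<exists>x\<in>C. x \<le> inf G H"
          using ch[OF GH] by (metis inf.absorb1 inf.absorb2 order_refl)
      qed
      then have "Inf C \<noteq> bot"
        using sub by (auto simp: trivial_limit_def S_def)
      moreover have "Inf C \<le> F"
        using False sub by (auto simp: S_def intro: Inf_lower2)
      ultimately show ?thesis
        by (intro bexI[of _ "Inf C"]) (auto simp: S_def intro: Inf_lower)
    qed
  qed
  then obtain U where U: "U \<noteq> bot" "U \<le> F"
    and max: "\<And>G. G \<noteq> bot \<Longrightarrow> G \<le> F \<Longrightarrow> G \<le> U \<Longrightarrow> G = U"
    by (auto simp: S_def)
  \<comment> \<open>Unless \<open>P\<close> fails eventually, restricting \<open>U\<close> to
    \<open>P\<close> leaves a proper filter, which minimality identifies with
    \<open>U\<close>.\<close>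
  have "eventually P U \<or> eventually (\<lambda>x. \<not> P x) U" for P
  proof (rule disjCI)
    assume "\<not> eventually (\<lambda>x. \<not> P x) U"
    then have "inf U (principal {x. P x}) \<noteq> bot"
      by (simp add: trivial_limit_def eventually_inf_principal)
    then have "inf U (principal {x. P x}) = U"
      using U(2) by (intro max) (auto intro: le_infI1)
    moreover have "eventually P (inf U (principal {x. P x}))"
      by (simp add: eventually_inf_principal)
    ultimately show "eventually P U" by simp
  qed
  with U show ?thesis by blast
qed

section \<open>Gradients and Lipschitz bounds of polynomials\<close>

text \<open>The sum and product rules keep the gradient polynomial; a linear functional contributes
  the constant vector representing it. Since \<open>D\<close> is again polynomial, second
  derivatives are available as well.\<close>

lemma polynomial_gradient:
  fixes f :: "'a::euclidean_space \<Rightarrow> real"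
  assumes "real_polynomial_function f"
  shows "\<exists>D. polynomial_function D \<and> (\<forall>u. (f has_derivative (\<lambda>h. D u \<bullet> h)) (at u))"
  using assms
proof induction
  case (linear f)
  interpret bounded_linear f by fact
  have "f h = (\<Sum>b\<in>Basis. f b *\<^sub>R b) \<bullet> h" for h
  proof -
    have "f h = f (\<Sum>b\<in>Basis. (h \<bullet> b) *\<^sub>R b)" by (simp add: euclidean_representation)
    also have "\<dots> = (\<Sum>b\<in>Basis. (h \<bullet> b) * f b)" by (simp add: sum scaleR)
    also have "\<dots> = (\<Sum>b\<in>Basis. f b *\<^sub>R b) \<bullet> h"
      by (simp add: inner_commute[of _ h] inner_sum_right mult.commute)
    finally show ?thesis .
  qed
  then have "f = (\<lambda>h. (\<Sum>b\<in>Basis. f b *\<^sub>R b) \<bullet> h)" by blast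
  then have "(f has_derivative (\<lambda>h. (\<Sum>b\<in>Basis. f b *\<^sub>R b) \<bullet> h)) (at u)" for u
    using bounded_linear_imp_has_derivative[OF linear.hyps] by metis
  then show ?case by (intro exI[of _ "\<lambda>_. \<Sum>b\<in>Basis. f b *\<^sub>R b"]) auto
next
  case (const c)
  then show ?case by (intro exI[of _ "\<lambda>_. 0"]) auto
next
  case (add f g)
  then obtain D E where "polynomial_function D" "polynomial_function E"
    "\<And>u. (f has_derivative (\<lambda>h. D u \<bullet> h)) (at u)" "\<And>u. (g has_derivative (\<lambda>h. E u \<bullet> h)) (at u)"
    by blast
  then show ?case
    by (intro exI[of _ "\<lambda>u. D u + E u"]) (auto simp: inner_add_left intro!: has_derivative_add)
next
  case (mult f g)
  then obtain D E where D: "polynomial_function D" "polynomial_function E"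
    "\<And>u. (f has_derivative (\<lambda>h. D u \<bullet> h)) (at u)" "\<And>u. (g has_derivative (\<lambda>h. E u \<bullet> h)) (at u)"
    by blast
  have "((\<lambda>u. f u * g u) has_derivative (\<lambda>h. (f u *\<^sub>R E u + g u *\<^sub>R D u) \<bullet> h)) (at u)" for u
    by (rule has_derivative_eq_rhs[OF has_derivative_mult[OF D(3,4)]])
       (auto simp: inner_add_left)
  moreover have "polynomial_function (\<lambda>u. f u *\<^sub>R E u + g u *\<^sub>R D u)"
    using mult.hyps D(1,2) by (intro polynomial_function_add polynomial_function_mult)
       (auto simp: real_polynomial_function_eq)
  ultimately show ?case by blast
qed

text \<open>Mean value inequality on the ball, where the polynomial gradient is bounded by
  compactness; a vector-valued \<open>f\<close> is treated coordinate by coordinate.\<close>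

lemma polynomial_lipschitz_on_cball:
  fixes f :: "'a::euclidean_space \<Rightarrow> 'b::euclidean_space"
  assumes "polynomial_function f"
  shows "\<exists>L>0. \<forall>x\<in>cball 0 R. \<forall>y\<in>cball 0 R. norm (f x - f y) \<le> L * norm (x - y)"
proof -
  have one: "\<exists>L. \<forall>x\<in>cball 0 R. \<forall>y\<in>cball 0 R. \<bar>g x - g y\<bar> \<le> L * norm (x - y)"
    if "real_polynomial_function g" for g :: "'a \<Rightarrow> real"
  proof -
    obtain D where D: "polynomial_function D" "\<And>u. (g has_derivative (\<lambda>h. D u \<bullet> h)) (at u)"
      using polynomial_gradient[OF \<open>real_polynomial_function g\<close>] by blast
    have "bounded (D ` cball 0 R)"
      by (intro compact_imp_bounded compact_continuous_image compact_cball
            continuous_on_polymonial_function D)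
    then obtain L where L: "\<And>x. x \<in> cball 0 R \<Longrightarrow> norm (D x) \<le> L"
      unfolding bounded_iff by blast
    have "norm (g x - g y) \<le> L * norm (x - y)" if "x \<in> cball 0 R" "y \<in> cball 0 R" for x y
    proof (rule differentiable_bound[of "cball 0 R" g "\<lambda>u h. D u \<bullet> h"])
      show "(g has_derivative (\<lambda>h. D u \<bullet> h)) (at u within cball 0 R)" for u
        using D(2) by (rule has_derivative_at_withinI)
      show "onorm (\<lambda>h. D u \<bullet> h) \<le> L" if "u \<in> cball 0 R" for u
      proof (rule onorm_bound)
        show "0 \<le> L" using L[OF that] norm_ge_zero order_trans by blast
        show "norm (D u \<bullet> h) \<le> L * norm h" for h
          using Cauchy_Schwarz_ineq2[of "D u" h] mult_right_mono[OF L[OF that] norm_ge_zero[of h]]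
          by simp
      qed
    qed (use that in auto)
    then show ?thesis by (intro exI[of _ L]) auto
  qed
  have "\<exists>L. \<forall>x\<in>cball 0 R. \<forall>y\<in>cball 0 R. \<bar>f x \<bullet> b - f y \<bullet> b\<bar> \<le> L * norm (x - y)" if "b \<in> Basis" for b
    using assms that by (intro one) (simp add: polynomial_function_iff_Basis_inner)
  then obtain L where L: "\<And>b x y. b \<in> Basis \<Longrightarrow> x \<in> cball 0 R \<Longrightarrow> y \<in> cball 0 R \<Longrightarrow>
      \<bar>f x \<bullet> b - f y \<bullet> b\<bar> \<le> L b * norm (x - y)"
    by metis
  define M where "M = max 1 (\<Sum>b\<in>Basis. L b)"
  have "norm (f x - f y) \<le> M * norm (x - y)" if "x \<in> cball 0 R" "y \<in> cball 0 R" for x y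
  proof -
    have "norm (f x - f y) \<le> (\<Sum>b\<in>Basis. \<bar>(f x - f y) \<bullet> b\<bar>)" by (rule norm_le_l1)
    also have "\<dots> \<le> (\<Sum>b\<in>Basis. L b * norm (x - y))"
      using L[OF _ that] by (intro sum_mono) (simp add: inner_diff_left)
    also have "\<dots> \<le> M * norm (x - y)"
      unfolding sum_distrib_right[symmetric] by (intro mult_right_mono) (auto simp: M_def)
    finally show ?thesis .
  qed
  then show ?thesis by (intro exI[of _ M]) (auto simp: M_def)
qed

section \<open>Reduction modulo the critical point equations\<close>

text \<open>The exponent is a function on the whole space of which only the values on
  \<open>Basis\<close> matter; \<open>monomial_restrict\<close> passes to the representative in an
  extensional product.\<close>

definition monomial :: "('a::euclidean_space \<Rightarrow> nat) \<Rightarrow> 'a \<Rightarrow> real" where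
  "monomial \<alpha> u = (\<Prod>b\<in>Basis. (u \<bullet> b) ^ \<alpha> b)"

lemma monomial_mult: "monomial \<alpha> u * monomial \<beta> u = monomial (\<lambda>b. \<alpha> b + \<beta> b) u"
  by (simp add: monomial_def prod.distrib power_add)

lemma monomial_zero [simp]: "monomial (\<lambda>_. 0) u = 1"
  by (simp add: monomial_def)

lemma monomial_single:
  assumes "b \<in> Basis"
  shows "monomial (\<lambda>c. if c = b then N else 0) u = (u \<bullet> b) ^ N"
proof -
  have "monomial (\<lambda>c. if c = b then N else 0) u = (\<Prod>c\<in>Basis. if c = b then (u \<bullet> b) ^ N else 1)"
    unfolding monomial_def by (rule prod.cong) auto
  then show ?thesis using assms by simp
qed

lemma monomial_restrict [simp]: "monomial (restrict \<alpha> Basis) u = monomial \<alpha> u"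
  unfolding monomial_def by (rule prod.cong) auto

text \<open>The span of the monomials of total degree at most \<open>N\<close>. It speaks of
  functions, not of formal expressions, so \<open>N\<close> is only an upper bound.\<close>

inductive deg_le :: "nat \<Rightarrow> ('a::euclidean_space \<Rightarrow> real) \<Rightarrow> bool" for N where
  monomial: "sum \<alpha> Basis \<le> N \<Longrightarrow> deg_le N (\<lambda>u. a * monomial \<alpha> u)"
| add: "deg_le N f \<Longrightarrow> deg_le N g \<Longrightarrow> deg_le N (\<lambda>u. f u + g u)"

lemma deg_le_mono: "deg_le N f \<Longrightarrow> N \<le> M \<Longrightarrow> deg_le M f"
  by (induction rule: deg_le.induct) (auto intro: deg_le.intros)

lemma deg_le_const: "deg_le N (\<lambda>_. a)"
  using deg_le.monomial[of "\<lambda>_. 0" N a] by simp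

lemma deg_le_sum:
  assumes "finite I" "\<And>i. i \<in> I \<Longrightarrow> deg_le N (f i)"
  shows "deg_le N (\<lambda>u. \<Sum>i\<in>I. f i u)"
  using assms by (induction rule: finite_induct) (auto intro: deg_le.add deg_le_const)

lemma deg_le_mult:
  assumes "deg_le N f" "deg_le M g"
  shows "deg_le (N + M) (\<lambda>u. f u * g u)"
  using assms(1)
proof induction
  case f: (monomial \<alpha> a)
  show ?case
    using assms(2)
  proof induction
    case (monomial \<beta> b)
    have "deg_le (N + M) (\<lambda>u. (a * b) * monomial (\<lambda>c. \<alpha> c + \<beta> c) u)"
      using f monomial by (intro deg_le.monomial) (simp add: sum.distrib)
    then show ?case
      by (simp add: monomial_mult[symmetric] mult_ac)
  next
    case (add g h)
    then show ?case by (simp add: distrib_left deg_le.add)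
  qed
next
  case (add f h)
  then show ?case by (simp add: distrib_right deg_le.add)
qed

lemma deg_le_cmult: "deg_le N f \<Longrightarrow> deg_le N (\<lambda>u. a * f u)"
  using deg_le_mult[OF deg_le_const[of 0 a]] by simp

lemma deg_le_inner:
  assumes "b \<in> Basis"
  shows "deg_le 1 (\<lambda>u. u \<bullet> b)"
  using deg_le.monomial[of "\<lambda>c. if c = b then 1 else 0" 1 1] assms
    monomial_single[OF assms, of 1]
  by simp

lemma real_polynomial_function_deg_le:
  fixes f :: "'a::euclidean_space \<Rightarrow> real"
  assumes "real_polynomial_function f"
  shows "\<exists>N. deg_le N f"
  using assms
proof induction
  case (linear f)
  interpret bounded_linear f by fact
  have "f u = (\<Sum>b\<in>Basis. f b * (u \<bullet> b))" for u
  proof -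
    have "f u = f (\<Sum>b\<in>Basis. (u \<bullet> b) *\<^sub>R b)" by (simp add: euclidean_representation)
    then show ?thesis by (simp add: sum scaleR mult.commute)
  qed
  then have eq: "f = (\<lambda>u. \<Sum>b\<in>Basis. f b * (u \<bullet> b))" by (rule ext)
  have "deg_le 1 (\<lambda>u. \<Sum>b\<in>Basis. f b * (u \<bullet> b))"
    by (intro deg_le_sum deg_le_cmult deg_le_inner) auto
  then have "deg_le 1 f" by (simp only: eq[symmetric])
  then show ?case by blast
next
  case (const c)
  then show ?case using deg_le_const by blast
next
  case (add f g)
  then obtain N M where "deg_le N f" "deg_le M g" by blast
  then show ?case
    using deg_le_mono[of _ _ "max N M"] deg_le.add by (metis max.cobounded1 max.cobounded2)
next
  case (mult f g)
  then show ?case using deg_le_mult by blast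
qed

text \<open>
  The reduction is the equation \<open>\<partial>/\<partial>u\<^sub>b = 0\<close> at a minimizer of the function described in the
  introduction, solved for the leading term \<open>u\<^sub>b^N\<close>; it lowers the total degree.
\<close>

locale reducing_sequence =
  fixes t :: "nat \<Rightarrow> real" and u :: "nat \<Rightarrow> 'a::euclidean_space" and N :: nat
    and r :: "'a \<Rightarrow> nat \<Rightarrow> 'a \<Rightarrow> real"
  assumes t_pos: "t k > 0"
    and N_pos: "N > 0"
    and deg_r: "b \<in> Basis \<Longrightarrow> deg_le (N - 1) (r b i)"
    and reduction: "b \<in> Basis \<Longrightarrow> t k ^ 4 * (u k \<bullet> b) ^ N = (\<Sum>i\<le>2. t k ^ i * r b i (u k))"
begin

text \<open>The exponents of the monomials that no reduction step touches; the extensional product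
  makes this set finite.\<close>

definition box :: "('a \<Rightarrow> nat) set" where
  "box = (\<Pi>\<^sub>E b\<in>Basis. {..<N})"

lemma finite_box [simp]: "finite box"
  by (simp add: box_def finite_PiE)

text \<open>Up to a power of t, \<open>h\<close> is a combination of the box monomials over R[t].
  Neither \<open>e\<close> nor the coefficients depend on \<open>k\<close>.\<close>

definition reducible :: "(nat \<Rightarrow> real) \<Rightarrow> bool" where
  "reducible h \<longleftrightarrow>
     (\<exists>e c. \<forall>k. t k ^ e * h k = (\<Sum>\<alpha>\<in>box. poly (c \<alpha>) (t k) * monomial \<alpha> (u k)))"

lemma reducible_add:
  assumes "reducible g" "reducible h"
  shows "reducible (\<lambda>k. g k + h k)"
proof -
  from assms(1)[unfolded reducible_def] obtain d a where
    g: "\<And>k. t k ^ d * g k = (\<Sum>\<alpha>\<in>box. poly (a \<alpha>) (t k) * monomial \<alpha> (u k))"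
    by blast
  from assms(2)[unfolded reducible_def] obtain e b where
    h: "\<And>k. t k ^ e * h k = (\<Sum>\<alpha>\<in>box. poly (b \<alpha>) (t k) * monomial \<alpha> (u k))"
    by blast
  have "t k ^ (d + e) * (g k + h k) = (\<Sum>\<alpha>\<in>box.
      poly (monom 1 e * a \<alpha> + monom 1 d * b \<alpha>) (t k) * monomial \<alpha> (u k))" for k
  proof -
    have "t k ^ (d + e) * (g k + h k) = t k ^ e * (t k ^ d * g k) + t k ^ d * (t k ^ e * h k)"
      by (simp add: power_add algebra_simps)
    also have "\<dots> = (\<Sum>\<alpha>\<in>box. poly (monom 1 e * a \<alpha> + monom 1 d * b \<alpha>) (t k) * monomial \<alpha> (u k))"
      unfolding g h by (simp add: sum_distrib_left sum.distrib[symmetric] poly_monom algebra_simps)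
    finally show ?thesis .
  qed
  then show ?thesis unfolding reducible_def
    by (intro exI[of _ "d + e"] exI[of _ "\<lambda>\<alpha>. monom 1 e * a \<alpha> + monom 1 d * b \<alpha>"]) simp
qed

lemma reducible_scale:
  assumes "reducible h"
  shows "reducible (\<lambda>k. poly p (t k) * h k)"
proof -
  obtain e b where
    h: "\<And>k. t k ^ e * h k = (\<Sum>\<alpha>\<in>box. poly (b \<alpha>) (t k) * monomial \<alpha> (u k))"
    using assms unfolding reducible_def by blast
  have "t k ^ e * (poly p (t k) * h k) =
      (\<Sum>\<alpha>\<in>box. poly (p * b \<alpha>) (t k) * monomial \<alpha> (u k))" for k
  proof -
    have "t k ^ e * (poly p (t k) * h k) = poly p (t k) * (t k ^ e * h k)" by simp
    then show ?thesis unfolding h by (simp add: sum_distrib_left mult.assoc)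
  qed
  then show ?thesis unfolding reducible_def
    by (intro exI[of _ e] exI[of _ "\<lambda>\<alpha>. p * b \<alpha>"]) simp
qed

lemma reducible_unscale:
  assumes "reducible (\<lambda>k. t k ^ d * h k)"
  shows "reducible h"
proof -
  obtain e b where
    h: "\<And>k. t k ^ e * (t k ^ d * h k) = (\<Sum>\<alpha>\<in>box. poly (b \<alpha>) (t k) * monomial \<alpha> (u k))"
    using assms unfolding reducible_def by blast
  then show ?thesis unfolding reducible_def
    by (intro exI[of _ "e + d"] exI[of _ b]) (simp add: power_add mult.assoc)
qed

lemma reducible_zero: "reducible (\<lambda>_. 0)"
  unfolding reducible_def by (intro exI[of _ 0] exI[of _ "\<lambda>_. 0"]) simp

lemma reducible_sum:
  assumes "finite I" "\<And>i. i \<in> I \<Longrightarrow> reducible (f i)"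
  shows "reducible (\<lambda>k. \<Sum>i\<in>I. f i k)"
  using assms by (induction rule: finite_induct) (auto intro: reducible_add reducible_zero)

lemma reducible_box:
  assumes "\<alpha> \<in> box"
  shows "reducible (\<lambda>k. monomial \<alpha> (u k))"
proof -
  have "(\<Sum>\<beta>\<in>box. poly (if \<beta> = \<alpha> then 1 else 0) (t k) * monomial \<beta> (u k)) = monomial \<alpha> (u k)" for k
  proof -
    have "(\<Sum>\<beta>\<in>box. poly (if \<beta> = \<alpha> then 1 else 0) (t k) * monomial \<beta> (u k)) =
        (\<Sum>\<beta>\<in>box. if \<beta> = \<alpha> then monomial \<alpha> (u k) else 0)"
      by (rule sum.cong) auto
    then show ?thesis using assms by simp
  qed
  then show ?thesis unfolding reducible_def
    by (intro exI[of _ 0] exI[of _ "\<lambda>\<beta>. if \<beta> = \<alpha> then 1 else 0"]) simp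
qed

text \<open>Strong induction on the degree bound. A monomial outside the box contains some factor
  \<open>(u k \<bullet> b) ^ N\<close>; trading it for the remainders \<open>r b i\<close> costs a
  factor \<open>t k ^ 4\<close> and lowers the degree.\<close>

lemma reducible_polynomial:
  "deg_le M f \<Longrightarrow> reducible (\<lambda>k. f (u k))"
proof (induction M arbitrary: f rule: less_induct)
  case (less M)
  from less.prems show ?case
  proof induction
    case (monomial \<alpha> a)
    have "reducible (\<lambda>k. monomial \<alpha> (u k))"
    proof (cases "\<forall>b\<in>Basis. \<alpha> b < N")
      case True
      then have "restrict \<alpha> Basis \<in> box" by (auto simp: box_def)
      from reducible_box[OF this] show ?thesis by simp
    next
      case False
      then obtain b where b: "b \<in> Basis" "N \<le> \<alpha> b" by force
      define \<beta> where "\<beta> = (\<lambda>c. if c = b then \<alpha> b - N else \<alpha> c)"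
      have \<alpha>: "\<alpha> = (\<lambda>c. (if c = b then N else 0) + \<beta> c)"
        using b by (auto simp: \<beta>_def)
      have mon: "monomial \<alpha> w = (w \<bullet> b) ^ N * monomial \<beta> w" for w
        using monomial_mult[of "\<lambda>c. if c = b then N else 0" w \<beta>] \<alpha> monomial_single[OF b(1)]
        by metis
      have sum: "sum \<alpha> Basis = N + sum \<beta> Basis"
        using b(1) by (subst \<alpha>) (simp add: sum.distrib)
      have "reducible (\<lambda>k. r b i (u k) * monomial \<beta> (u k))" for i
      proof (rule less.IH)
        \<comment> \<open>A factor of degree \<open>N\<close> is replaced by one of degree at most
          \<open>N - 1\<close>, so the bound drops strictly below \<open>M\<close>.\<close>
        show "N - 1 + sum \<beta> Basis < M" using sum monomial N_pos by simp
        show "deg_le (N - 1 + sum \<beta> Basis) (\<lambda>w. r b i w * monomial \<beta> w)"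
          using deg_le_mult[OF deg_r[OF b(1)] deg_le.monomial[of \<beta> _ 1]] by simp
      qed
      then have "reducible (\<lambda>k. \<Sum>i\<le>2. poly (monom 1 i) (t k) * (r b i (u k) * monomial \<beta> (u k)))"
        by (intro reducible_sum reducible_scale) auto
      moreover have "(\<Sum>i\<le>2. poly (monom 1 i) (t k) * (r b i (u k) * monomial \<beta> (u k))) =
          t k ^ 4 * monomial \<alpha> (u k)" for k
        using reduction[OF b(1), of k]
        by (simp add: mon poly_monom sum_distrib_right mult.assoc[symmetric])
      ultimately show ?thesis
        using reducible_unscale[of 4] by simp
    qed
    from reducible_scale[OF this, of "[:a:]"] show ?case by simp
  next
    case (add f g)
    then show ?case by (intro reducible_add) auto
  qed
qed

text \<open>A product of two box monomials may leave the box, so it is reduced again by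
  \<open>reducible_polynomial\<close>.\<close>

lemma reducible_mult:
  assumes "reducible g" "reducible h"
  shows "reducible (\<lambda>k. g k * h k)"
proof -
  from assms(1)[unfolded reducible_def] obtain d a where
    g: "\<And>k. t k ^ d * g k = (\<Sum>\<alpha>\<in>box. poly (a \<alpha>) (t k) * monomial \<alpha> (u k))"
    by blast
  from assms(2)[unfolded reducible_def] obtain e b where
    h: "\<And>k. t k ^ e * h k = (\<Sum>\<alpha>\<in>box. poly (b \<alpha>) (t k) * monomial \<alpha> (u k))"
    by blast
  have "reducible (\<lambda>k. monomial (\<lambda>c. \<alpha> c + \<beta> c) (u k))" for \<alpha> \<beta>
    using reducible_polynomial[OF deg_le.monomial[OF order_refl, of _ 1]] by simp
  then have "reducible (\<lambda>k. \<Sum>\<alpha>\<in>box. \<Sum>\<beta>\<in>box.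
      poly (a \<alpha> * b \<beta>) (t k) * monomial (\<lambda>c. \<alpha> c + \<beta> c) (u k))"
    by (intro reducible_sum reducible_scale) auto
  moreover have "(\<Sum>\<alpha>\<in>box. \<Sum>\<beta>\<in>box.
      poly (a \<alpha> * b \<beta>) (t k) * monomial (\<lambda>c. \<alpha> c + \<beta> c) (u k)) = t k ^ (d + e) * (g k * h k)" for k
  proof -
    have "t k ^ (d + e) * (g k * h k) = (t k ^ d * g k) * (t k ^ e * h k)"
      by (simp add: power_add)
    then show ?thesis unfolding g h
      by (simp add: sum_product monomial_mult[symmetric] mult_ac)
  qed
  ultimately show ?thesis
    using reducible_unscale[of "d + e"] by simp
qed

lemma reducible_const: "reducible (\<lambda>_. a)"
  using reducible_polynomial[OF deg_le_const] .

lemma reducible_power: "reducible h \<Longrightarrow> reducible (\<lambda>k. h k ^ j)"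
  by (induction j) (auto intro: reducible_mult reducible_const)

lemma reducible_t: "reducible t" and reducible_inverse_t: "reducible (\<lambda>k. inverse (t k))"
proof -
  show "reducible t"
    using reducible_scale[OF reducible_const[of 1], of "[:0, 1:]"] by simp
  have "reducible (\<lambda>k. t k ^ 1 * inverse (t k))"
  proof -
    have "t k ^ 1 * inverse (t k) = 1" for k using t_pos[of k] by simp
    then show ?thesis using reducible_const[of 1] by simp
  qed
  then show "reducible (\<lambda>k. inverse (t k))" by (rule reducible_unscale)
qed

text \<open>The \<open>card box + 1\<close> powers of \<open>h\<close> have, up to powers of t,
  coordinate vectors of length \<open>card box\<close> over R[t], hence satisfy a nontrivial linear
  relation. The degree bound is the same for every \<open>h\<close>, which later bounds the
  denominators of all growth orders.\<close>

lemma reducible_algebraic: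
  assumes "reducible h"
  shows "\<exists>p. (\<exists>j\<le>card box. p j \<noteq> 0) \<and> (\<forall>k. (\<Sum>j\<le>card box. poly (p j) (t k) * h k ^ j) = 0)"
proof -
  have "\<forall>j. \<exists>e c. \<forall>k. t k ^ e * h k ^ j = (\<Sum>\<alpha>\<in>box. poly (c \<alpha>) (t k) * monomial \<alpha> (u k))"
    using reducible_power[OF assms] unfolding reducible_def by blast
  from choice[OF this] obtain e where
    "\<forall>j. \<exists>c. \<forall>k. t k ^ e j * h k ^ j = (\<Sum>\<alpha>\<in>box. poly (c \<alpha>) (t k) * monomial \<alpha> (u k))"
    by blast
  from choice[OF this] obtain C where
    C: "\<And>j k. t k ^ e j * h k ^ j = (\<Sum>\<alpha>\<in>box. poly (C j \<alpha>) (t k) * monomial \<alpha> (u k))"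
    by blast
  obtain x where x: "\<exists>j\<in>{..card box}. x j \<noteq> 0" "\<forall>\<alpha>\<in>box. (\<Sum>j\<le>card box. C j \<alpha> * x j) = 0"
    using homogeneous_system_nontrivial_solution[of box "{..card box}" "\<lambda>\<alpha> j. C j \<alpha>"] by auto
  have "(\<Sum>j\<le>card box. poly (x j * monom 1 (e j)) (t k) * h k ^ j) = 0" for k
  proof -
    have "(\<Sum>j\<le>card box. poly (x j * monom 1 (e j)) (t k) * h k ^ j) =
        (\<Sum>j\<le>card box. poly (x j) (t k) * (t k ^ e j * h k ^ j))"
      by (simp add: poly_monom mult_ac)
    also have "\<dots> = (\<Sum>j\<le>card box. \<Sum>\<alpha>\<in>box. poly (C j \<alpha> * x j) (t k) * monomial \<alpha> (u k))"
      unfolding C by (simp add: sum_distrib_left mult_ac)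
    also have "\<dots> = (\<Sum>\<alpha>\<in>box. poly (\<Sum>j\<le>card box. C j \<alpha> * x j) (t k) * monomial \<alpha> (u k))"
      by (subst sum.swap) (simp add: poly_sum sum_distrib_right)
    also have "\<dots> = 0" using x(2) by simp
    finally show ?thesis .
  qed
  then show ?thesis
    using x(1) by (intro exI[of _ "\<lambda>j. x j * monom 1 (e j)"]) auto
qed

end

section \<open>Orders of growth along an ultrafilter\<close>

lemma bigtheta_eventually_cong:
  assumes "f \<in> \<Theta>[F](g)" "eventually (\<lambda>x. f x = f' x) F" "eventually (\<lambda>x. g x = g' x) F"
  shows "f' \<in> \<Theta>[F](g')"
  using assms landau_theta.in_cong[OF assms(2)] landau_theta.cong[OF assms(3)] by simp

text \<open>Splitting off the zero at the origin leaves a factor whose limit is nonzero.\<close>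

lemma poly_bigtheta_power_order:
  fixes p :: "real poly"
  assumes "p \<noteq> 0" "(s \<longlongrightarrow> 0) F"
  shows "(\<lambda>k. poly p (s k)) \<in> \<Theta>[F](\<lambda>k. s k ^ order 0 p)"
proof -
  obtain q where q: "p = [:- 0, 1:] ^ order 0 p * q" "\<not> [:- 0, 1:] dvd q"
    using order_decomp[OF assms(1)] by blast
  have "poly q 0 \<noteq> 0" using q(2) by (simp add: poly_eq_0_iff_dvd)
  moreover have "((\<lambda>k. poly q (s k)) \<longlongrightarrow> poly q 0) F"
    using assms(2) by (intro tendsto_poly)
  ultimately have "(\<lambda>k. poly q (s k)) \<in> \<Theta>[F](\<lambda>_. 1)"
    by (intro bigthetaI_tendsto[of "poly q 0"]) auto
  then have "(\<lambda>k. s k ^ order 0 p * poly q (s k)) \<in> \<Theta>[F](\<lambda>k. s k ^ order 0 p * 1)"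
    by (rule landau_theta.mult[OF bigtheta_refl])
  moreover have "poly p x = x ^ order 0 p * poly q x" for x
    by (subst q(1)) simp
  ultimately show ?thesis by simp
qed

text \<open>
  In an algebraic relation, two terms of maximal size must be comparable; this forces every algebraic
  function of \<open>t\<close> to grow like a power of \<open>t\<close>.
\<close>

lemma two_dominant_terms:
  fixes a :: "'j \<Rightarrow> real"
  assumes "finite J" "J \<noteq> {}" "\<And>j. j \<in> J \<Longrightarrow> a j \<noteq> 0" "sum a J = 0"
  shows "\<exists>j\<in>J. \<exists>l\<in>J. j \<noteq> l \<and> \<bar>a j\<bar> \<le> card J * \<bar>a l\<bar> \<and> \<bar>a l\<bar> \<le> card J * \<bar>a j\<bar>"
proof -
  obtain j where j: "j \<in> J" "\<And>l. l \<in> J \<Longrightarrow> \<bar>a l\<bar> \<le> \<bar>a j\<bar>"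
  proof -
    have "Max ((\<lambda>j. \<bar>a j\<bar>) ` J) \<in> (\<lambda>j. \<bar>a j\<bar>) ` J" using assms(1,2) by (intro Max_in) auto
    then obtain j where "j \<in> J" "Max ((\<lambda>j. \<bar>a j\<bar>) ` J) = \<bar>a j\<bar>" by blast
    moreover have "\<bar>a l\<bar> \<le> Max ((\<lambda>j. \<bar>a j\<bar>) ` J)" if "l \<in> J" for l
      using assms(1) that by (intro Max_ge) auto
    ultimately show thesis using that by metis
  qed
  have c: "real (card J) \<ge> 1"
    using assms(1,2) by (simp add: Suc_leI card_gt_0_iff)
  have sj: "a j + sum a (J - {j}) = 0"
    using assms(1,4) j(1) by (simp add: sum.remove)
  \<comment> \<open>The other terms sum to \<open>- a j\<close>; if each were smaller than a
    \<open>card J\<close>-th part of it in modulus, \<open>card J - 1\<close> such parts would not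
    suffice.\<close>
  have "\<exists>l\<in>J - {j}. \<bar>a j\<bar> \<le> card J * \<bar>a l\<bar>"
  proof (rule ccontr)
    assume "\<not> ?thesis"
    then have lt: "card J * \<bar>a l\<bar> \<le> \<bar>a j\<bar>" if "l \<in> J - {j}" for l
      using that by force
    have "card J * \<bar>a j\<bar> = card J * \<bar>sum a (J - {j})\<bar>" 
    proof -
      have "a j = - sum a (J - {j})" using sj by linarith
      then show ?thesis by simp
    qed
    also have "\<dots> \<le> card J * (\<Sum>l\<in>J - {j}. \<bar>a l\<bar>)"
      by (intro mult_left_mono sum_abs) simp
    also have "\<dots> \<le> (\<Sum>l\<in>J - {j}. \<bar>a j\<bar>)"
      unfolding sum_distrib_left by (intro sum_mono lt)
    also have "\<dots> = (real (card J) - 1) * \<bar>a j\<bar>"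
      using assms(1) j(1) c by (simp add: of_nat_diff card_Diff_singleton)
    finally show False using assms(3)[OF j(1)] by (simp add: algebra_simps)
  qed
  then obtain l where l: "l \<in> J" "l \<noteq> j" "\<bar>a j\<bar> \<le> card J * \<bar>a l\<bar>" by blast
  have "\<bar>a l\<bar> \<le> card J * \<bar>a j\<bar>"
    using j(2)[OF l(1)] mult_right_mono[OF c abs_ge_zero[of "a j"]] by simp
  with j(1) l show ?thesis by blast
qed

section \<open>Growth orders of functions algebraic over R(t)\<close>

text \<open>\<open>R\<close> abstracts the reducible functions: a ring containing t and its inverse,
  all of whose elements are algebraic over R(t) of degree at most \<open>D\<close>. Along the
  ultrafilter \<open>U\<close> an element is either eventually zero or eventually nonzero.\<close>

locale tame_ring =
  fixes U :: "'i filter" and t :: "'i \<Rightarrow> real" and R :: "('i \<Rightarrow> real) \<Rightarrow> bool" and D :: nat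
  assumes U_nontrivial: "U \<noteq> bot"
    and ultra: "eventually P U \<or> eventually (\<lambda>k. \<not> P k) U"
    and t_pos: "t k > 0"
    and t_lim: "(t \<longlongrightarrow> 0) U"
    and R_add: "R g \<Longrightarrow> R h \<Longrightarrow> R (\<lambda>k. g k + h k)"
    and R_mult: "R g \<Longrightarrow> R h \<Longrightarrow> R (\<lambda>k. g k * h k)"
    and R_const: "R (\<lambda>_. a)"
    and R_t: "R t"
    and R_inverse_t: "R (\<lambda>k. inverse (t k))"
    and algebraic: "R h \<Longrightarrow>
      \<exists>p. (\<exists>j\<le>D. p j \<noteq> 0) \<and> (\<forall>k. (\<Sum>j\<le>D. poly (p j) (t k) * h k ^ j) = 0)"
begin

lemma t_nonzero [simp]: "t k \<noteq> 0"
  using t_pos[of k] by simp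

text \<open>An ultrafilter that contains a finite union contains one of the pieces; thus a finite
  choice that varies with \<open>k\<close> can be made constant.\<close>

lemma eventually_bex_finite:
  assumes "finite A" "eventually (\<lambda>k. \<exists>x\<in>A. P x k) U"
  shows "\<exists>x\<in>A. eventually (P x) U"
proof (rule ccontr)
  assume "\<not> ?thesis"
  then have "\<forall>x\<in>A. eventually (\<lambda>k. \<not> P x k) U" using ultra by blast
  with assms(1) have "eventually (\<lambda>k. \<forall>x\<in>A. \<not> P x k) U"
    by (simp add: eventually_ball_finite_distrib)
  then have "eventually (\<lambda>_. False) U" using assms(2) by eventually_elim blast
  then show False using U_nontrivial by (simp add: trivial_limit_def)
qed

text \<open>Compactness gives a cluster point of the image filter, and a cluster point of an
  ultrafilter is a limit.\<close>

lemma convergent_in_compact: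
  fixes x :: "'i \<Rightarrow> real"
  assumes "eventually (\<lambda>k. \<bar>x k\<bar> \<le> C) U"
  shows "\<exists>c. (x \<longlongrightarrow> c) U"
proof -
  have "filtermap x U \<noteq> bot" using U_nontrivial by (simp add: filtermap_bot_iff)
  moreover have "eventually (\<lambda>y. y \<in> {-C..C}) (filtermap x U)"
    using assms unfolding eventually_filtermap by (rule eventually_mono) auto
  ultimately obtain c where c: "inf (nhds c) (filtermap x U) \<noteq> bot"
    using compact_Icc[of "-C" C] unfolding compact_filter by blast
  have "eventually (\<lambda>k. x k \<in> S) U" if "open S" "c \<in> S" for S
  proof (rule ccontr)
    assume "\<not> ?thesis"
    then have "eventually (\<lambda>k. x k \<notin> S) U" using ultra by blast
    then have "eventually (\<lambda>y. y \<notin> S) (filtermap x U)" by (simp add: eventually_filtermap)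
    moreover have "eventually (\<lambda>y. y \<in> S) (nhds c)" using that by (rule eventually_nhds_in_open)
    ultimately have "eventually (\<lambda>_. False) (inf (nhds c) (filtermap x U))"
      unfolding eventually_inf by blast
    with c show False by (simp add: trivial_limit_def)
  qed
  then have "(x \<longlongrightarrow> c) U" by (intro topological_tendstoI)
  then show ?thesis by blast
qed

text \<open>Passing to \<open>inverse (t k)\<close>, which tends to infinity, makes the comparison
  of powers at infinity applicable.\<close>

lemma powr_t_eq: "t k powr r = inverse (t k) powr (- r)"
  using t_pos[of k] by (simp add: powr_minus inverse_powr)

lemma filterlim_inverse_t: "filterlim (\<lambda>k. inverse (t k)) at_top U"
  using t_lim t_pos by (intro filterlim_inverse_at_top) auto

lemma powr_t_bigo_iff: "(\<lambda>k. t k powr r) \<in> O[U](\<lambda>k. t k powr s) \<longleftrightarrow> s \<le> r"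
  unfolding powr_t_eq by (subst powr_bigo_iff[OF filterlim_inverse_t U_nontrivial]) auto

lemma powr_t_smallo_iff: "(\<lambda>k. t k powr r) \<in> o[U](\<lambda>k. t k powr s) \<longleftrightarrow> s < r"
  unfolding powr_t_eq by (subst powr_smallo_iff[OF filterlim_inverse_t U_nontrivial]) auto

lemma powr_t_bigtheta_iff: "(\<lambda>k. t k powr r) \<in> \<Theta>[U](\<lambda>k. t k powr s) \<longleftrightarrow> r = s"
  unfolding powr_t_eq by (subst powr_bigtheta_iff[OF filterlim_inverse_t U_nontrivial]) auto

lemma R_power: "R h \<Longrightarrow> R (\<lambda>k. h k ^ n)"
  by (induction n) (auto intro: R_mult R_const)

lemma R_poly: "R h \<Longrightarrow> R (\<lambda>k. poly p (h k))"
  by (induction p) (auto intro: R_add R_mult R_const)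

lemma R_cmult: "R h \<Longrightarrow> R (\<lambda>k. a * h k)"
  by (rule R_mult[OF R_const])

text \<open>Two terms of the algebraic relation with distinct exponents \<open>j < l\<close> are
  comparable. As \<open>poly (p j) (t k)\<close> grows like \<open>t k powr m j\<close>, this gives
  \<open>r = (m j - m l) / (l - j)\<close>, and \<open>l - j \<le> D\<close> divides
  \<open>fact D\<close>.\<close>

lemma bigtheta_powr_t_exists:
  assumes h: "R h" and nz: "\<not> eventually (\<lambda>k. h k = 0) U"
  shows "\<exists>r. r * fact D \<in> \<int> \<and> h \<in> \<Theta>[U](\<lambda>k. t k powr r)"
proof -
  have hn: "eventually (\<lambda>k. h k \<noteq> 0) U" using nz ultra by blast
  obtain p where p: "\<exists>j\<le>D. p j \<noteq> 0" "\<And>k. (\<Sum>j\<le>D. poly (p j) (t k) * h k ^ j) = 0"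
    using algebraic[OF h] by blast
  define J where "J = {j. j \<le> D \<and> p j \<noteq> 0}"
  have J: "finite J" "J \<noteq> {}" using p(1) by (auto simp: J_def)
  define a where "a = (\<lambda>j k. poly (p j) (t k) * h k ^ j)"
  define m where "m = (\<lambda>j. real (order 0 (p j)))"
  have pth: "(\<lambda>k. poly (p j) (t k)) \<in> \<Theta>[U](\<lambda>k. t k powr m j)" if "j \<in> J" for j
    using poly_bigtheta_power_order[OF _ t_lim, of "p j"] that t_pos
    by (simp add: J_def m_def powr_realpow)
  have "eventually (\<lambda>k. poly (p j) (t k) \<noteq> 0) U" if "j \<in> J" for j
    using eventually_nonzero_bigtheta[OF pth[OF that]] by simp
  then have "eventually (\<lambda>k. \<forall>j\<in>J. poly (p j) (t k) \<noteq> 0) U"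
    using J(1) by (simp add: eventually_ball_finite_distrib)
  \<comment> \<open>The dominant pair may change with \<open>k\<close>; being one of finitely many,
    it can be fixed along the ultrafilter.\<close>
  then have "eventually (\<lambda>k. \<exists>jl\<in>J \<times> J. fst jl \<noteq> snd jl \<and>
      \<bar>a (fst jl) k\<bar> \<le> card J * \<bar>a (snd jl) k\<bar> \<and> \<bar>a (snd jl) k\<bar> \<le> card J * \<bar>a (fst jl) k\<bar>) U"
    using hn
  proof eventually_elim
    case (elim k)
    have "(\<Sum>j\<in>J. a j k) = (\<Sum>j\<le>D. poly (p j) (t k) * h k ^ j)"
      unfolding a_def by (rule sum.mono_neutral_left) (auto simp: J_def)
    then have "(\<Sum>j\<in>J. a j k) = 0" using p(2) by simp
    then obtain j l where "j \<in> J" "l \<in> J" "j \<noteq> l" "\<bar>a j k\<bar> \<le> card J * \<bar>a l k\<bar>"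
        "\<bar>a l k\<bar> \<le> card J * \<bar>a j k\<bar>"
      using two_dominant_terms[OF J, of "\<lambda>j. a j k"] elim by (auto simp: a_def)
    then show ?case by (intro bexI[of _ "(j, l)"]) auto
  qed
  from eventually_bex_finite[OF finite_cartesian_product[OF J(1) J(1)] this]
  obtain i where i: "i \<in> J \<times> J" "eventually (\<lambda>k. fst i \<noteq> snd i \<and>
      \<bar>a (fst i) k\<bar> \<le> card J * \<bar>a (snd i) k\<bar> \<and> \<bar>a (snd i) k\<bar> \<le> card J * \<bar>a (fst i) k\<bar>) U"
    by blast
  define j l where "j = fst i" and "l = snd i"
  have jl: "j \<in> J" "l \<in> J" "j \<noteq> l"
    and ev: "eventually (\<lambda>k. \<bar>a j k\<bar> \<le> card J * \<bar>a l k\<bar> \<and> \<bar>a l k\<bar> \<le> card J * \<bar>a j k\<bar>) U"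
    using i by (auto simp: j_def l_def eventually_conj_iff eventually_const_iff U_nontrivial)
  have th: "a j \<in> \<Theta>[U](a l)"
  proof
    show "a j \<in> O[U](a l)"
      by (rule bigoI[of _ "card J"]) (use ev in \<open>auto elim: eventually_mono\<close>)
    have "a l \<in> O[U](a j)"
      by (rule bigoI[of _ "card J"]) (use ev in \<open>auto elim: eventually_mono\<close>)
    then show "a j \<in> \<Omega>[U](a l)" by (simp add: bigomega_iff_bigo)
  qed
  have "\<exists>j l. j \<in> J \<and> l \<in> J \<and> j < l \<and> a j \<in> \<Theta>[U](a l)"
    using jl th bigtheta_sym[of "a j" U "a l"] by (metis linorder_neqE_nat)
  then obtain j l where jl: "j \<in> J" "l \<in> J" "j < l" and th: "a j \<in> \<Theta>[U](a l)" by blast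
  have ath: "a i \<in> \<Theta>[U](\<lambda>k. t k powr m i * h k ^ i)" if "i \<in> J" for i
    unfolding a_def by (intro landau_theta.mult pth that bigtheta_refl)
  have "(\<lambda>k. t k powr m j * h k ^ j) \<in> \<Theta>[U](\<lambda>k. t k powr m l * h k ^ l)"
    by (rule landau_theta.trans[OF landau_theta.trans[OF iffD1[OF bigtheta_sym ath[OF jl(1)]] th]
          ath[OF jl(2)]])
  \<comment> \<open>Division by \<open>t k powr m l * h k ^ j\<close> isolates the power
    \<open>h k ^ (l - j)\<close>; the root is taken of absolute values because \<open>h\<close> may
    be negative.\<close>
  from landau_theta.mult[OF this bigtheta_refl, of "\<lambda>k. inverse (t k powr m l * h k ^ j)"]
  have "(\<lambda>k. t k powr (m j - m l)) \<in> \<Theta>[U](\<lambda>k. h k ^ (l - j))"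
  proof (rule bigtheta_eventually_cong)
    show "eventually (\<lambda>k. t k powr m j * h k ^ j * inverse (t k powr m l * h k ^ j) =
        t k powr (m j - m l)) U"
      using hn by eventually_elim (use t_pos in \<open>simp add: powr_diff field_simps\<close>)
    show "eventually (\<lambda>k. t k powr m l * h k ^ l * inverse (t k powr m l * h k ^ j) =
        h k ^ (l - j)) U"
      using hn
    proof eventually_elim
      case (elim k)
      have "h k ^ l = h k ^ j * h k ^ (l - j)"
        using jl(3) by (simp add: power_add[symmetric])
      then show ?case using elim t_pos[of k] by (simp add: field_simps)
    qed
  qed
  then have "(\<lambda>k. h k ^ (l - j)) \<in> \<Theta>[U](\<lambda>k. t k powr (m j - m l))"
    by (simp add: bigtheta_sym)
  from bigtheta_powr[OF this, of "1 / real (l - j)"]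
  have "(\<lambda>k. \<bar>h k\<bar>) \<in> \<Theta>[U](\<lambda>k. t k powr ((m j - m l) / real (l - j)))"
  proof (rule bigtheta_eventually_cong)
    show "eventually (\<lambda>k. \<bar>h k ^ (l - j)\<bar> powr (1 / real (l - j)) = \<bar>h k\<bar>) U"
      using hn
    proof eventually_elim
      case (elim k)
      then have "\<bar>h k ^ (l - j)\<bar> = \<bar>h k\<bar> powr real (l - j)"
        by (simp add: power_abs powr_realpow)
      then show ?case using jl(3) by (simp add: powr_powr)
    qed
    show "eventually (\<lambda>k. \<bar>t k powr (m j - m l)\<bar> powr (1 / real (l - j)) =
        t k powr ((m j - m l) / real (l - j))) U"
      by (simp add: powr_powr)
  qed
  then have "h \<in> \<Theta>[U](\<lambda>k. t k powr ((m j - m l) / real (l - j)))" by simp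
  moreover have "(m j - m l) / real (l - j) * fact D \<in> \<int>"
  proof -
    have "l - j dvd fact D" using jl by (intro dvd_fact) (auto simp: J_def)
    then obtain c where c: "fact D = (l - j) * c" by (auto simp: dvd_def)
    have "(fact D :: real) = real (l - j) * real c"
      using arg_cong[OF c, of real] by simp
    then have "(m j - m l) / real (l - j) * fact D = (m j - m l) * real c"
      using jl(3) by simp
    then show ?thesis by (simp add: m_def)
  qed
  ultimately show ?thesis by blast
qed

text \<open>The growth orders form a subgroup of the multiples of \<open>1 / fact D\<close> that
  contains 1, hence a cyclic group. Its least positive element \<open>s\<close> is a generator, and
  1 being a multiple of \<open>s\<close> gives \<open>q\<close>.\<close>

lemma uniformizer_exists:
  "\<exists>\<pi> s q. R \<pi> \<and> eventually (\<lambda>k. \<pi> k > 0) U \<and> \<pi> \<in> \<Theta>[U](\<lambda>k. t k powr s) \<and> s > 0 \<and>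
     q > 0 \<and> real q * s = 1 \<and>
     (\<forall>h. R h \<longrightarrow> \<not> eventually (\<lambda>k. h k = 0) U \<longrightarrow>
       (\<exists>m::int. h \<in> \<Theta>[U](\<lambda>k. t k powr (m * s))))"
proof -
  define V where "V = {r. \<exists>h. R h \<and> h \<in> \<Theta>[U](\<lambda>k. t k powr r)}"
  have V_add: "r + s \<in> V" if rs: "r \<in> V" "s \<in> V" for r s
  proof -
    obtain g h where "R g" "g \<in> \<Theta>[U](\<lambda>k. t k powr r)" "R h" "h \<in> \<Theta>[U](\<lambda>k. t k powr s)"
      using rs by (auto simp: V_def)
    then have "R (\<lambda>k. g k * h k)" "(\<lambda>k. g k * h k) \<in> \<Theta>[U](\<lambda>k. t k powr (r + s))"
      unfolding powr_add by (auto intro: R_mult landau_theta.mult)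
    then show ?thesis by (auto simp: V_def)
  qed
  have V0: "0 \<in> V"
    unfolding V_def by (intro CollectI exI[of _ "\<lambda>_. 1"] conjI R_const)
      simp
  have V1: "1 \<in> V"
    unfolding V_def by (intro CollectI exI[of _ t] conjI R_t)
      (use t_pos in \<open>simp add: less_imp_le\<close>)
  have Vm1: "-1 \<in> V"
    unfolding V_def by (intro CollectI exI[of _ "\<lambda>k. inverse (t k)"] conjI R_inverse_t)
      (use t_pos in \<open>simp add: powr_minus less_imp_le\<close>)
  have V_mult: "real n * r \<in> V" if "r \<in> V" for r n
  proof (induction n)
    case (Suc n)
    have "real (Suc n) * r = r + real n * r" by (simp add: algebra_simps)
    then show ?case using V_add[OF that Suc] by metis
  qed (simp add: V0)
  have V_int: "r * fact D \<in> \<int>" if "r \<in> V" for r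
  proof -
    obtain h where h: "R h" "h \<in> \<Theta>[U](\<lambda>k. t k powr r)" using \<open>r \<in> V\<close> by (auto simp: V_def)
    have "eventually (\<lambda>k. h k \<noteq> 0) U"
      using eventually_nonzero_bigtheta[OF h(2)] by simp
    then have "\<not> eventually (\<lambda>k. h k = 0) U"
    proof (rule contrapos_pn)
      assume "eventually (\<lambda>k. h k = 0) U"
      then have "eventually (\<lambda>_. False) U"
        using \<open>eventually (\<lambda>k. h k \<noteq> 0) U\<close> by eventually_elim simp
      then show "\<not> eventually (\<lambda>k. h k \<noteq> 0) U" using U_nontrivial by (simp add: trivial_limit_def)
    qed
    from bigtheta_powr_t_exists[OF h(1) this] obtain r' where
      r': "r' * fact D \<in> \<int>" "h \<in> \<Theta>[U](\<lambda>k. t k powr r')" by blast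
    have "(\<lambda>k. t k powr r) \<in> \<Theta>[U](\<lambda>k. t k powr r')"
      by (rule landau_theta.trans[OF iffD1[OF bigtheta_sym h(2)] r'(2)])
    then show ?thesis using r'(1) by (simp add: powr_t_bigtheta_iff)
  qed
  \<comment> \<open>Numerators over the common denominator \<open>fact D\<close>, so that the least
    positive order is found as a least natural number.\<close>
  define P where "P = (\<lambda>n::nat. n > 0 \<and> real n / fact D \<in> V)"
  have "P (fact D)" using V1 by (simp add: P_def)
  then have L: "P (LEAST n. P n)" by (rule LeastI)
  define n0 where "n0 = (LEAST n. P n)"
  define s where "s = real n0 / fact D"
  have n0: "n0 > 0" "s \<in> V" using L by (auto simp: P_def n0_def s_def)
  have s: "s > 0" using n0(1) by (simp add: s_def)
  \<comment> \<open>The ring is assumed to contain the inverse of \<open>t\<close> only; so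
    \<open>- s\<close> is composed of multiples of \<open>s\<close> and of the order -1 of
    \<open>inverse (t k)\<close>, using \<open>fact D * s = n0\<close>.\<close>
  have "real (fact D - 1) * s + real n0 * (-1) = - s"
    by (simp add: s_def of_nat_diff field_simps)
  then have ms: "- s \<in> V" using V_add[OF V_mult[OF n0(2)] V_mult[OF Vm1]] by metis
  \<comment> \<open>Division with remainder: \<open>r - m * s\<close> is an order in the interval
    from 0 to below \<open>s\<close>, so it vanishes by minimality of \<open>n0\<close>.\<close>
  have mult: "\<exists>m::int. r = m * s" if r: "r \<in> V" for r
  proof -
    define m where "m = \<lfloor>r / s\<rfloor>"
    have "r - m * s \<in> V"
    proof (cases "m \<ge> 0")
      case True
      then have "r - m * s = r + real (nat m) * (- s)" by simp
      then show ?thesis using V_add[OF r V_mult[OF ms]] by metis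
    next
      case False
      then have "r - m * s = r + real (nat (- m)) * s" by simp
      then show ?thesis using V_add[OF r V_mult[OF n0(2)]] by metis
    qed
    note rm = this
    have "m \<le> r / s" "r / s < m + 1" unfolding m_def by linarith+
    then have bd: "0 \<le> r - m * s" "r - m * s < s" using s by (auto simp: field_simps)
    obtain z :: int where z: "(r - m * s) * fact D = z" using V_int[OF rm] by (auto elim: Ints_cases)
    have "0 \<le> z" using z bd(1) by (metis fact_ge_zero mult_nonneg_nonneg of_int_0_le_iff)
    then have zn: "(r - m * s) = real (nat z) / fact D" using z by (simp add: field_simps)
    have "real (nat z) / fact D < s" using bd(2) by (simp only: zn)
    then have "nat z < n0" by (simp add: s_def divide_less_cancel)
    then have "\<not> P (nat z)" unfolding n0_def by (rule not_less_Least)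
    then have "\<not> nat z > 0" using rm unfolding zn P_def by metis
    then have "r = m * s" using zn by simp
    then show ?thesis by blast
  qed
  obtain m :: int where m: "1 = m * s" using mult[OF V1] by blast
  have "m > 0" using m s by (smt (verit, best) mult_nonpos_nonneg of_int_le_0_iff)
  then have q: "nat m > 0" "real (nat m) * s = 1" using m by auto
  obtain h where h: "R h" "h \<in> \<Theta>[U](\<lambda>k. t k powr s)" using n0(2) by (auto simp: V_def)
  have hn: "eventually (\<lambda>k. h k \<noteq> 0) U"
    using eventually_nonzero_bigtheta[OF h(2)] by simp
  \<comment> \<open>The sign of \<open>h\<close> is eventually constant along the ultrafilter, so
    \<open>h\<close> or its negative is a positive uniformizer.\<close>
  have "\<exists>\<pi>. R \<pi> \<and> eventually (\<lambda>k. \<pi> k > 0) U \<and> \<pi> \<in> \<Theta>[U](\<lambda>k. t k powr s)"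
  proof (cases "eventually (\<lambda>k. h k > 0) U")
    case True
    then show ?thesis using h by blast
  next
    case False
    then have "eventually (\<lambda>k. \<not> h k > 0) U" using ultra by blast
    then have "eventually (\<lambda>k. -1 * h k > 0) U" using hn by eventually_elim auto
    moreover have "(\<lambda>k. -1 * h k) \<in> \<Theta>[U](\<lambda>k. t k powr s)" using h(2) by simp
    ultimately show ?thesis using R_cmult[OF h(1), of "-1"] by blast
  qed
  then obtain \<pi> where \<pi>: "R \<pi>" "eventually (\<lambda>k. \<pi> k > 0) U" "\<pi> \<in> \<Theta>[U](\<lambda>k. t k powr s)"
    by blast
  have "\<exists>m::int. h \<in> \<Theta>[U](\<lambda>k. t k powr (m * s))"
    if hh: "R h" "\<not> eventually (\<lambda>k. h k = 0) U" for h
  proof -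
    obtain r where r: "h \<in> \<Theta>[U](\<lambda>k. t k powr r)" using bigtheta_powr_t_exists[OF hh] by blast
    then have "r \<in> V" using hh(1) by (auto simp: V_def)
    then show ?thesis using mult r by blast
  qed
  then show ?thesis using \<pi> s q by blast
qed

end

section \<open>Expansions in powers of a uniformizer\<close>

text \<open>The analogue of a discrete valuation: \<open>\<pi>\<close> has the least positive growth
  order \<open>s\<close>, and every element that is not eventually zero has an order in the
  multiples of \<open>s\<close>.\<close>

locale uniformized_ring = tame_ring U t R D
  for U :: "'i filter" and t R D +
  fixes \<pi> :: "'i \<Rightarrow> real" and s :: real
  assumes R_uniformizer: "R \<pi>"
    and uniformizer_pos: "eventually (\<lambda>k. \<pi> k > 0) U"
    and uniformizer_bigtheta: "\<pi> \<in> \<Theta>[U](\<lambda>k. t k powr s)"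
    and s_pos: "s > 0"
    and value_group: "R h \<Longrightarrow> \<not> eventually (\<lambda>k. h k = 0) U \<Longrightarrow>
      \<exists>m::int. h \<in> \<Theta>[U](\<lambda>k. t k powr (m * s))"
begin

lemma uniformizer_power_bigtheta: "(\<lambda>k. \<pi> k ^ M) \<in> \<Theta>[U](\<lambda>k. t k powr (real M * s))"
proof (induction M)
  case 0
  then show ?case by simp
next
  case (Suc M)
  have "real (Suc M) * s = s + real M * s" by (simp add: algebra_simps)
  then show ?case using landau_theta.mult[OF uniformizer_bigtheta Suc] by (simp add: powr_add)
qed

lemma uniformizer_lim: "(\<pi> \<longlongrightarrow> 0) U"
proof -
  have "\<pi> \<in> O[U](\<lambda>k. t k powr s)" using uniformizer_bigtheta by blast
  moreover have "(\<lambda>k. t k powr s) \<in> o[U](\<lambda>k. t k powr 0)" using s_pos by (simp only: powr_t_smallo_iff)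
  ultimately have "\<pi> \<in> o[U](\<lambda>k. t k powr 0)" by (rule landau_o.big_small_trans)
  from smalloD_tendsto[OF this] show ?thesis by simp
qed

text \<open>The next coefficient is the limit of the bounded quotient
  \<open>g k / \<pi> k ^ M\<close>. Removing it makes the remainder strictly smaller than
  \<open>\<pi> k ^ M\<close>, and since orders are multiples of \<open>s\<close>, the gain is a full
  factor \<open>t k powr s\<close>.\<close>

lemma uniformizer_expansion:
  assumes h: "R h" and bdd: "h \<in> O[U](\<lambda>_. 1)"
  shows "\<exists>T. (\<lambda>k. h k - poly T (\<pi> k)) \<in> O[U](\<lambda>k. t k powr (real M * s))"
proof (induction M)
  case 0
  then show ?case
    using bdd t_pos by (intro exI[of _ 0]) simp
next
  case (Suc M)
  then obtain T where T: "(\<lambda>k. h k - poly T (\<pi> k)) \<in> O[U](\<lambda>k. t k powr (real M * s))" by blast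
  define g where "g = (\<lambda>k. h k - poly T (\<pi> k))"
  have Rg: "R g"
    using R_add[OF h R_cmult[OF R_poly[OF R_uniformizer], of "-1" T]] by (simp add: g_def)
  have "g \<in> O[U](\<lambda>k. \<pi> k ^ M)"
    using landau_o.big.trans[OF T bigthetaD1[OF iffD1[OF bigtheta_sym uniformizer_power_bigtheta]]]
    by (simp add: g_def)
  then obtain C where C: "eventually (\<lambda>k. norm (g k) \<le> C * norm (\<pi> k ^ M)) U"
    using landau_o.bigE by blast
  have "eventually (\<lambda>k. \<bar>g k / \<pi> k ^ M\<bar> \<le> C) U"
    using C uniformizer_pos by eventually_elim (simp add: field_simps)
  from convergent_in_compact[OF this] obtain c where c: "((\<lambda>k. g k / \<pi> k ^ M) \<longlongrightarrow> c) U"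
    by blast
  define g' where "g' = (\<lambda>k. g k + - c * \<pi> k ^ M)"
  have Rg': "R g'"
    unfolding g'_def by (intro R_add Rg R_cmult R_power R_uniformizer)
  have "((\<lambda>k. g' k / \<pi> k ^ M) \<longlongrightarrow> 0) U"
  proof (rule Lim_transform_eventually)
    show "((\<lambda>k. g k / \<pi> k ^ M - c) \<longlongrightarrow> 0) U" using c by (simp add: LIM_zero)
    show "eventually (\<lambda>k. g k / \<pi> k ^ M - c = g' k / \<pi> k ^ M) U"
      using uniformizer_pos by eventually_elim (simp add: g'_def field_simps)
  qed
  then have "g' \<in> o[U](\<lambda>k. \<pi> k ^ M)"
  proof (rule smalloI_tendsto)
    show "eventually (\<lambda>k. \<pi> k ^ M \<noteq> 0) U"
      using uniformizer_pos by (rule eventually_mono) simp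
  qed
  then have small: "g' \<in> o[U](\<lambda>k. t k powr (real M * s))"
    by (rule landau_o.small_big_trans[OF _ bigthetaD1[OF uniformizer_power_bigtheta]])
  have "g' \<in> O[U](\<lambda>k. t k powr (real (Suc M) * s))"
  proof (cases "eventually (\<lambda>k. g' k = 0) U")
    case True
    then show ?thesis by (intro bigoI[of _ 0]) (auto elim: eventually_mono)
  next
    case False
    then obtain m :: int where m: "g' \<in> \<Theta>[U](\<lambda>k. t k powr (m * s))"
      using value_group[OF Rg'] by blast
    then have "(\<lambda>k. t k powr (m * s)) \<in> o[U](\<lambda>k. t k powr (real M * s))"
      using landau_o.big_small_trans[OF bigthetaD1[OF iffD1[OF bigtheta_sym m]] small] by simp
    then have "real M < m" using s_pos by (simp add: powr_t_smallo_iff)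
    then have "int (Suc M) \<le> m" by linarith
    then have "real (Suc M) \<le> m" by (metis of_int_le_iff of_int_of_nat_eq)
    then have "real (Suc M) * s \<le> m * s" using s_pos by (simp add: mult_right_mono)
    then have "(\<lambda>k. t k powr (m * s)) \<in> O[U](\<lambda>k. t k powr (real (Suc M) * s))"
      by (simp only: powr_t_bigo_iff)
    then show ?thesis by (rule landau_o.big.trans[OF bigthetaD1[OF m]])
  qed
  moreover have "g' = (\<lambda>k. h k - poly (T + monom c M) (\<pi> k))"
    by (simp add: g'_def g_def poly_monom fun_eq_iff)
  ultimately have "(\<lambda>k. h k - poly (T + monom c M) (\<pi> k)) \<in> O[U](\<lambda>k. t k powr (real (Suc M) * s))"
    by simp
  then show ?case by blast
qed

end

section \<open>Sequences violating the gradient inequality\<close>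

lemma (in tame_ring) bigo_sqrt:
  assumes "(\<lambda>k. (x k)\<^sup>2) \<in> O[U](\<lambda>k. t k powr r)"
  shows "x \<in> O[U](\<lambda>k. t k powr (r / 2))"
proof -
  have "(\<lambda>k. \<bar>(x k)\<^sup>2\<bar> powr (1/2)) \<in> O[U](\<lambda>k. \<bar>t k powr r\<bar> powr (1/2))"
    using assms by (rule bigo_powr) simp
  moreover have "\<bar>(x k)\<^sup>2\<bar> powr (1/2) = \<bar>x k\<bar>" for k
    by (simp add: powr_half_sqrt)
  moreover have "\<bar>t k powr r\<bar> powr (1/2) = t k powr (r / 2)" for k
    by (simp add: powr_powr)
  ultimately show ?thesis by simp
qed

lemma bigo_sum:
  fixes f :: "'b \<Rightarrow> 'a \<Rightarrow> real"
  assumes "finite I" "\<And>i. i \<in> I \<Longrightarrow> f i \<in> O[F](g)"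
  shows "(\<lambda>k. \<Sum>i\<in>I. f i k) \<in> O[F](g)"
  using assms by (induction rule: finite_induct) (auto intro!: sum_in_bigo)

lemma bigo_norm_Basis:
  fixes x :: "'b \<Rightarrow> 'a::euclidean_space"
  assumes "\<And>b. b \<in> Basis \<Longrightarrow> (\<lambda>k. x k \<bullet> b) \<in> O[F](g)"
  shows "(\<lambda>k. norm (x k)) \<in> O[F](g :: 'b \<Rightarrow> real)"
proof (rule landau_o.big.trans)
  show "(\<lambda>k. norm (x k)) \<in> O[F](\<lambda>k. \<Sum>b\<in>Basis. \<bar>x k \<bullet> b\<bar>)"
    by (rule bigoI[of _ 1]) (auto intro!: always_eventually norm_le_l1 order_trans[OF _ abs_ge_self])
  show "(\<lambda>k. \<Sum>b\<in>Basis. \<bar>x k \<bullet> b\<bar>) \<in> O[F](g)"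
    using assms by (intro bigo_sum) auto
qed

lemma deg_le_common:
  assumes "finite S" "\<And>f. f \<in> S \<Longrightarrow> real_polynomial_function f"
  shows "\<exists>d. \<forall>f\<in>S. deg_le d (f :: 'a::euclidean_space \<Rightarrow> real)"
  using assms
proof (induction rule: finite_induct)
  case (insert f S)
  obtain d where d: "\<forall>g\<in>S. deg_le d g" using insert by auto
  obtain e where e: "deg_le e f" using real_polynomial_function_deg_le insert.prems by blast
  have "\<forall>g\<in>insert f S. deg_le (max d e) g"
    using d deg_le_mono[OF e, of "max d e"] deg_le_mono[of d _ "max d e"] by auto
  then show ?case by blast
qed simp

lemma real_polynomial_function_poly: "real_polynomial_function (poly (p :: real poly))"
proof (induction p)
  case 0
  have "poly (0 :: real poly) = (\<lambda>_. 0)" by auto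
  then show ?case using real_polynomial_function.intros(2)[of 0] by simp
next
  case (pCons a p)
  have "real_polynomial_function (\<lambda>x::real. a + x * poly p x)"
    using pCons by (intro real_polynomial_function.intros(3)[OF real_polynomial_function.intros(2)]
        real_polynomial_function.intros(4)[OF real_polynomial_function.intros(1)[OF bounded_linear_ident]])
  then show ?case by (simp add: poly_pCons[abs_def])
qed

lemma real_polynomial_function_eq_poly:
  fixes f :: "real \<Rightarrow> real"
  assumes "real_polynomial_function f"
  shows "\<exists>p. \<forall>x. f x = poly p x"
proof -
  obtain a n where "f = (\<lambda>x. \<Sum>i\<le>n. a i * x ^ i)"
    using real_polynomial_function_imp_sum[OF assms] by blast
  then show ?thesis
    by (intro exI[of _ "\<Sum>i\<le>n. monom (a i) i"]) (simp add: poly_sum poly_monom)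
qed

text \<open>The even powers control the coordinates, so the sublevel set of the value
  \<open>f 0\<close> is bounded, hence compact.\<close>

lemma coercive_attains_inf:
  fixes f :: "'a::euclidean_space \<Rightarrow> real"
  assumes "continuous_on UNIV f" "a > 0" "n > 0" "\<And>u. a * (\<Sum>b\<in>Basis. (u \<bullet> b) ^ (2 * n)) \<le> f u"
  shows "\<exists>u. \<forall>v. f u \<le> f v"
proof -
  define S where "S = {u. f u \<le> f 0}"
  define c where "c = f 0 / a"
  have "norm u \<le> (\<Sum>b\<in>(Basis :: 'a set). c + 1)" if "u \<in> S" for u
  proof -
    have nn: "(u \<bullet> b) ^ (2 * n) \<ge> 0" for b by (simp add: power_mult)
    have bd: "\<bar>u \<bullet> b\<bar> \<le> c + 1" if b: "b \<in> Basis" for b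
    proof -
      have "a * (u \<bullet> b) ^ (2 * n) \<le> a * (\<Sum>b\<in>Basis. (u \<bullet> b) ^ (2 * n))"
        using assms(2) nn b by (intro mult_left_mono member_le_sum) auto
      also have "\<dots> \<le> f 0" using assms(4)[of u] \<open>u \<in> S\<close> by (simp add: S_def)
      finally have le: "(u \<bullet> b) ^ (2 * n) \<le> c" using assms(2) by (simp add: c_def field_simps)
      show ?thesis
      proof (cases "\<bar>u \<bullet> b\<bar> \<le> 1")
        case True
        then show ?thesis using le nn[of b] by linarith
      next
        case False
        then have "\<bar>u \<bullet> b\<bar> ^ 1 \<le> \<bar>u \<bullet> b\<bar> ^ (2 * n)" using assms(3) by (intro power_increasing) auto
        also have "\<dots> = (u \<bullet> b) ^ (2 * n)" by (simp add: power_mult)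
        finally show ?thesis using le by simp
      qed
    qed
    show ?thesis by (rule order_trans[OF norm_le_l1]) (intro sum_mono bd)
  qed
  then have "bounded S" by (auto simp: bounded_iff)
  moreover have "closed S"
    unfolding S_def using assms(1) by (intro closed_Collect_le) auto
  ultimately have "compact S" by (simp add: compact_eq_bounded_closed)
  moreover have "S \<noteq> {}" by (auto simp: S_def)
  moreover have "continuous_on S f" using assms(1) by (rule continuous_on_subset) simp
  ultimately obtain u where u: "u \<in> S" "\<forall>v\<in>S. f u \<le> f v"
    using continuous_attains_inf by blast
  then have "f u \<le> f v" for v
    using u by (cases "v \<in> S") (auto simp: S_def)
  then show ?thesis by blast
qed

text \<open>Bookkeeping of orders: the minimum of \<open>\<Psi> k\<close> is
  \<open>O(t powr (4 - s))\<close>, hence \<open>f (u k) - t k\<close> is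
  \<open>O(t powr (2 - s / 2))\<close> and the gradient at \<open>u k\<close> is
  \<open>O(t powr (1 - s / 2))\<close>. Along the curve \<open>X\<close> the derivative of
  \<open>f\<close> is comparable to \<open>t powr (1 - s)\<close>, which is larger.\<close>

lemma no_sequence_violating_lojasiewicz:
  fixes f :: "'a::euclidean_space \<Rightarrow> real"
  assumes f: "real_polynomial_function f" and D: "polynomial_function D"
    and grad: "\<And>u. (f has_derivative (\<lambda>h. D u \<bullet> h)) (at u)"
    and w_bdd: "\<And>k. norm (w k) \<le> B"
    and t_pos: "\<And>k. f (w k) > 0" and t_lim: "(\<lambda>k. f (w k)) \<longlonglongrightarrow> 0"
    and small: "\<And>e. e > 0 \<Longrightarrow> \<forall>\<^sub>F k in sequentially. norm (D (w k)) \<le> f (w k) powr (1 - e)"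
  shows False
proof -
  define t where "t = (\<lambda>k. f (w k))"
  have tp: "t k > 0" and tn: "t k \<noteq> 0" for k using t_pos[of k] by (auto simp: t_def)
  have "\<forall>c\<in>Basis. \<exists>E. polynomial_function E \<and> (\<forall>u. ((\<lambda>u. D u \<bullet> c) has_derivative (\<lambda>h. E u \<bullet> h)) (at u))"
    using D by (intro ballI polynomial_gradient) (simp add: polynomial_function_iff_Basis_inner)
  from bchoice[OF this] obtain E where E: "\<And>c. c \<in> Basis \<Longrightarrow> polynomial_function (E c)"
    "\<And>c u. c \<in> Basis \<Longrightarrow> ((\<lambda>u. D u \<bullet> c) has_derivative (\<lambda>h. E c u \<bullet> h)) (at u)"
    by blast
  define S where "S = insert f ((\<lambda>b u. D u \<bullet> b) ` Basis \<union> (\<lambda>(c, b) u. E c u \<bullet> b) ` (Basis \<times> Basis))"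
  have "finite S" by (simp add: S_def)
  moreover have "real_polynomial_function g" if "g \<in> S" for g
    using that f D E(1) unfolding S_def by (auto simp: polynomial_function_iff_Basis_inner)
  ultimately obtain d where "\<forall>g\<in>S. deg_le d g" using deg_le_common by blast
  then have d: "deg_le d f" "\<And>b. b \<in> Basis \<Longrightarrow> deg_le d (\<lambda>u. D u \<bullet> b)"
    "\<And>c b. c \<in> Basis \<Longrightarrow> b \<in> Basis \<Longrightarrow> deg_le d (\<lambda>u. E c u \<bullet> b)"
    by (auto simp: S_def)
  \<comment> \<open>At \<open>w k\<close> the first term vanishes and, up to a constant, the other
    two are eventually at most \<open>t k powr (4 - s)\<close>; this explains the weights. The power
    \<open>2 * (d + 1)\<close> has a derivative of degree \<open>2 * d + 1\<close>, above the degree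
    bound \<open>2 * d\<close> for the rest of the gradient.\<close>
  define \<Psi> where "\<Psi> = (\<lambda>k u. (f u - t k)\<^sup>2 + (t k)\<^sup>2 * (\<Sum>c\<in>Basis. (D u \<bullet> c)\<^sup>2) +
      t k ^ 4 * (\<Sum>b\<in>Basis. (u \<bullet> b) ^ (2 * (d + 1))))"
  have normD: "(\<Sum>c\<in>Basis. (D u \<bullet> c)\<^sup>2) = (norm (D u))\<^sup>2" for u
    unfolding power2_norm_eq_inner by (subst euclidean_inner) (simp add: power2_eq_square)
  have even: "(x::real) ^ (2 * (d + 1)) \<ge> 0" for x by (subst power_mult) simp
  have \<Psi>_ge: "(f u - t k)\<^sup>2 \<le> \<Psi> k u" "(t k)\<^sup>2 * (norm (D u))\<^sup>2 \<le> \<Psi> k u"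
    "t k ^ 4 * (\<Sum>b\<in>Basis. (u \<bullet> b) ^ (2 * (d + 1))) \<le> \<Psi> k u" for k u
    using tp[of k] even by (auto simp: \<Psi>_def normD sum_nonneg)
  have contf: "continuous_on UNIV f" and contD: "continuous_on UNIV D"
    using f D by (auto intro: continuous_on_polymonial_function simp: real_polynomial_function_eq)
  have "\<exists>u. \<forall>v. \<Psi> k u \<le> \<Psi> k v" for k
  proof (rule coercive_attains_inf)
    show "continuous_on UNIV (\<Psi> k)"
      unfolding \<Psi>_def by (intro continuous_intros contf contD)
    show "t k ^ 4 * (\<Sum>b\<in>Basis. (u \<bullet> b) ^ (2 * (d + 1))) \<le> \<Psi> k u" for u by (rule \<Psi>_ge)
    show "t k ^ 4 > 0" using tp[of k] by simp
  qed simp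
  then obtain u where u: "\<And>k v. \<Psi> k (u k) \<le> \<Psi> k v" by metis
  have crit: "2 * (f (u k) - t k) * (D (u k) \<bullet> b) +
      (t k)\<^sup>2 * (\<Sum>c\<in>Basis. 2 * (D (u k) \<bullet> c) * (E c (u k) \<bullet> b)) +
      t k ^ 4 * (real (2 * (d + 1)) * (u k \<bullet> b) ^ (2 * d + 1)) = 0"
    if b: "b \<in> Basis" for k b
  proof -
    have "(\<Psi> k has_derivative (\<lambda>h. 2 * (f (u k) - t k) * (D (u k) \<bullet> h) +
      (t k)\<^sup>2 * (\<Sum>c\<in>Basis. 2 * (D (u k) \<bullet> c) * (E c (u k) \<bullet> h)) +
      t k ^ 4 * (\<Sum>c\<in>Basis. real (2 * (d + 1)) * (u k \<bullet> c) ^ (2 * d + 1) * (h \<bullet> c)))) (at (u k))"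
      unfolding \<Psi>_def
      by (rule derivative_eq_intros grad E(2) | assumption | rule refl ext)+
         (simp add: algebra_simps)
    from differential_zero_maxmin[OF _ open_UNIV this] u
    have "2 * (f (u k) - t k) * (D (u k) \<bullet> b) +
      (t k)\<^sup>2 * (\<Sum>c\<in>Basis. 2 * (D (u k) \<bullet> c) * (E c (u k) \<bullet> b)) +
      t k ^ 4 * (\<Sum>c\<in>Basis. real (2 * (d + 1)) * (u k \<bullet> c) ^ (2 * d + 1) * (b \<bullet> c)) = 0"
      by (simp add: fun_eq_iff)
    moreover have "(\<Sum>c\<in>Basis. real (2 * (d + 1)) * (u k \<bullet> c) ^ (2 * d + 1) * (b \<bullet> c)) =
        (\<Sum>c\<in>Basis. if c = b then real (2 * (d + 1)) * (u k \<bullet> b) ^ (2 * d + 1) else 0)"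
      using b by (intro sum.cong) (auto simp: inner_Basis)
    ultimately show ?thesis using b by simp
  qed
  \<comment> \<open>The coefficients of \<open>t ^ 0\<close>, \<open>t ^ 1\<close> and
    \<open>t ^ 2\<close> in the critical point equation after moving the penalty term to the other
    side and dividing by \<open>2 * (d + 1)\<close>.\<close>
  define r where "r = (\<lambda>b (i::nat) u. if i = 0 then - 1 / (d + 1) * (f u * (D u \<bullet> b))
      else if i = 1 then 1 / (d + 1) * (D u \<bullet> b)
      else - 1 / (d + 1) * (\<Sum>c\<in>Basis. (D u \<bullet> c) * (E c u \<bullet> b)))"
  have deg_r: "deg_le (2 * d + 1 - 1) (r b i)" if b: "b \<in> Basis" for b i
  proof -
    have "deg_le (d + d) (\<lambda>u. - 1 / (d + 1) * (f u * (D u \<bullet> b)))"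
      by (intro deg_le_cmult deg_le_mult d b)
    moreover have "deg_le (d + d) (\<lambda>u. 1 / (d + 1) * (D u \<bullet> b))"
      by (intro deg_le_cmult deg_le_mono[OF d(2)[OF b]]) simp
    moreover have "deg_le (d + d) (\<lambda>u. - 1 / (d + 1) * (\<Sum>c\<in>Basis. (D u \<bullet> c) * (E c u \<bullet> b)))"
      by (intro deg_le_cmult deg_le_sum deg_le_mult d b) auto
    ultimately show ?thesis
      by (cases "i = 0"; cases "i = 1") (simp_all add: r_def mult_2)
  qed
  interpret reducing_sequence t u "2 * d + 1" r
  proof
    fix k b assume b: "b \<in> (Basis :: 'a set)"
    have "(\<Sum>i\<le>2. t k ^ i * r b i (u k)) = r b 0 (u k) + t k * r b 1 (u k) + (t k)\<^sup>2 * r b 2 (u k)"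
      by (simp add: numeral_2_eq_2)
    also have "\<dots> = (t k * (D (u k) \<bullet> b) - f (u k) * (D (u k) \<bullet> b) -
        (t k)\<^sup>2 * (\<Sum>c\<in>Basis. (D (u k) \<bullet> c) * (E c (u k) \<bullet> b))) / real (d + 1)"
      by (simp add: r_def diff_divide_distrib)
    also have "t k * (D (u k) \<bullet> b) - f (u k) * (D (u k) \<bullet> b) -
        (t k)\<^sup>2 * (\<Sum>c\<in>Basis. (D (u k) \<bullet> c) * (E c (u k) \<bullet> b)) =
        real (d + 1) * (t k ^ 4 * (u k \<bullet> b) ^ (2 * d + 1))"
    proof -
      have "(\<Sum>c\<in>Basis. 2 * (D (u k) \<bullet> c) * (E c (u k) \<bullet> b)) =
          2 * (\<Sum>c\<in>Basis. (D (u k) \<bullet> c) * (E c (u k) \<bullet> b))"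
        by (simp add: sum_distrib_left mult.assoc)
      moreover have "real (2 * (d + 1)) = 2 * real (d + 1)" by simp
      moreover have "S' = 2 * S \<Longrightarrow> d2 = 2 * d1 \<Longrightarrow> 2 * (x - y) * z + y\<^sup>2 * S' + y ^ 4 * (d2 * P) = 0 \<Longrightarrow>
          y * z - x * z - y\<^sup>2 * S = d1 * (y ^ 4 * P)" for S S' d1 d2 x y z P :: real
        by (simp add: algebra_simps)
      ultimately show ?thesis using crit[OF b, of k] by blast
    qed
    also have "\<dots> / real (d + 1) = t k ^ 4 * (u k \<bullet> b) ^ (2 * d + 1)"
      by (rule nonzero_mult_div_cancel_left) simp
    finally show "t k ^ 4 * (u k \<bullet> b) ^ (2 * d + 1) = (\<Sum>i\<le>2. t k ^ i * r b i (u k))" ..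
  qed (use tp deg_r in auto)
  obtain U where U: "U \<le> sequentially" "U \<noteq> bot"
    "\<And>P. eventually P U \<or> eventually (\<lambda>x. \<not> P x) U"
    using ultrafilter_below[of sequentially] by auto
  have tU: "(t \<longlongrightarrow> 0) U" using t_lim U(1) unfolding t_def by (rule tendsto_mono[rotated])
  interpret tame_ring U t reducible "card box"
    by unfold_locales (use U tp tU reducible_add reducible_mult reducible_const reducible_t
        reducible_inverse_t reducible_algebraic in auto)
  obtain \<pi> s q where \<pi>: "reducible \<pi>" "eventually (\<lambda>k. \<pi> k > 0) U" "\<pi> \<in> \<Theta>[U](\<lambda>k. t k powr s)"
    "s > 0" "q > (0::nat)" "real q * s = 1"
    "\<And>h. reducible h \<Longrightarrow> \<not> eventually (\<lambda>k. h k = 0) U \<Longrightarrow>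
       \<exists>m::int. h \<in> \<Theta>[U](\<lambda>k. t k powr (m * s))"
    using uniformizer_exists by blast
  interpret uniformized_ring U t reducible "card box" \<pi> s
    by unfold_locales (use \<pi> in auto)
  have s1: "s \<le> 1"
  proof -
    have "1 * s \<le> real q * s" using \<pi>(4,5) by (intro mult_right_mono) auto
    then show ?thesis using \<pi>(6) by simp
  qed
  \<comment> \<open>The minimizer is compared with \<open>w k\<close>, the bound on the gradient
    being used with exponent \<open>e = s / 2\<close>.\<close>
  have \<Psi>_O: "(\<lambda>k. \<Psi> k (u k)) \<in> O[U](\<lambda>k. t k powr (4 - s))"
  proof -
    define C where "C = (\<Sum>b\<in>(Basis :: 'a set). B ^ (2 * (d + 1)))"
    have C: "(\<Sum>b\<in>Basis. (w k \<bullet> b) ^ (2 * (d + 1))) \<le> C" for k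
      unfolding C_def
    proof (rule sum_mono)
      fix b :: 'a assume "b \<in> Basis"
      then have "\<bar>w k \<bullet> b\<bar> \<le> B" using Basis_le_norm w_bdd order_trans by blast
      then have "\<bar>w k \<bullet> b\<bar> ^ (2 * (d + 1)) \<le> B ^ (2 * (d + 1))" by (intro power_mono) auto
      then show "(w k \<bullet> b) ^ (2 * (d + 1)) \<le> B ^ (2 * (d + 1))" by (metis dvd_triv_left power_even_abs)
    qed
    have "eventually (\<lambda>k. t k < 1) U" using order_tendstoD(2)[OF tU, of 1] by simp
    moreover have "eventually (\<lambda>k. norm (D (w k)) \<le> t k powr (1 - s / 2)) U"
      using small[of "s / 2"] \<pi>(4) U(1) unfolding t_def by (auto simp: le_filter_def)
    ultimately have "eventually (\<lambda>k. \<Psi> k (u k) \<le> (1 + C) * t k powr (4 - s)) U"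
    proof eventually_elim
      case (elim k)
      have "(norm (D (w k)))\<^sup>2 \<le> (t k powr (1 - s / 2))\<^sup>2" using elim(2) by (intro power_mono) auto
      also have "\<dots> = t k powr (2 - s)" by (simp add: power2_eq_square powr_add[symmetric])
      finally have "(t k)\<^sup>2 * (norm (D (w k)))\<^sup>2 \<le> (t k)\<^sup>2 * t k powr (2 - s)"
        by (intro mult_left_mono) auto
      also have "\<dots> = t k powr 2 * t k powr (2 - s)" using tp[of k] by simp
      also have "\<dots> = t k powr (4 - s)" by (simp add: powr_add[symmetric])
      finally have 1: "(t k)\<^sup>2 * (norm (D (w k)))\<^sup>2 \<le> t k powr (4 - s)" .
      have C0: "0 \<le> C" using order_trans[OF sum_nonneg C[of k]] even by blast
      have "t k ^ 4 = t k powr 4" using tp[of k] by simp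
      also have "\<dots> \<le> t k powr (4 - s)" using elim(1) tp[of k] \<pi>(4) by (intro powr_mono') auto
      finally have "t k ^ 4 * (\<Sum>b\<in>Basis. (w k \<bullet> b) ^ (2 * (d + 1))) \<le> t k powr (4 - s) * C"
        using C even tp[of k] by (intro mult_mono sum_nonneg) auto
      then have "\<Psi> k (w k) \<le> (1 + C) * t k powr (4 - s)"
        using 1 by (simp add: \<Psi>_def normD t_def[symmetric] algebra_simps) (simp add: t_def)
      then show ?case using u[of k "w k"] by linarith
    qed
    moreover have "\<Psi> k (u k) \<ge> 0" for k using \<Psi>_ge(1)[of "u k" k] zero_le_power2 order_trans by blast
    ultimately show ?thesis
      by (intro bigoI[of _ "1 + C"]) (auto elim!: eventually_mono)
  qed
  \<comment> \<open>A coordinate of negative order would have order at most \<open>- s\<close>, and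
    the penalty term would then have order at most \<open>4 - 2 * (d + 1) * s\<close>, below
    \<open>4 - s\<close>. So the minimizers stay bounded along \<open>U\<close>.\<close>
  have inner_O: "(\<lambda>k. u k \<bullet> b) \<in> O[U](\<lambda>_. 1)" if b: "b \<in> Basis" for b
  proof (cases "eventually (\<lambda>k. u k \<bullet> b = 0) U")
    case True
    then show ?thesis by (intro bigoI[of _ 0]) (auto elim: eventually_mono)
  next
    case False
    from \<pi>(7)[OF reducible_polynomial[OF deg_le_inner[OF b]] False] obtain m :: int where
      m: "(\<lambda>k. u k \<bullet> b) \<in> \<Theta>[U](\<lambda>k. t k powr (m * s))" by blast
    have "m \<ge> 0"
    proof (rule ccontr)
      assume "\<not> m \<ge> 0"
      have "(\<lambda>k. t k ^ 4 * (u k \<bullet> b) ^ (2 * (d + 1))) \<in> O[U](\<lambda>k. t k powr (4 - s))"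
      proof (rule landau_o.big.trans[OF _ \<Psi>_O], rule bigoI[of _ 1], rule always_eventually, rule allI)
        fix k
        have "t k ^ 4 * (u k \<bullet> b) ^ (2 * (d + 1)) \<le> t k ^ 4 * (\<Sum>b\<in>Basis. (u k \<bullet> b) ^ (2 * (d + 1)))"
          using b even tp[of k] by (intro mult_left_mono member_le_sum) auto
        also have "\<dots> \<le> \<Psi> k (u k)" by (rule \<Psi>_ge)
        finally show "norm (t k ^ 4 * (u k \<bullet> b) ^ (2 * (d + 1))) \<le> 1 * norm (\<Psi> k (u k))"
          using even tp[of k] by (simp add: abs_mult)
      qed
      moreover have "(\<lambda>k. t k powr (4 + (2 * (d + 1)) * (m * s))) \<in>
          O[U](\<lambda>k. t k ^ 4 * (u k \<bullet> b) ^ (2 * (d + 1)))"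
      proof -
        have "(\<lambda>k. t k ^ 4 * (t k powr (m * s)) ^ (2 * (d + 1))) \<in>
            O[U](\<lambda>k. t k ^ 4 * (u k \<bullet> b) ^ (2 * (d + 1)))"
          by (intro landau_o.big.mult landau_o.big_power bigthetaD1 iffD1[OF bigtheta_sym m]) simp
        moreover have "t k ^ 4 * (t k powr (m * s)) ^ (2 * (d + 1)) =
            t k powr (4 + (2 * (d + 1)) * (m * s))" for k
        proof -
          have "(t k powr (m * s)) ^ (2 * (d + 1)) = (t k powr (m * s)) powr real (2 * (d + 1))"
            by (rule powr_realpow[symmetric]) (use tp[of k] in simp)
          also have "\<dots> = t k powr ((2 * (d + 1)) * (m * s))" by (simp only: powr_powr mult.commute)
          finally show ?thesis using tp[of k] by (simp only: powr_add powr_numeral)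
        qed
        ultimately show ?thesis by simp
      qed
      ultimately have "(\<lambda>k. t k powr (4 + (2 * (d + 1)) * (m * s))) \<in> O[U](\<lambda>k. t k powr (4 - s))"
        using landau_o.big.trans by blast
      then have "4 - s \<le> 4 + (2 * (d + 1)) * (m * s)" by (simp only: powr_t_bigo_iff)
      then have "- s \<le> real (2 * (d + 1)) * (m * s)" by linarith
      also have "\<dots> = (real (2 * (d + 1)) * m) * s" by (simp add: mult.assoc)
      finally have "0 \<le> (real (2 * (d + 1)) * m + 1) * s" by (simp add: distrib_right)
      then have "0 \<le> real (2 * (d + 1)) * m + 1" using \<pi>(4) by (simp add: zero_le_mult_iff)
      moreover have "real (2 * (d + 1)) * m \<le> real (2 * (d + 1)) * (- 1)"
        using \<open>\<not> m \<ge> 0\<close> by (intro mult_left_mono) auto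
      ultimately show False by simp
    qed
    then have "(\<lambda>k. t k powr (m * s)) \<in> O[U](\<lambda>k. t k powr 0)"
      unfolding powr_t_bigo_iff using \<pi>(4) by simp
    from landau_o.big.trans[OF bigthetaD1[OF m] this] show ?thesis by simp
  qed
  \<comment> \<open>With \<open>q * s = 1\<close>, truncation at \<open>M = q + 1\<close> leaves an
    error \<open>O(t powr (1 + s))\<close>, negligible against \<open>t\<close> and against the
    gradient bound \<open>t powr (1 - s / 2)\<close>.\<close>
  define M where "M = Suc q"
  have Ms: "real M * s = 1 + s" using \<pi>(6) by (simp add: M_def algebra_simps)
  have "\<forall>b\<in>Basis. \<exists>T. (\<lambda>k. u k \<bullet> b - poly T (\<pi> k)) \<in> O[U](\<lambda>k. t k powr (real M * s))"
    using uniformizer_expansion[OF reducible_polynomial[OF deg_le_inner] inner_O] by blast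
  from bchoice[OF this] obtain T where
    T: "\<And>b. b \<in> Basis \<Longrightarrow> (\<lambda>k. u k \<bullet> b - poly (T b) (\<pi> k)) \<in> O[U](\<lambda>k. t k powr (1 + s))"
    unfolding Ms by blast
  define X where "X = (\<lambda>z. \<Sum>b\<in>Basis. poly (T b) z *\<^sub>R b)"
  define X' where "X' = (\<lambda>z. \<Sum>b\<in>Basis. poly (pderiv (T b)) z *\<^sub>R b)"
  have X_O: "(\<lambda>k. norm (u k - X (\<pi> k))) \<in> O[U](\<lambda>k. t k powr (1 + s))"
  proof (rule bigo_norm_Basis)
    fix b :: 'a assume b: "b \<in> Basis"
    then have "X z \<bullet> b = poly (T b) z" for z
      by (simp add: X_def)
    then show "(\<lambda>k. (u k - X (\<pi> k)) \<bullet> b) \<in> O[U](\<lambda>k. t k powr (1 + s))"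
      using T[OF b] by (simp add: inner_diff_left)
  qed
  have polyX: "polynomial_function X"
    unfolding X_def
    by (intro polynomial_function_sum polynomial_function_mult finite_Basis polynomial_function_const)
       (simp add: real_polynomial_function_poly real_polynomial_function_eq[symmetric])
  obtain \<Phi> where \<Phi>: "\<And>z. f (X z) = poly \<Phi> z"
    using real_polynomial_function_eq_poly[OF real_polynomial_function_compose[OF polyX f]] by auto
  have limX: "((\<lambda>k. X (\<pi> k)) \<longlongrightarrow> X 0) U" "((\<lambda>k. X' (\<pi> k)) \<longlongrightarrow> X' 0) U"
    unfolding X_def X'_def by (intro tendsto_intros uniformizer_lim)+
  have "eventually (\<lambda>k. norm (X (\<pi> k)) < norm (X 0) + 1) U"
    by (rule order_tendstoD(2)[OF tendsto_norm[OF limX(1)]]) simp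
  moreover obtain Cu where "eventually (\<lambda>k. norm (u k) \<le> Cu) U"
    using landau_o.bigE[OF bigo_norm_Basis[OF inner_O]] by auto
  ultimately have bdd: "eventually (\<lambda>k. u k \<in> cball 0 (max Cu (norm (X 0) + 1)) \<and>
      X (\<pi> k) \<in> cball 0 (max Cu (norm (X 0) + 1))) U"
    by eventually_elim auto
  \<comment> \<open>Passing from \<open>u k\<close> to the curve point \<open>X (\<pi> k)\<close>
    changes a polynomial by \<open>O(t powr (1 + s))\<close> only, since eventually both points lie
    in one ball.\<close>
  have lip: "(\<lambda>k. norm (g (X (\<pi> k)) - g (u k))) \<in> O[U](\<lambda>k. t k powr (1 + s))"
    if "polynomial_function g" for g :: "'a \<Rightarrow> 'b::euclidean_space"
  proof -
    obtain L where L: "L > 0" "\<forall>x\<in>cball 0 (max Cu (norm (X 0) + 1)). \<forall>y\<in>cball 0 (max Cu (norm (X 0) + 1)).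
        norm (g x - g y) \<le> L * norm (x - y)"
      using polynomial_lipschitz_on_cball[OF \<open>polynomial_function g\<close>] by blast
    have "(\<lambda>k. norm (g (X (\<pi> k)) - g (u k))) \<in> O[U](\<lambda>k. norm (u k - X (\<pi> k)))"
    proof (rule bigoI)
      show "eventually (\<lambda>k. norm (norm (g (X (\<pi> k)) - g (u k))) \<le> L * norm (norm (u k - X (\<pi> k)))) U"
        using bdd by eventually_elim (use L(2) in \<open>auto simp: norm_minus_commute\<close>)
    qed
    then show ?thesis using X_O by (rule landau_o.big.trans)
  qed
  have 1: "(\<lambda>k. poly \<Phi> (\<pi> k) - f (u k)) \<in> O[U](\<lambda>k. t k powr (1 + s))"
    using lip[OF iffD1[OF real_polynomial_function_eq f]] by (simp add: \<Phi>)
  have 2: "(\<lambda>k. f (u k) - t k) \<in> O[U](\<lambda>k. t k powr ((4 - s) / 2))"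
  proof (rule bigo_sqrt, rule landau_o.big.trans[OF _ \<Psi>_O], rule bigoI[of _ 1], rule always_eventually, rule allI)
    show "norm ((f (u k) - t k)\<^sup>2) \<le> 1 * norm (\<Psi> k (u k))" for k
      using \<Psi>_ge(1)[of "u k" k] by simp
  qed
  \<comment> \<open>The bound \<open>s \<le> 1\<close> makes \<open>(4 - s) / 2\<close> exceed
    1.\<close>
  have 3: "(\<lambda>k. t k powr (1 + s)) \<in> o[U](\<lambda>k. t k powr 1)"
    "(\<lambda>k. t k powr ((4 - s) / 2)) \<in> o[U](\<lambda>k. t k powr 1)"
    unfolding powr_t_smallo_iff using \<pi>(4) s1 by auto
  have "(\<lambda>k. (poly \<Phi> (\<pi> k) - f (u k)) + (f (u k) - t k)) \<in> o[U](\<lambda>k. t k powr 1)"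
    by (rule sum_in_smallo(1)[OF landau_o.big_small_trans[OF 1 3(1)] landau_o.big_small_trans[OF 2 3(2)]])
  then have "(\<lambda>k. poly \<Phi> (\<pi> k) - t k) \<in> o[U](\<lambda>k. t k powr 1)" by simp
  from smalloD_tendsto[OF this] have "((\<lambda>k. (poly \<Phi> (\<pi> k) - t k) / t k powr 1 + 1) \<longlongrightarrow> 0 + 1) U"
    by (intro tendsto_add tendsto_const)
  moreover have "(poly \<Phi> (\<pi> k) - t k) / t k powr 1 + 1 = poly \<Phi> (\<pi> k) / t k powr 1" for k
    using tp[of k] by (simp add: field_simps)
  ultimately have \<Phi>_t: "(\<lambda>k. poly \<Phi> (\<pi> k)) \<in> \<Theta>[U](\<lambda>k. t k powr 1)"
    by (intro bigthetaI_tendsto[of 1]) auto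
  have \<Phi>0: "\<Phi> \<noteq> 0"
  proof
    assume "\<Phi> = 0"
    then have "(\<lambda>k. t k powr 1) \<in> \<Theta>[U](\<lambda>_. 0)" using iffD1[OF bigtheta_sym \<Phi>_t] by simp
    then show False using U(2) tn by (simp add: eventually_const_iff)
  qed
  have pow: "(\<lambda>k. poly p (\<pi> k)) \<in> \<Theta>[U](\<lambda>k. t k powr (real (order 0 p) * s))" if "p \<noteq> 0" for p
    by (rule landau_theta.trans[OF poly_bigtheta_power_order[OF that uniformizer_lim]
          uniformizer_power_bigtheta])
  have "(\<lambda>k. t k powr 1) \<in> \<Theta>[U](\<lambda>k. t k powr (real (order 0 \<Phi>) * s))"
    by (rule landau_theta.trans[OF iffD1[OF bigtheta_sym \<Phi>_t] pow[OF \<Phi>0]])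
  \<comment> \<open>The zero of \<open>\<Phi>\<close> at the origin has the positive order
    \<open>1 / s\<close>; differentiation lowers this order by one and the growth order by
    \<open>s\<close>.\<close>
  then have ord: "real (order 0 \<Phi>) * s = 1" by (simp only: powr_t_bigtheta_iff)
  then have root: "poly \<Phi> 0 = 0" using \<Phi>0 by (cases "order 0 \<Phi> = 0") (auto simp: order_root)
  have d\<Phi>0: "pderiv \<Phi> \<noteq> 0"
  proof
    assume "pderiv \<Phi> = 0"
    then obtain a where "\<Phi> = [:a:]" by (auto simp: pderiv_eq_0_iff elim: degree_eq_zeroE)
    then show False using root \<Phi>0 by simp
  qed
  have "real (order 0 (pderiv \<Phi>)) * s = 1 - s"
    using ord order_pderiv[OF \<Phi>0 root] by (simp add: algebra_simps)
  then have d\<Phi>: "(\<lambda>k. poly (pderiv \<Phi>) (\<pi> k)) \<in> \<Theta>[U](\<lambda>k. t k powr (1 - s))"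
    using pow[OF d\<Phi>0] by simp
  have chain: "poly (pderiv \<Phi>) z = D (X z) \<bullet> X' z" for z
  proof -
    have "(X has_derivative (\<lambda>h. \<Sum>b\<in>Basis. (poly (pderiv (T b)) z * h) *\<^sub>R b)) (at z)"
      unfolding X_def
      by (intro has_derivative_sum has_derivative_scaleR_left poly_DERIV[unfolded has_field_derivative_def])
    then have "(X has_derivative (\<lambda>h. h *\<^sub>R X' z)) (at z)"
      by (simp add: X'_def scaleR_sum_right mult.commute)
    from has_derivative_compose[OF this grad]
    have "((\<lambda>z. f (X z)) has_derivative (\<lambda>h. D (X z) \<bullet> (h *\<^sub>R X' z))) (at z)" .
    moreover have "((\<lambda>z. f (X z)) has_derivative (\<lambda>h. poly (pderiv \<Phi>) z * h)) (at z)"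
      using poly_DERIV[of \<Phi> z] by (simp add: \<Phi> has_field_derivative_def)
    ultimately have "(\<lambda>h. poly (pderiv \<Phi>) z * h) = (\<lambda>h. D (X z) \<bullet> (h *\<^sub>R X' z))"
      by (rule has_derivative_unique[rotated])
    from fun_cong[OF this, of 1] show ?thesis by simp
  qed
  have "(\<lambda>k. norm (D (u k))) \<in> O[U](\<lambda>k. t k powr ((2 - s) / 2))"
  proof (rule bigo_sqrt)
    have "(\<lambda>k. (t k)\<^sup>2 * (norm (D (u k)))\<^sup>2) \<in> O[U](\<lambda>k. t k powr (4 - s))"
    proof (rule landau_o.big.trans[OF _ \<Psi>_O], rule bigoI[of _ 1], rule always_eventually, rule allI)
      show "norm ((t k)\<^sup>2 * (norm (D (u k)))\<^sup>2) \<le> 1 * norm (\<Psi> k (u k))" for k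
        using \<Psi>_ge(2)[of k "u k"] by (simp add: abs_mult)
    qed
    from landau_o.big.mult[OF this landau_o.big_refl, of "\<lambda>k. t k powr (-2)"]
    have "(\<lambda>k. (t k)\<^sup>2 * (norm (D (u k)))\<^sup>2 * t k powr (-2)) \<in> O[U](\<lambda>k. t k powr (4 - s) * t k powr (-2))"
      by simp
    moreover have "(t k)\<^sup>2 * (norm (D (u k)))\<^sup>2 * t k powr (-2) = (norm (D (u k)))\<^sup>2" for k
      using tp[of k] by (simp add: powr_minus powr_numeral field_simps)
    moreover have "t k powr (4 - s) * t k powr (-2) = t k powr (2 - s)" for k
      by (simp add: powr_add[symmetric])
    ultimately show "(\<lambda>k. (norm (D (u k)))\<^sup>2) \<in> O[U](\<lambda>k. t k powr (2 - s))" by simp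
  qed
  moreover have "(\<lambda>k. norm (D (X (\<pi> k)) - D (u k))) \<in> O[U](\<lambda>k. t k powr ((2 - s) / 2))"
    by (rule landau_o.big.trans[OF lip[OF D]]) (unfold powr_t_bigo_iff, use \<pi>(4) in simp)
  ultimately have "(\<lambda>k. norm (D (u k)) + norm (D (X (\<pi> k)) - D (u k))) \<in> O[U](\<lambda>k. t k powr ((2 - s) / 2))"
    by (rule sum_in_bigo)
  moreover have "(\<lambda>k. norm (D (X (\<pi> k)))) \<in> O[U](\<lambda>k. norm (D (u k)) + norm (D (X (\<pi> k)) - D (u k)))"
    by (rule bigoI[of _ 1], rule always_eventually)
       (use norm_triangle_sub in \<open>auto simp: add.commute intro: order_trans[OF _ abs_ge_self]\<close>)
  ultimately have DX: "(\<lambda>k. norm (D (X (\<pi> k)))) \<in> O[U](\<lambda>k. t k powr ((2 - s) / 2))"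
    by (rule landau_o.big.trans[rotated])
  have "eventually (\<lambda>k. norm (X' (\<pi> k)) < norm (X' 0) + 1) U"
    by (rule order_tendstoD(2)[OF tendsto_norm[OF limX(2)]]) simp
  then have "eventually (\<lambda>k. norm (poly (pderiv \<Phi>) (\<pi> k)) \<le>
      (norm (X' 0) + 1) * norm (norm (D (X (\<pi> k))))) U"
  proof eventually_elim
    case (elim k)
    have "\<bar>D (X (\<pi> k)) \<bullet> X' (\<pi> k)\<bar> \<le> norm (D (X (\<pi> k))) * norm (X' (\<pi> k))"
      by (rule Cauchy_Schwarz_ineq2)
    also have "\<dots> \<le> norm (D (X (\<pi> k))) * (norm (X' 0) + 1)"
      using elim by (intro mult_left_mono) auto
    finally show ?case by (simp add: chain mult.commute)
  qed
  then have "(\<lambda>k. poly (pderiv \<Phi>) (\<pi> k)) \<in> O[U](\<lambda>k. norm (D (X (\<pi> k))))"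
    by (rule bigoI)
  \<comment> \<open>The derivative, of exact order \<open>1 - s\<close>, would be
    \<open>O(t powr (1 - s / 2))\<close>, which forces \<open>s \<le> 0\<close>.\<close>
  from landau_o.big.trans[OF landau_o.big.trans[OF bigthetaD1[OF iffD1[OF bigtheta_sym d\<Phi>]] this] DX]
  have "(2 - s) / 2 \<le> 1 - s" by (simp only: powr_t_bigo_iff)
  then show False using \<pi>(4) by simp
qed

section \<open>Lojasiewicz inequalities\<close>

text \<open>
  A single parameter \<open>\<delta>\<close> serves as the radius and as the exponent, so that the statement remains true
  when \<open>\<delta>\<close> decreases (as long as \<open>f u - f u0 < 1\<close>) and finitely many such statements can be combined.
\<close>

lemma lojasiewicz_gradient_inequality:
  fixes f :: "'a::euclidean_space \<Rightarrow> real"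
  assumes f: "real_polynomial_function f" and D: "polynomial_function D"
    and grad: "\<And>u. (f has_derivative (\<lambda>h. D u \<bullet> h)) (at u)"
  shows "\<exists>\<delta>>0. \<forall>u\<in>ball u0 \<delta>. f u > f u0 \<longrightarrow> (f u - f u0) powr (1 - \<delta>) \<le> norm (D u)"
proof (rule ccontr)
  assume neg: "\<not> ?thesis"
  \<comment> \<open>Radius and exponent shrink together, so one sequence of counterexamples
    converges to \<open>u0\<close> and eventually violates the inequality for each fixed exponent
    \<open>e\<close>.\<close>
  define \<delta> where "\<delta> = (\<lambda>k. inverse (real (Suc k)))"
  have \<delta>: "\<delta> k > 0" "\<delta> k \<le> 1" for k by (auto simp: \<delta>_def inverse_eq_divide)
  have \<delta>_lim: "\<delta> \<longlonglongrightarrow> 0" unfolding \<delta>_def by (rule LIMSEQ_inverse_real_of_nat)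
  have "\<forall>k. \<exists>u. u \<in> ball u0 (\<delta> k) \<and> f u > f u0 \<and> norm (D u) < (f u - f u0) powr (1 - \<delta> k)"
    using neg \<delta>(1) by (meson not_le)
  from choice[OF this] obtain w where w: "\<And>k. w k \<in> ball u0 (\<delta> k)" "\<And>k. f (w k) > f u0"
    "\<And>k. norm (D (w k)) < (f (w k) - f u0) powr (1 - \<delta> k)" by blast
  have w_lim: "w \<longlonglongrightarrow> u0"
    by (rule metric_tendsto_imp_tendsto[OF \<delta>_lim])
      (use w(1) \<delta>(1) in \<open>auto simp: dist_commute less_imp_le\<close>)
  have "continuous (at u0) f" using f by (simp add: continuous_real_polymonial_function)
  then have f_lim: "(\<lambda>k. f (w k) - f u0) \<longlonglongrightarrow> 0"
    using isCont_tendsto_compose[OF _ w_lim] by (auto simp: LIM_zero_iff)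
  show False
  proof (rule no_sequence_violating_lojasiewicz)
    show "real_polynomial_function (\<lambda>u. f u - f u0)"
      using f real_polynomial_function.intros(2) by (rule real_polynomial_function_diff)
    show "((\<lambda>u. f u - f u0) has_derivative (\<lambda>h. D u \<bullet> h)) (at u)" for u
      using grad[of u] by (auto intro!: derivative_eq_intros)
    show "norm (w k) \<le> norm u0 + 1" for k
      using w(1)[of k] \<delta>(2)[of k] norm_triangle_sub[of "w k" u0]
      by (simp add: dist_norm norm_minus_commute)
    fix e :: real assume "e > 0"
    have "eventually (\<lambda>k. \<delta> k < e) sequentially" using order_tendstoD(2)[OF \<delta>_lim \<open>e > 0\<close>] .
    moreover have "eventually (\<lambda>k. f (w k) - f u0 < 1) sequentially"
      using order_tendstoD(2)[OF f_lim, of 1] by simp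
    ultimately show "eventually (\<lambda>k. norm (D (w k)) \<le> (f (w k) - f u0) powr (1 - e)) sequentially"
    proof eventually_elim
      case (elim k)
      have "norm (D (w k)) \<le> (f (w k) - f u0) powr (1 - \<delta> k)" using w(3)[of k] by simp
      also have "\<dots> \<le> (f (w k) - f u0) powr (1 - e)"
        using elim w(2)[of k] by (intro powr_mono') auto
      finally show ?case .
    qed
  qed (use D w(2) f_lim in auto)
qed

text \<open>\<open>w\<close> is a Frechet subgradient at \<open>u\<close> of the function that is \<open>F\<close> on \<open>X\<close> and \<open>\<infinity>\<close> outside \<open>X\<close>.\<close>

definition frechet_ineq :: "('a::euclidean_space \<Rightarrow> real) \<Rightarrow> 'a set \<Rightarrow> 'a \<Rightarrow> 'a \<Rightarrow> bool" where
  "frechet_ineq F X u w \<longleftrightarrow>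
     (\<forall>e>0. \<exists>r>0. \<forall>z\<in>X \<inter> ball u r. F z - F u - w \<bullet> (z - u) \<ge> - e * norm (z - u))"

section \<open>Functions that are polynomial on the cells of a hyperplane arrangement\<close>

text \<open>A cell is the set of points with given signs of the affine functions
  \<open>l i - \<beta> i\<close>. By \<open>saturated\<close>, \<open>X\<close> is a union of cells,
  and \<open>P \<sigma>\<close> extends \<open>F\<close> from the cell \<open>\<sigma>\<close> to a
  polynomial on the whole space.\<close>

locale piecewise_polynomial =
  fixes F :: "'a::euclidean_space \<Rightarrow> real" and X :: "'a set" and I :: "'i set"
    and l :: "'i \<Rightarrow> 'a \<Rightarrow> real" and \<beta> :: "'i \<Rightarrow> real" and P :: "('i \<Rightarrow> real) \<Rightarrow> 'a \<Rightarrow> real"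
  assumes finite_I: "finite I"
    and linear_l: "i \<in> I \<Longrightarrow> bounded_linear (l i)"
    and saturated: "u \<in> X \<Longrightarrow> \<forall>i\<in>I. sgn (l i u' - \<beta> i) = sgn (l i u - \<beta> i) \<Longrightarrow> u' \<in> X"
    and poly_P: "real_polynomial_function (P \<sigma>)"
    and F_eq: "u \<in> X \<Longrightarrow> F u = P (restrict (\<lambda>i. sgn (l i u - \<beta> i)) I) u"
    and cont_F: "continuous_on X F"
begin

definition pattern :: "'a \<Rightarrow> 'i \<Rightarrow> real" where
  "pattern u = restrict (\<lambda>i. sgn (l i u - \<beta> i)) I"

lemma pattern_eqD: "pattern u = \<sigma> \<Longrightarrow> i \<in> I \<Longrightarrow> sgn (l i u - \<beta> i) = \<sigma> i"
  by (auto simp: pattern_def)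

lemma finite_patterns: "finite (range pattern)"
proof (rule finite_subset)
  show "range pattern \<subseteq> (\<Pi>\<^sub>E i\<in>I. {-1, 0, 1})"
    by (auto simp: pattern_def sgn_if split: if_splits)
  show "finite (\<Pi>\<^sub>E i\<in>I. {-1, 0, 1 :: real})" using finite_I by (intro finite_PiE) auto
qed

text \<open>A direction annihilated by the active \<open>l i\<close> keeps
  \<open>u + \<tau> *\<^sub>R d\<close> in the cell of \<open>u\<close> for small
  \<open>\<tau> > 0\<close>, as strict signs persist. There \<open>F\<close> is a polynomial, whose
  difference quotients tend to \<open>D \<bullet> d\<close>.\<close>

lemma face_subgradient:
  assumes u: "u \<in> X" and w: "frechet_ineq F X u w"
    and grad: "(P (pattern u) has_derivative (\<lambda>h. D \<bullet> h)) (at u)"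
    and d: "\<And>i. i \<in> I \<Longrightarrow> l i u = \<beta> i \<Longrightarrow> l i d = 0"
  shows "w \<bullet> d \<le> D \<bullet> d"
proof -
  have pat: "eventually (\<lambda>\<tau>. \<forall>i\<in>I. sgn (l i (u + \<tau> *\<^sub>R d) - \<beta> i) = sgn (l i u - \<beta> i)) (at_right 0)"
  proof (rule eventually_ball_finite[OF finite_I], rule ballI)
    fix i assume i: "i \<in> I"
    interpret bounded_linear "l i" using linear_l[OF i] .
    have eq: "l i (u + \<tau> *\<^sub>R d) - \<beta> i = (l i u - \<beta> i) + \<tau> * l i d" for \<tau>
      by (simp add: add scaleR)
    have lim: "((\<lambda>\<tau>. (l i u - \<beta> i) + \<tau> * l i d) \<longlongrightarrow> (l i u - \<beta> i) + 0 * l i d) (at_right 0)"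
      by (intro tendsto_intros)
    consider "l i u - \<beta> i = 0" | "l i u - \<beta> i > 0" | "l i u - \<beta> i < 0" by linarith
    then show "eventually (\<lambda>\<tau>. sgn (l i (u + \<tau> *\<^sub>R d) - \<beta> i) = sgn (l i u - \<beta> i)) (at_right 0)"
    proof cases
      case 1
      then show ?thesis using d[OF i] by (simp add: eq)
    next
      case 2
      then have "eventually (\<lambda>\<tau>. (l i u - \<beta> i) + \<tau> * l i d > 0) (at_right 0)"
        using order_tendstoD(1)[OF lim, of 0] by simp
      then show ?thesis by eventually_elim (use 2 in \<open>simp add: eq\<close>)
    next
      case 3
      then have "eventually (\<lambda>\<tau>. (l i u - \<beta> i) + \<tau> * l i d < 0) (at_right 0)"
        using order_tendstoD(2)[OF lim, of 0] by simp
      then show ?thesis by eventually_elim (use 3 in \<open>simp add: eq\<close>)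
    qed
  qed
  have "((\<lambda>\<tau>. u + \<tau> *\<^sub>R d) has_derivative (\<lambda>\<tau>. \<tau> *\<^sub>R d)) (at 0)"
    by (auto intro!: derivative_eq_intros)
  moreover have "(P (pattern u) has_derivative (\<lambda>h. D \<bullet> h)) (at (u + 0 *\<^sub>R d))" using grad by simp
  ultimately have "((\<lambda>\<tau>. P (pattern u) (u + \<tau> *\<^sub>R d)) has_derivative (\<lambda>\<tau>. D \<bullet> (\<tau> *\<^sub>R d))) (at 0)"
    by (rule has_derivative_compose)
  then have "((\<lambda>\<tau>. P (pattern u) (u + \<tau> *\<^sub>R d)) has_field_derivative (D \<bullet> d)) (at 0)"
    unfolding has_field_derivative_def by (rule has_derivative_eq_rhs) (simp add: mult.commute fun_eq_iff)
  then have "((\<lambda>\<tau>. (P (pattern u) (u + \<tau> *\<^sub>R d) - P (pattern u) u) / \<tau>) \<longlongrightarrow> D \<bullet> d) (at 0)"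
    by (simp add: has_field_derivative_iff)
  then have lim: "((\<lambda>\<tau>. (P (pattern u) (u + \<tau> *\<^sub>R d) - P (pattern u) u) / \<tau>) \<longlongrightarrow> D \<bullet> d) (at_right 0)"
    by (rule filterlim_mono) (auto intro: at_le)
  have "w \<bullet> d - e * norm d \<le> D \<bullet> d" if "e > 0" for e
  proof -
    obtain r where r: "r > 0" "\<forall>z\<in>X \<inter> ball u r. F z - F u - w \<bullet> (z - u) \<ge> - e * norm (z - u)"
      using w \<open>e > 0\<close> unfolding frechet_ineq_def by blast
    have "((\<lambda>\<tau>. dist u (u + \<tau> *\<^sub>R d)) \<longlongrightarrow> dist u (u + 0 *\<^sub>R d)) (at_right 0)"
      by (intro tendsto_intros)
    then have "eventually (\<lambda>\<tau>. dist u (u + \<tau> *\<^sub>R d) < r) (at_right 0)"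
      using order_tendstoD(2) r(1) by fastforce
    then have "eventually (\<lambda>\<tau>. w \<bullet> d - e * norm d \<le>
        (P (pattern u) (u + \<tau> *\<^sub>R d) - P (pattern u) u) / \<tau>) (at_right 0)"
      using pat eventually_at_right_less[of 0]
    proof eventually_elim
      case (elim \<tau>)
      have X: "u + \<tau> *\<^sub>R d \<in> X" using saturated[OF u] elim(2) by blast
      have "pattern (u + \<tau> *\<^sub>R d) = pattern u" using elim(2) by (auto simp: pattern_def)
      then have F: "F (u + \<tau> *\<^sub>R d) = P (pattern u) (u + \<tau> *\<^sub>R d)" "F u = P (pattern u) u"
        using F_eq[OF X] F_eq[OF u] by (simp_all add: pattern_def)
      have "- e * norm (\<tau> *\<^sub>R d) \<le> F (u + \<tau> *\<^sub>R d) - F u - w \<bullet> (\<tau> *\<^sub>R d)"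
        using r(2) X elim(1) by force
      then show ?case using elim(3) by (simp add: F field_simps)
    qed
    then show ?thesis by (rule tendsto_lowerbound[OF lim]) simp
  qed
  note le = this
  show ?thesis
  proof (rule field_le_epsilon)
    fix e :: real assume "e > 0"
    then have "e / (norm d + 1) > 0" by (simp add: add_nonneg_pos)
    from le[OF this] have "w \<bullet> d \<le> D \<bullet> d + e / (norm d + 1) * norm d" by simp
    also have "e / (norm d + 1) * norm d \<le> e"
      using \<open>e > 0\<close> add_nonneg_pos[OF norm_ge_zero[of d] zero_less_one]
      by (simp add: pos_divide_le_eq distrib_left)
    finally show "w \<bullet> d \<le> D \<bullet> d + e" by simp
  qed
qed

text \<open>Only cells with \<open>u0\<close> in their closure matter. Such a cell lies in the
  affine subspace \<open>u0 + S\<close>, along which \<open>P \<sigma>\<close> has the projected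
  gradient \<open>pr (D u)\<close>; a subgradient has the same projection, and projecting does not
  increase the norm.\<close>

lemma lojasiewicz_on_pattern:
  assumes u0: "u0 \<in> X"
  shows "\<exists>\<delta>>0. \<forall>u\<in>X \<inter> ball u0 \<delta>. \<forall>w. pattern u = \<sigma> \<longrightarrow> F u > F u0 \<longrightarrow> frechet_ineq F X u w \<longrightarrow>
    (F u - F u0) powr (1 - \<delta>) \<le> norm w"
proof (cases "\<forall>\<delta>>0. \<exists>u\<in>X \<inter> ball u0 \<delta>. pattern u = \<sigma>")
  case False
  then obtain \<delta> where \<delta>: "\<delta> > 0" "\<forall>u\<in>X \<inter> ball u0 \<delta>. pattern u \<noteq> \<sigma>" by blast
  then show ?thesis by (intro exI[of _ \<delta>]) auto
next
  case True
  have "\<forall>k. \<exists>u. u \<in> X \<inter> ball u0 (inverse (real (Suc k))) \<and> pattern u = \<sigma>"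
    using True by (auto simp: Bex_def)
  from choice[OF this] obtain v where
    v: "\<And>k. v k \<in> X" "\<And>k. v k \<in> ball u0 (inverse (real (Suc k)))" "\<And>k. pattern (v k) = \<sigma>"
    by blast
  have v_lim: "v \<longlonglongrightarrow> u0"
    by (rule metric_tendsto_imp_tendsto[OF LIMSEQ_inverse_real_of_nat])
      (use v(2) in \<open>auto simp: dist_commute less_imp_le\<close>)
  \<comment> \<open>The equations of the cell pass to its limit point \<open>u0\<close>; the strict
    inequalities may be lost.\<close>
  have zero: "l i u0 = \<beta> i" if i: "i \<in> I" "\<sigma> i = 0" for i
  proof -
    have eq: "l i (v k) = \<beta> i" for k using pattern_eqD[OF v(3) i(1), of k] i(2) by (simp add: sgn_zero_iff)
    have "(\<lambda>k. l i (v k)) \<longlonglongrightarrow> l i u0"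
      by (rule bounded_linear.tendsto[OF linear_l[OF i(1)] v_lim])
    then have "(\<lambda>k. \<beta> i) \<longlonglongrightarrow> l i u0" by (simp only: eq)
    then show ?thesis by (simp add: LIMSEQ_const_iff)
  qed
  \<comment> \<open>By continuity of \<open>F\<close> on \<open>X\<close>, its value at
    \<open>u0\<close> is that of \<open>P \<sigma>\<close> even if \<open>u0\<close> lies in another
    cell.\<close>
  have F_u0: "F u0 = P \<sigma> u0"
  proof (rule LIMSEQ_unique)
    show "(\<lambda>k. F (v k)) \<longlonglongrightarrow> F u0"
      by (rule continuous_on_tendsto_compose[OF cont_F v_lim u0]) (use v in auto)
    have "(\<lambda>k. P \<sigma> (v k)) \<longlonglongrightarrow> P \<sigma> u0"
      by (rule isCont_tendsto_compose[OF continuous_real_polymonial_function[OF poly_P] v_lim])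
    moreover have "F (v k) = P \<sigma> (v k)" for k
      using F_eq[OF v(1)] v(3) by (simp add: pattern_def)
    ultimately show "(\<lambda>k. F (v k)) \<longlonglongrightarrow> P \<sigma> u0" by simp
  qed
  define S where "S = {d. \<forall>i\<in>I. \<sigma> i = 0 \<longrightarrow> l i d = 0}"
  have "subspace S"
    unfolding S_def subspace_def
    using linear_l by (auto simp: linear_simps linear_0[OF bounded_linear.linear])
  then obtain B where B: "B \<subseteq> S" "pairwise orthogonal B" "\<And>x. x \<in> B \<Longrightarrow> norm x = 1"
    "independent B" "span B = S"
    using orthonormal_basis_subspace by metis
  have fB: "finite B" using B(4) by (rule independent_imp_finite)
  \<comment> \<open>The orthogonal projection onto \<open>S\<close>. Composition with it keeps the
    whole space as domain, so the gradient inequality applies directly; self-adjointness gives the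
    gradient \<open>pr (D (u0 + pr z))\<close>.\<close>
  define pr where "pr = (\<lambda>z. \<Sum>b\<in>B. (z \<bullet> b) *\<^sub>R b)"
  have pr_id: "pr z = z" if "z \<in> S" for z
    unfolding pr_def using B fB that by (intro orthonormal_basis_expand) auto
  have pr_adj: "pr x \<bullet> y = x \<bullet> pr y" for x y
    by (simp add: pr_def inner_sum_left inner_sum_right inner_commute mult.commute)
  have pr_S: "pr x \<in> S" for x
    unfolding B(5)[symmetric] pr_def by (intro span_sum span_scale span_base)
  have pr_norm: "norm (pr x) \<le> norm x" for x
  proof (cases "pr x = 0")
    case False
    have "norm (pr x) * norm (pr x) = pr x \<bullet> pr x" by (simp add: norm_eq_sqrt_inner)
    also have "\<dots> = pr x \<bullet> x" using pr_adj[of x "pr x"] pr_id[OF pr_S] by (simp add: inner_commute)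
    also have "\<dots> \<le> norm (pr x) * norm x" by (rule norm_cauchy_schwarz)
    finally show ?thesis using False by simp
  qed simp
  obtain D where D: "polynomial_function D" "\<And>u. (P \<sigma> has_derivative (\<lambda>h. D u \<bullet> h)) (at u)"
    using polynomial_gradient[OF poly_P] by blast
  have pr_bl: "bounded_linear pr"
    unfolding pr_def by (intro bounded_linear_sum bounded_linear_scaleR_const bounded_linear_inner_left)
  have pr_poly: "polynomial_function (\<lambda>z. u0 + pr z)"
    using pr_bl by (intro polynomial_function_add polynomial_function_const polynomial_function_bounded_linear)
  have "\<exists>\<delta>>0. \<forall>z\<in>ball 0 \<delta>. P \<sigma> (u0 + pr z) > P \<sigma> (u0 + pr 0) \<longrightarrow>
      (P \<sigma> (u0 + pr z) - P \<sigma> (u0 + pr 0)) powr (1 - \<delta>) \<le> norm (pr (D (u0 + pr z)))"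
  proof (rule lojasiewicz_gradient_inequality)
    show "real_polynomial_function (\<lambda>z. P \<sigma> (u0 + pr z))"
      using real_polynomial_function_compose[OF pr_poly poly_P] by (simp add: o_def)
    have "polynomial_function (D \<circ> (\<lambda>z. u0 + pr z))" using pr_poly D(1) by (rule polynomial_function_compose)
    from polynomial_function_compose[OF this polynomial_function_bounded_linear[OF pr_bl]]
    show "polynomial_function (\<lambda>z. pr (D (u0 + pr z)))" by (simp add: o_def)
    show "((\<lambda>z. P \<sigma> (u0 + pr z)) has_derivative (\<lambda>h. pr (D (u0 + pr z)) \<bullet> h)) (at z)" for z
    proof -
      have "((\<lambda>z. u0 + pr z) has_derivative pr) (at z)"
        using bounded_linear_imp_has_derivative[OF pr_bl] by (auto intro!: derivative_eq_intros)
      from has_derivative_compose[OF this D(2)] show ?thesis by (simp add: pr_adj)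
    qed
  qed
  then obtain \<delta> where \<delta>: "\<delta> > 0" "\<And>z. z \<in> ball 0 \<delta> \<Longrightarrow> P \<sigma> (u0 + pr z) > P \<sigma> (u0 + pr 0) \<Longrightarrow>
      (P \<sigma> (u0 + pr z) - P \<sigma> (u0 + pr 0)) powr (1 - \<delta>) \<le> norm (pr (D (u0 + pr z)))"
    by blast
  have "(F u - F u0) powr (1 - \<delta>) \<le> norm w"
    if u: "u \<in> X" "u \<in> ball u0 \<delta>" "pattern u = \<sigma>" "F u > F u0" and w: "frechet_ineq F X u w" for u w
  proof -
    have zl: "l i u = \<beta> i \<longleftrightarrow> \<sigma> i = 0" if "i \<in> I" for i
      using pattern_eqD[OF u(3) that] by (metis sgn_zero_iff right_minus_eq)
    have "u - u0 \<in> S"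
      unfolding S_def using zl zero linear_l
      by (auto simp: linear_diff[OF bounded_linear.linear])
    then have pu: "u0 + pr (u - u0) = u" by (simp add: pr_id)
    have Fu: "F u = P \<sigma> u" using F_eq[OF u(1)] u(3) by (simp add: pattern_def)
    have p0: "pr 0 = 0" using pr_bl by (simp add: linear_0[OF bounded_linear.linear])
    have "(F u - F u0) powr (1 - \<delta>) \<le> norm (pr (D u))"
      using \<delta>(2)[of "u - u0"] u(2,4) unfolding pu p0 Fu F_u0 by (simp add: dist_norm norm_minus_commute)
    \<comment> \<open>Both \<open>b\<close> and \<open>- b\<close> are admissible directions, so the
      one-sided inequality of \<open>face_subgradient\<close> becomes an equality on the basis of
      \<open>S\<close>.\<close>
    also have "pr (D u) = pr w"
    proof -
      have le: "w \<bullet> d \<le> D u \<bullet> d" if "d \<in> S" for d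
        using face_subgradient[OF u(1) w, of "D u" d] D(2) u(3) zl that by (auto simp: S_def)
      have "w \<bullet> b = D u \<bullet> b" if b: "b \<in> B" for b
      proof -
        have "b \<in> S" "- b \<in> S" using b B(1) \<open>subspace S\<close> by (auto simp: subspace_neg)
        from le[OF this(1)] le[OF this(2)] show ?thesis by simp
      qed
      then show ?thesis by (simp add: pr_def)
    qed
    also have "norm (pr w) \<le> norm w" by (rule pr_norm)
    finally show ?thesis .
  qed
  then show ?thesis using \<delta>(1) by blast
qed

text \<open>There are finitely many cells, and the inequality on each holds for all sufficiently
  small positive parameters; one parameter then serves them all.\<close>

lemma lojasiewicz_inequality:
  assumes u0: "u0 \<in> X"
  shows "\<exists>\<delta>>0. \<delta> < 1 \<and> (\<forall>u\<in>X \<inter> ball u0 \<delta>. \<forall>w. F u > F u0 \<longrightarrow> frechet_ineq F X u w \<longrightarrow>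
    (F u - F u0) powr (1 - \<delta>) \<le> norm w)"
proof -
  \<comment> \<open>The clause \<open>F u < F u0 + 1\<close> makes the inequality monotone in the
    exponent; continuity discharges it near \<open>u0\<close>.\<close>
  define Q where "Q = (\<lambda>\<delta> \<sigma>. \<forall>u\<in>X \<inter> ball u0 \<delta>. \<forall>w. pattern u = \<sigma> \<longrightarrow> F u > F u0 \<longrightarrow>
    F u < F u0 + 1 \<longrightarrow> frechet_ineq F X u w \<longrightarrow> (F u - F u0) powr (1 - \<delta>) \<le> norm w)"
  have "eventually (\<lambda>\<delta>. Q \<delta> \<sigma>) (at_right 0)" for \<sigma>
  proof -
    obtain d where d: "d > 0" "\<forall>u\<in>X \<inter> ball u0 d. \<forall>w. pattern u = \<sigma> \<longrightarrow> F u > F u0 \<longrightarrow>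
        frechet_ineq F X u w \<longrightarrow> (F u - F u0) powr (1 - d) \<le> norm w"
      using lojasiewicz_on_pattern[OF u0] by blast
    have "Q \<delta> \<sigma>" if "\<delta> > 0" "\<delta> < d" for \<delta>
      unfolding Q_def
    proof (intro ballI allI impI)
      fix u w assume u: "u \<in> X \<inter> ball u0 \<delta>" "pattern u = \<sigma>" "F u > F u0" "F u < F u0 + 1"
        "frechet_ineq F X u w"
      have "(F u - F u0) powr (1 - \<delta>) \<le> (F u - F u0) powr (1 - d)"
        using u that by (intro powr_mono') auto
      also have "\<dots> \<le> norm w" using d(2) u that by auto
      finally show "(F u - F u0) powr (1 - \<delta>) \<le> norm w" .
    qed
    then show ?thesis using d(1) by (auto simp: eventually_at_right_field)
  qed
  then have "eventually (\<lambda>\<delta>. \<forall>\<sigma>\<in>range pattern. Q \<delta> \<sigma>) (at_right 0)"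
    by (intro eventually_ball_finite finite_patterns) auto
  moreover have "eventually (\<lambda>\<delta>. \<forall>u\<in>X \<inter> ball u0 \<delta>. F u < F u0 + 1) (at_right 0)"
  proof -
    obtain d where "d > 0" "\<forall>u\<in>X. dist u u0 < d \<longrightarrow> dist (F u) (F u0) < 1"
      using cont_F u0 unfolding continuous_on_iff by (metis zero_less_one)
    then show ?thesis unfolding eventually_at_right_field
      by (intro exI[of _ d]) (force simp: dist_commute dist_real_def)
  qed
  moreover have "eventually (\<lambda>\<delta>::real. 0 < \<delta> \<and> \<delta> < 1) (at_right 0)"
    by (auto simp: eventually_at_right_field intro: exI[of _ 1])
  ultimately have "eventually (\<lambda>\<delta>. 0 < \<delta> \<and> \<delta> < 1 \<and> (\<forall>u\<in>X \<inter> ball u0 \<delta>. \<forall>w. F u > F u0 \<longrightarrow>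
      frechet_ineq F X u w \<longrightarrow> (F u - F u0) powr (1 - \<delta>) \<le> norm w)) (at_right 0)"
    by eventually_elim (auto simp: Q_def)
  from eventually_happens'[OF _ this] show ?thesis by auto
qed

end

section \<open>Descent sequences of finite length\<close>

text \<open>The graph of the concave function \<open>s powr \<delta>\<close> lies below its
  tangents; this follows from the weighted Young inequality and includes
  \<open>s' = 0\<close>.\<close>

lemma powr_diff_concave:
  fixes s s' \<delta> :: real
  assumes "0 < s" "0 \<le> s'" "0 < \<delta>" "\<delta> < 1"
  shows "\<delta> * s powr (\<delta> - 1) * (s - s') \<le> s powr \<delta> - s' powr \<delta>"
proof -
  have "s' powr \<delta> * s powr (1 - \<delta>) \<le> \<delta> * s' + (1 - \<delta>) * s"
    using Youngs_inequality_0[of \<delta> "1 - \<delta>" s' s] assms by (cases "s' = 0") auto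
  then have "(s' powr \<delta> * s powr (1 - \<delta>)) * s powr (\<delta> - 1) \<le> (\<delta> * s' + (1 - \<delta>) * s) * s powr (\<delta> - 1)"
    by (rule mult_right_mono) simp
  moreover have "s powr (1 - \<delta>) * s powr (\<delta> - 1) = 1"
    using assms by (simp add: powr_add[symmetric])
  moreover have "s * s powr (\<delta> - 1) = s powr \<delta>"
    using assms by (simp add: powr_mult_base)
  ultimately show ?thesis by (simp add: algebra_simps)
qed

text \<open>The finite length argument. Near \<open>u0\<close>, descent and the Lojasiewicz
  inequality bound twice a step by the previous step plus a telescoping difference of
  \<open>\<phi> k = r k powr \<delta>\<close>. Once the sequence is close to \<open>u0\<close> with
  small values, the remaining length is too small to leave the ball.\<close>

lemma converges_if_lojasiewicz_descent:
  fixes u :: "nat \<Rightarrow> 'a::real_normed_vector" and r :: "nat \<Rightarrow> real"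
  assumes "a > 0" "b > 0" and \<delta>: "0 < \<delta>" "\<delta> < 1"
    and r_nonneg: "\<And>k. r k \<ge> 0" and r_lim: "r \<longlonglongrightarrow> 0"
    and descent: "\<And>k. a * (norm (u (Suc k) - u k))\<^sup>2 \<le> r k - r (Suc k)"
    and ineq: "\<And>k. u (Suc k) \<in> ball u0 \<delta> \<Longrightarrow> r (Suc k) > 0 \<Longrightarrow>
      r (Suc k) powr (1 - \<delta>) \<le> b * norm (u (Suc k) - u k)"
    and subseq: "strict_mono \<sigma>" "(\<lambda>j. u (\<sigma> j)) \<longlonglongrightarrow> u0"
  shows "u \<longlonglongrightarrow> u0"
proof -
  define D where "D = (\<lambda>k. norm (u (Suc k) - u k))"
  define \<phi> where "\<phi> = (\<lambda>k. r k powr \<delta>)"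
  define M where "M = b / (a * \<delta>)"
  have M: "M > 0" using assms by (simp add: M_def)
  \<comment> \<open>If the value is already 0, descent makes the next step vanish. Otherwise the
    concavity estimate bounds \<open>(D (Suc k))^2\<close> by \<open>D k\<close> times the
    \<open>\<phi>\<close> term, and the arithmetic-geometric mean inequality finishes.\<close>
  have key: "2 * D (Suc k) \<le> D k + M * (\<phi> (Suc k) - \<phi> (Suc (Suc k)))" if "u (Suc k) \<in> ball u0 \<delta>" for k
  proof (cases "r (Suc k) = 0")
    case True
    have "a * (D (Suc k))\<^sup>2 \<le> - r (Suc (Suc k))" using descent[of "Suc k"] True by (simp add: D_def)
    moreover have "0 \<le> a * (D (Suc k))\<^sup>2" using \<open>a > 0\<close> by simp
    ultimately have "r (Suc (Suc k)) = 0" "a * (D (Suc k))\<^sup>2 = 0"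
      using r_nonneg[of "Suc (Suc k)"] by linarith+
    then show ?thesis using True \<open>a > 0\<close> by (simp add: \<phi>_def) (simp add: D_def)
  next
    case False
    then have pos: "r (Suc k) > 0" using r_nonneg[of "Suc k"] by simp
    define s where "s = r (Suc k)"
    have s: "s > 0" using pos by (simp add: s_def)
    have le: "s powr (1 - \<delta>) \<le> b * D k" using ineq[OF that pos] by (simp add: D_def s_def)
    have "s powr (1 - \<delta>) > 0" using s by simp
    with le have "0 < b * D k" by linarith
    then have Dk: "D k > 0" using \<open>b > 0\<close> by (simp add: zero_less_mult_iff)
    have "a * (D (Suc k))\<^sup>2 \<le> s - r (Suc (Suc k))" using descent[of "Suc k"] by (simp add: D_def s_def)
    then have "\<delta> * s powr (\<delta> - 1) * (a * (D (Suc k))\<^sup>2) \<le> \<delta> * s powr (\<delta> - 1) * (s - r (Suc (Suc k)))"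
      using \<delta> by (intro mult_left_mono) auto
    also have "\<dots> \<le> \<phi> (Suc k) - \<phi> (Suc (Suc k))"
      unfolding \<phi>_def s_def[symmetric] using powr_diff_concave[OF s r_nonneg \<delta>] .
    finally have 1: "\<delta> * s powr (\<delta> - 1) * (a * (D (Suc k))\<^sup>2) \<le> \<phi> (Suc k) - \<phi> (Suc (Suc k))" .
    have "s powr (\<delta> - 1) * s powr (1 - \<delta>) = 1" using s by (simp add: powr_add[symmetric])
    then have "\<delta> * a * (D (Suc k))\<^sup>2 = \<delta> * s powr (\<delta> - 1) * (a * (D (Suc k))\<^sup>2) * s powr (1 - \<delta>)"
      by (simp add: mult_ac)
    also have "\<dots> \<le> (\<phi> (Suc k) - \<phi> (Suc (Suc k))) * s powr (1 - \<delta>)"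
      using 1 by (rule mult_right_mono) simp
    also have "\<dots> \<le> (\<phi> (Suc k) - \<phi> (Suc (Suc k))) * (b * D k)"
    proof (rule mult_left_mono[OF le])
      have "0 \<le> \<delta> * s powr (\<delta> - 1) * (a * (D (Suc k))\<^sup>2)" using \<delta> \<open>a > 0\<close> by simp
      then show "0 \<le> \<phi> (Suc k) - \<phi> (Suc (Suc k))" using 1 by linarith
    qed
    finally have "(D (Suc k))\<^sup>2 \<le> D k * (M * (\<phi> (Suc k) - \<phi> (Suc (Suc k))))"
      using \<delta> \<open>a > 0\<close> by (simp add: M_def field_simps)
    moreover have "4 * (x * y) \<le> (x + y)\<^sup>2" for x y :: real
      using zero_le_power2[of "x - y"] by (simp add: power2_eq_square algebra_simps)
    ultimately have "(2 * D (Suc k))\<^sup>2 \<le> (D k + M * (\<phi> (Suc k) - \<phi> (Suc (Suc k))))\<^sup>2"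
      by (smt (verit) four_x_squared)
    moreover have "0 \<le> M * (\<phi> (Suc k) - \<phi> (Suc (Suc k)))"
    proof -
      have "0 \<le> \<delta> * s powr (\<delta> - 1) * (a * (D (Suc k))\<^sup>2)" using \<delta> \<open>a > 0\<close> by simp
      then show ?thesis using 1 M by simp
    qed
    then have "0 \<le> D k + M * (\<phi> (Suc k) - \<phi> (Suc (Suc k)))" using Dk by simp
    ultimately show ?thesis by (rule power2_le_imp_le)
  qed
  have D_le: "D k \<le> sqrt (r k / a)" for k
  proof -
    have "(D k)\<^sup>2 \<le> r k / a"
      using descent[of k] r_nonneg[of "Suc k"] \<open>a > 0\<close> by (simp add: D_def field_simps)
    then show ?thesis by (simp add: real_le_rsqrt)
  qed
  have "(\<lambda>k. sqrt (r k / a) + M * (r (Suc k) powr \<delta>)) \<longlonglongrightarrow> sqrt (0 / a) + M * 0"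
  proof (intro tendsto_intros r_lim)
    show "(\<lambda>k. r (Suc k) powr \<delta>) \<longlonglongrightarrow> 0"
      by (rule tendsto_zero_powrI[OF LIMSEQ_Suc[OF r_lim] tendsto_const]) (use r_nonneg \<delta>(1) in auto)
  qed (use \<open>a > 0\<close> in auto)
  then have c_lim: "(\<lambda>k. sqrt (r k / a) + M * (r (Suc k) powr \<delta>)) \<longlonglongrightarrow> 0" by simp
  show ?thesis
  proof (rule metric_LIMSEQ_I)
    fix e' :: real assume "0 < e'"
    define e where "e = min e' \<delta>"
    have e: "e > 0" "e \<le> \<delta>" "e \<le> e'" using \<open>0 < e'\<close> \<delta> by (auto simp: e_def)
    obtain N0 where N0: "\<And>k. k \<ge> N0 \<Longrightarrow> sqrt (r k / a) + M * (r (Suc k) powr \<delta>) < e / 2"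
      using order_tendstoD(2)[OF c_lim, of "e / 2"] e(1) by (auto simp: eventually_sequentially)
    obtain J where J: "\<And>j. j \<ge> J \<Longrightarrow> dist (u (\<sigma> j)) u0 < e / 2"
      using metric_LIMSEQ_D[OF subseq(2), of "e / 2"] e(1) by auto
    define j where "j = max J (Suc N0)"
    have "\<sigma> j \<ge> Suc N0" using seq_suble[OF subseq(1), of j] by (simp add: j_def)
    then obtain N where N: "\<sigma> j = Suc N" "N \<ge> N0" by (cases "\<sigma> j") auto
    have start: "dist (u (Suc N)) u0 < e / 2" using J[of j] N(1) by (simp add: j_def)
    have budget: "D N + M * \<phi> (Suc N) < e / 2"
      using N0[OF N(2)] D_le[of N] by (simp add: \<phi>_def)
    have \<phi>0: "\<phi> k \<ge> 0" and D0: "D k \<ge> 0" for k by (auto simp: \<phi>_def D_def)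
    \<comment> \<open>Length and distance are carried together: the distance bound makes
      \<open>key\<close> applicable, and \<open>key\<close> extends the length bound by one
      step.\<close>
    have main: "(\<Sum>i<n. D (Suc N + i)) + D (N + n) + M * \<phi> (Suc N + n) \<le> D N + M * \<phi> (Suc N)
        \<and> dist (u (Suc N + n)) u0 < e" for n
    proof (induction n)
      case 0
      then show ?case using start e(1) by simp
    next
      case (Suc n)
      have "u (Suc (N + n)) \<in> ball u0 \<delta>" using Suc e(2) by (simp add: dist_commute)
      from key[OF this] have sum: "(\<Sum>i<Suc n. D (Suc N + i)) + D (N + Suc n) + M * \<phi> (Suc N + Suc n)
          \<le> D N + M * \<phi> (Suc N)"
        using Suc by (simp add: algebra_simps)
      have tele: "dist (u (Suc N + m)) (u (Suc N)) \<le> (\<Sum>i<m. D (Suc N + i))" for m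
      proof (induction m)
        case (Suc m)
        have "dist (u (Suc N + Suc m)) (u (Suc N)) \<le>
            dist (u (Suc N + Suc m)) (u (Suc N + m)) + dist (u (Suc N + m)) (u (Suc N))"
          by (rule dist_triangle)
        then show ?case using Suc by (simp add: D_def dist_norm)
      qed simp
      have "dist (u (Suc N + Suc n)) u0 \<le> dist (u (Suc N + Suc n)) (u (Suc N)) + dist (u (Suc N)) u0"
        by (rule dist_triangle)
      also have "\<dots> < (\<Sum>i<Suc n. D (Suc N + i)) + e / 2"
        by (intro add_le_less_mono tele start)
      also have "\<dots> \<le> e"
        using sum budget D0[of "N + Suc n"] mult_nonneg_nonneg[OF less_imp_le[OF M] \<phi>0[of "Suc N + Suc n"]]
        by linarith
      finally show ?case using sum by blast
    qed
    have "dist (u n) u0 < e'" if "n \<ge> Suc N" for n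
      using main[of "n - Suc N"] that e(3) by simp
    then show "\<exists>no. \<forall>n\<ge>no. dist (u n) u0 < e'" by blast
  qed
qed

section \<open>Proximal alternating minimization\<close>

text \<open>Comparison with the previous iterate gives descent, and the optimality conditions give
  subgradients \<open>w k\<close> bounded by the step length; \<open>loj\<close> at a cluster point
  then yields convergence. Functions stay real-valued, the constraint being kept in
  \<open>X\<close>.\<close>

lemma proximal_alternating_minimization:
  fixes g :: "'a::euclidean_space \<times> 'b::euclidean_space \<times> 'c::euclidean_space \<Rightarrow> real"
    and h :: "'c \<Rightarrow> real" and C :: "'c set" and x y c
  defines "F \<equiv> \<lambda>u. g u + h (snd (snd u))" and "X \<equiv> UNIV \<times> UNIV \<times> C"
    and "u \<equiv> \<lambda>k::nat. (x k, y k, c k)"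
  assumes g: "real_polynomial_function g" and g_nonneg: "\<And>u. g u \<ge> 0"
    and h_nonneg: "\<And>c. h c \<ge> 0" and h_cont: "continuous_on UNIV h" and C: "closed C"
    and loj: "\<And>u0. u0 \<in> X \<Longrightarrow> \<exists>\<delta>>0. \<delta> < 1 \<and> (\<forall>u\<in>X \<inter> ball u0 \<delta>. \<forall>w. F u > F u0 \<longrightarrow>
      frechet_ineq F X u w \<longrightarrow> (F u - F u0) powr (1 - \<delta>) \<le> norm w)"
    and \<rho>: "\<rho>1 > 0" "\<rho>2 > 0" "\<rho>3 > 0"
    and c_in: "\<And>k. c k \<in> C"
    and min_x: "\<And>k z. g (x (Suc k), y k, c k) + \<rho>1 / 2 * (norm (x (Suc k) - x k))\<^sup>2 \<le>
      g (z, y k, c k) + \<rho>1 / 2 * (norm (z - x k))\<^sup>2"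
    and min_y: "\<And>k z. g (x (Suc k), y (Suc k), c k) + \<rho>2 / 2 * (norm (y (Suc k) - y k))\<^sup>2 \<le>
      g (x (Suc k), z, c k) + \<rho>2 / 2 * (norm (z - y k))\<^sup>2"
    and min_c: "\<And>k z. z \<in> C \<Longrightarrow>
      g (x (Suc k), y (Suc k), c (Suc k)) + h (c (Suc k)) + \<rho>3 / 2 * (norm (c (Suc k) - c k))\<^sup>2 \<le>
      g (x (Suc k), y (Suc k), z) + h z + \<rho>3 / 2 * (norm (z - c k))\<^sup>2"
    and bdd: "bounded (range u)"
  shows "\<exists>u0 w. u0 \<in> X \<and> u \<longlonglongrightarrow> u0 \<and> w \<longlonglongrightarrow> 0 \<and> (\<forall>k. frechet_ineq F X (u (Suc k)) (w k))"
proof -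
  obtain D where D: "polynomial_function D" "\<And>u. (g has_derivative (\<lambda>h. D u \<bullet> h)) (at u)"
    using polynomial_gradient[OF g] by blast
  define a where "a = min \<rho>1 (min \<rho>2 \<rho>3) / 2"
  have a: "a > 0" "a \<le> \<rho>1 / 2" "a \<le> \<rho>2 / 2" "a \<le> \<rho>3 / 2" using \<rho> by (auto simp: a_def)
  have du: "u (Suc k) - u k = (x (Suc k) - x k, y (Suc k) - y k, c (Suc k) - c k)" for k
    by (simp add: u_def)
  have norm_du: "(norm (u (Suc k) - u k))\<^sup>2 =
      (norm (x (Suc k) - x k))\<^sup>2 + (norm (y (Suc k) - y k))\<^sup>2 + (norm (c (Suc k) - c k))\<^sup>2" for k
    unfolding du by (simp add: norm_Pair)
  have comp_le: "norm (x (Suc k) - x k) \<le> norm (u (Suc k) - u k)"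
    "norm (y (Suc k) - y k) \<le> norm (u (Suc k) - u k)"
    "norm (c (Suc k) - c k) \<le> norm (u (Suc k) - u k)" for k
    by (rule power2_le_imp_le; simp add: norm_du)+
  have descent: "a * (norm (u (Suc k) - u k))\<^sup>2 \<le> F (u k) - F (u (Suc k))" for k
  proof -
    have "a * (norm (x (Suc k) - x k))\<^sup>2 \<le> \<rho>1 / 2 * (norm (x (Suc k) - x k))\<^sup>2"
      "a * (norm (y (Suc k) - y k))\<^sup>2 \<le> \<rho>2 / 2 * (norm (y (Suc k) - y k))\<^sup>2"
      "a * (norm (c (Suc k) - c k))\<^sup>2 \<le> \<rho>3 / 2 * (norm (c (Suc k) - c k))\<^sup>2"
      using a by (intro mult_right_mono; simp)+
    moreover have "F (u j) = g (x j, y j, c j) + h (c j)" for j by (simp add: F_def u_def)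
    ultimately show ?thesis
      using min_x[of k "x k"] min_y[of k "y k"] min_c[OF c_in, of k k]
      unfolding norm_du distrib_left by simp
  qed
  obtain R where R: "\<And>k. norm (u k) \<le> R" using bdd by (auto simp: bounded_iff)
  have R3: "norm (x k) \<le> R" "norm (y k) \<le> R" "norm (c k) \<le> R" for k
  proof -
    show "norm (x k) \<le> R" using norm_fst_le[of "x k" "(y k, c k)"] R[of k] by (simp add: u_def)
    have "norm (y k, c k) \<le> R" using norm_snd_le[of "(y k, c k)" "x k"] R[of k] by (simp add: u_def)
    then show "norm (y k) \<le> R" "norm (c k) \<le> R"
      using norm_fst_le[of "y k" "c k"] norm_snd_le[of "c k" "y k"] by linarith+
  qed
  \<comment> \<open>The intermediate points mix old and new components; one ball contains all of
    them.\<close>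
  have in_cball: "(x i, y j, c k) \<in> cball 0 (3 * R)" for i j k
    using norm_Pair_le[of "x i" "(y j, c k)"] norm_Pair_le[of "y j" "c k"] R3(1)[of i] R3(2)[of j] R3(3)[of k]
    by simp
  obtain L where L: "L > 0" "\<And>p q. p \<in> cball 0 (3 * R) \<Longrightarrow> q \<in> cball 0 (3 * R) \<Longrightarrow>
      norm (D p - D q) \<le> L * norm (p - q)"
    using polynomial_lipschitz_on_cball[OF D(1)] by blast
  have opt_x: "fst (D (x (Suc k), y k, c k)) = - \<rho>1 *\<^sub>R (x (Suc k) - x k)" for k
  proof -
    have "((\<lambda>z. g (z, y k, c k)) has_derivative (\<lambda>d. D (x (Suc k), y k, c k) \<bullet> (d, 0, 0))) (at (x (Suc k)))"
      by (rule has_derivative_compose[OF _ D(2)]) (auto intro!: derivative_eq_intros simp: zero_prod_def)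
    then have "((\<lambda>z. g (z, y k, c k) + \<rho>1 / 2 * (norm (z - x k))\<^sup>2) has_derivative
        (\<lambda>d. D (x (Suc k), y k, c k) \<bullet> (d, 0, 0) + \<rho>1 * ((x (Suc k) - x k) \<bullet> d))) (at (x (Suc k)))"
      unfolding power2_norm_eq_inner
      by (auto intro!: derivative_eq_intros simp: inner_commute algebra_simps)
    from differential_zero_maxmin[OF _ open_UNIV this] min_x[of k]
    have "D (x (Suc k), y k, c k) \<bullet> (d, 0, 0) + \<rho>1 * ((x (Suc k) - x k) \<bullet> d) = 0" for d
      by (simp add: fun_eq_iff)
    then have "(fst (D (x (Suc k), y k, c k)) + \<rho>1 *\<^sub>R (x (Suc k) - x k)) \<bullet> d = 0" for d
      by (simp add: inner_prod_def inner_add_left)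
    then have "fst (D (x (Suc k), y k, c k)) + \<rho>1 *\<^sub>R (x (Suc k) - x k) = 0"
      by (metis inner_eq_zero_iff)
    then show ?thesis by (simp add: eq_neg_iff_add_eq_0)
  qed
  have opt_y: "fst (snd (D (x (Suc k), y (Suc k), c k))) = - \<rho>2 *\<^sub>R (y (Suc k) - y k)" for k
  proof -
    have "((\<lambda>z. g (x (Suc k), z, c k)) has_derivative (\<lambda>d. D (x (Suc k), y (Suc k), c k) \<bullet> (0, d, 0))) (at (y (Suc k)))"
      by (rule has_derivative_compose[OF _ D(2)]) (auto intro!: derivative_eq_intros)
    then have "((\<lambda>z. g (x (Suc k), z, c k) + \<rho>2 / 2 * (norm (z - y k))\<^sup>2) has_derivative
        (\<lambda>d. D (x (Suc k), y (Suc k), c k) \<bullet> (0, d, 0) + \<rho>2 * ((y (Suc k) - y k) \<bullet> d))) (at (y (Suc k)))"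
      unfolding power2_norm_eq_inner
      by (auto intro!: derivative_eq_intros simp: inner_commute algebra_simps)
    from differential_zero_maxmin[OF _ open_UNIV this] min_y[of k]
    have "D (x (Suc k), y (Suc k), c k) \<bullet> (0, d, 0) + \<rho>2 * ((y (Suc k) - y k) \<bullet> d) = 0" for d
      by (simp add: fun_eq_iff)
    then have "(fst (snd (D (x (Suc k), y (Suc k), c k))) + \<rho>2 *\<^sub>R (y (Suc k) - y k)) \<bullet> d = 0" for d
      by (simp add: inner_prod_def inner_add_left)
    then have "fst (snd (D (x (Suc k), y (Suc k), c k))) + \<rho>2 *\<^sub>R (y (Suc k) - y k) = 0"
      by (metis inner_eq_zero_iff)
    then show ?thesis by (simp add: eq_neg_iff_add_eq_0)
  qed
  \<comment> \<open>The partial gradients of \<open>g\<close> in x and y at the new point, and in c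
    the negative proximal term, as optimality in the third subproblem prescribes.\<close>
  define w where "w = (\<lambda>k. (fst (D (u (Suc k))), fst (snd (D (u (Suc k)))), - \<rho>3 *\<^sub>R (c (Suc k) - c k)))"
  define b where "b = 2 * L + \<rho>1 + \<rho>2 + \<rho>3"
  have b: "b > 0" using L(1) \<rho> by (simp add: b_def)
  \<comment> \<open>The optimality conditions in x and y hold at intermediate points; the Lipschitz
    bound on \<open>D\<close> transfers them to \<open>u (Suc k)\<close>.\<close>
  have w_le: "norm (w k) \<le> b * norm (u (Suc k) - u k)" for k
  proof -
    let ?n = "norm (u (Suc k) - u k)"
    have fst_le: "norm (fst p) \<le> norm p" and snd_le: "norm (fst (snd p)) \<le> norm p"
      for p :: "'a \<times> 'b \<times> 'c"
      using norm_fst_le[of "fst p" "snd p"] norm_snd_le[of "snd p" "fst p"]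
        norm_fst_le[of "fst (snd p)" "snd (snd p)"] by simp_all
    have "norm (D (u (Suc k)) - D (x (Suc k), y k, c k)) \<le> L * norm (u (Suc k) - (x (Suc k), y k, c k))"
      using in_cball by (intro L(2)) (auto simp: u_def)
    also have "norm (u (Suc k) - (x (Suc k), y k, c k)) \<le> ?n"
      by (rule power2_le_imp_le) (simp_all add: norm_du, simp add: u_def norm_Pair)
    finally have 1: "norm (fst (D (u (Suc k))) - fst (D (x (Suc k), y k, c k))) \<le> L * ?n"
      using fst_le[of "D (u (Suc k)) - D (x (Suc k), y k, c k)"] L(1) by simp
    have "norm (D (u (Suc k)) - D (x (Suc k), y (Suc k), c k)) \<le> L * norm (u (Suc k) - (x (Suc k), y (Suc k), c k))"
      using in_cball by (intro L(2)) (auto simp: u_def)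
    also have "norm (u (Suc k) - (x (Suc k), y (Suc k), c k)) \<le> ?n"
      by (rule power2_le_imp_le) (simp_all add: norm_du, simp add: u_def norm_Pair)
    finally have 2: "norm (fst (snd (D (u (Suc k)))) - fst (snd (D (x (Suc k), y (Suc k), c k)))) \<le> L * ?n"
      using snd_le[of "D (u (Suc k)) - D (x (Suc k), y (Suc k), c k)"] L(1) by simp
    have "norm (fst (D (u (Suc k)))) \<le> L * ?n + \<rho>1 * norm (x (Suc k) - x k)"
      using 1 norm_triangle_sub[of "fst (D (u (Suc k)))" "fst (D (x (Suc k), y k, c k))"] \<rho>(1)
      unfolding opt_x by simp
    moreover have "norm (fst (snd (D (u (Suc k))))) \<le> L * ?n + \<rho>2 * norm (y (Suc k) - y k)"
      using 2 norm_triangle_sub[of "fst (snd (D (u (Suc k))))" "fst (snd (D (x (Suc k), y (Suc k), c k)))"] \<rho>(2)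
      unfolding opt_y by simp
    moreover have "norm (w k) \<le> norm (fst (D (u (Suc k)))) + (norm (fst (snd (D (u (Suc k))))) +
        norm (- \<rho>3 *\<^sub>R (c (Suc k) - c k)))"
      unfolding w_def by (intro order_trans[OF norm_Pair_le] add_left_mono norm_Pair_le)
    moreover have "norm (- \<rho>3 *\<^sub>R (c (Suc k) - c k)) = \<rho>3 * norm (c (Suc k) - c k)" using \<rho>(3) by simp
    moreover have "\<rho>1 * norm (x (Suc k) - x k) \<le> \<rho>1 * ?n" "\<rho>2 * norm (y (Suc k) - y k) \<le> \<rho>2 * ?n"
      "\<rho>3 * norm (c (Suc k) - c k) \<le> \<rho>3 * ?n"
      using \<rho> comp_le by (intro mult_left_mono; simp)+
    ultimately show ?thesis by (simp add: b_def algebra_simps)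
  qed
  \<comment> \<open>Minimality in c controls \<open>h\<close>, and linearizing \<open>g\<close>
    relates the competitor to an arbitrary point. The error \<open>e\<close> is split into two
    quarters for the linearizations and one half for the quadratic proximal term.\<close>
  have fr: "frechet_ineq F X (u (Suc k)) (w k)" for k
    unfolding frechet_ineq_def
  proof (intro allI impI)
    fix e :: real assume e: "e > 0"
    let ?u = "u (Suc k)"
    obtain r where r: "r > 0" "\<And>z. norm (z - ?u) < r \<Longrightarrow> norm (g z - g ?u - D ?u \<bullet> (z - ?u)) \<le> e / 4 * norm (z - ?u)"
      using D(2)[of ?u] e unfolding has_derivative_at_alt by (meson divide_pos_pos zero_less_numeral)
    \<comment> \<open>The bound \<open>e / \<rho>3\<close> turns \<open>\<rho>3 / 2 * d^2\<close>
      into at most \<open>e / 2 * norm (z - ?u)\<close>.\<close>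
    define r' where "r' = min r (e / \<rho>3)"
    have r': "r' > 0" "r' \<le> r" "\<rho>3 * r' \<le> e"
      using r(1) e \<rho>(3) by (auto simp: r'_def field_simps min_def)
    have "F z - F ?u - w k \<bullet> (z - ?u) \<ge> - e * norm (z - ?u)" if z: "z \<in> X \<inter> ball ?u r'" for z
    proof -
      obtain z1 z2 z3 where zz: "z = (z1, z2, z3)" by (cases z) auto
      have z3: "z3 \<in> C" using z by (simp add: zz X_def)
      let ?c = "c (Suc k)"
      \<comment> \<open>The competitor in the third subproblem: only the last component of the new
        iterate is moved.\<close>
      define v where "v = (x (Suc k), y (Suc k), z3)"
      define d where "d = norm (z3 - ?c)"
      have nz: "norm (z - ?u) < r'" using z by (simp add: dist_norm norm_minus_commute)
      have nv: "norm (v - ?u) = d" by (simp add: v_def u_def d_def norm_Pair)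
      have d_le: "d \<le> norm (z - ?u)"
        unfolding d_def by (rule power2_le_imp_le) (simp_all add: zz u_def norm_Pair)
      have 1: "- (e / 4) * norm (z - ?u) \<le> g z - g ?u - D ?u \<bullet> (z - ?u)"
      proof -
        have "\<bar>g z - g ?u - D ?u \<bullet> (z - ?u)\<bar> \<le> e / 4 * norm (z - ?u)"
          using r(2)[of z] nz r'(2) by simp
        then show ?thesis by (simp only: abs_le_iff minus_mult_left) linarith
      qed
      have 2: "g v - g ?u - D ?u \<bullet> (v - ?u) \<le> e / 4 * norm (z - ?u)"
      proof -
        have "\<bar>g v - g ?u - D ?u \<bullet> (v - ?u)\<bar> \<le> e / 4 * d"
          using r(2)[of v] nz r'(2) d_le by (simp add: nv)
        also have "\<dots> \<le> e / 4 * norm (z - ?u)" using e by (intro mult_left_mono d_le) simp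
        finally show ?thesis by (simp only: abs_le_iff)
      qed
      have ip: "D ?u \<bullet> (v - ?u) = snd (snd (D ?u)) \<bullet> (z3 - ?c)"
        by (simp add: v_def u_def inner_prod_def)
      have "(norm (z3 - c k))\<^sup>2 - (norm (?c - c k))\<^sup>2 = d\<^sup>2 + 2 * ((?c - c k) \<bullet> (z3 - ?c))"
      proof -
        have "(p + q) \<bullet> (p + q) - q \<bullet> q = p \<bullet> p + 2 * (q \<bullet> p)" for p q :: 'c
          by (simp add: inner_add_left inner_add_right inner_commute)
        from this[of "z3 - ?c" "?c - c k"] show ?thesis
          unfolding d_def power2_norm_eq_inner by simp
      qed
      from arg_cong[OF this, of "\<lambda>r. \<rho>3 / 2 * r"]
      have "\<rho>3 / 2 * (norm (z3 - c k))\<^sup>2 - \<rho>3 / 2 * (norm (?c - c k))\<^sup>2 =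
          \<rho>3 / 2 * d\<^sup>2 + \<rho>3 * ((?c - c k) \<bullet> (z3 - ?c))"
        by (simp add: right_diff_distrib distrib_left)
      with min_c[OF z3, of k]
      have 3: "h z3 - h ?c \<ge> - (g v - g ?u) - (\<rho>3 / 2 * d\<^sup>2 + \<rho>3 * ((?c - c k) \<bullet> (z3 - ?c)))"
        by (simp add: v_def u_def)
      have "\<rho>3 / 2 * d\<^sup>2 \<le> \<rho>3 / 2 * (r' * norm (z - ?u))"
        unfolding power2_eq_square using d_le nz \<rho>(3) r'(1)
        by (intro mult_left_mono mult_mono) (auto simp: d_def)
      also have "\<dots> \<le> e / 2 * norm (z - ?u)"
        using mult_right_mono[OF r'(3) norm_ge_zero[of "z - ?u"]] by (simp add: mult.assoc)
      finally have 4: "\<rho>3 / 2 * d\<^sup>2 \<le> e / 2 * norm (z - ?u)" .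
      have "w k \<bullet> (z - ?u) = D ?u \<bullet> (z - ?u) - snd (snd (D ?u)) \<bullet> (z3 - ?c) - \<rho>3 * ((?c - c k) \<bullet> (z3 - ?c))"
        by (simp add: w_def zz inner_prod_def) (simp add: u_def)
      moreover have "F z - F ?u = (g z - g ?u) + (h z3 - h ?c)"
        by (simp add: F_def zz) (simp add: u_def)
      ultimately show ?thesis using 1 2 3 4 ip by (simp add: algebra_simps)
    qed
    then show "\<exists>r>0. \<forall>z\<in>X \<inter> ball ?u r. - e * norm (z - ?u) \<le> F z - F ?u - w k \<bullet> (z - ?u)"
      using r'(1) by blast
  qed
  obtain u0 \<sigma> where \<sigma>: "strict_mono \<sigma>" "(u \<circ> \<sigma>) \<longlonglongrightarrow> u0"
    using bounded_imp_convergent_subsequence[OF bdd] by blast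
  have closedX: "closed X" unfolding X_def by (intro closed_Times closed_UNIV C)
  have uX: "u k \<in> X" for k using c_in by (simp add: u_def X_def)
  have u0X: "u0 \<in> X" using closed_sequentially[OF closedX _ \<sigma>(2)] uX by simp
  have contF: "continuous_on UNIV F"
    unfolding F_def
    by (intro continuous_on_add continuous_on_polymonial_function
        continuous_on_compose2[OF h_cont] continuous_intros)
       (use g in \<open>auto simp: real_polynomial_function_eq\<close>)
  have "decseq (\<lambda>k. F (u k))"
  proof (rule decseq_SucI)
    fix k
    have "0 \<le> a * (norm (u (Suc k) - u k))\<^sup>2" using a(1) by simp
    then show "F (u (Suc k)) \<le> F (u k)" using descent[of k] by linarith
  qed
  moreover have "0 \<le> F (u k)" for k using g_nonneg h_nonneg by (simp add: F_def)
  ultimately obtain l where l: "(\<lambda>k. F (u k)) \<longlonglongrightarrow> l" "\<And>k. l \<le> F (u k)"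
    using decseq_convergent by blast
  \<comment> \<open>By continuity the limit of the decreasing values is the value at the cluster
    point.\<close>
  have "(\<lambda>j. F ((u \<circ> \<sigma>) j)) \<longlonglongrightarrow> F u0"
    by (rule continuous_on_tendsto_compose[OF contF \<sigma>(2)]) auto
  moreover have "(\<lambda>j. F ((u \<circ> \<sigma>) j)) \<longlonglongrightarrow> l"
    using LIMSEQ_subseq_LIMSEQ[OF l(1) \<sigma>(1)] by (simp add: o_def)
  ultimately have lF: "l = F u0" by (rule LIMSEQ_unique[rotated])
  obtain \<delta> where \<delta>: "\<delta> > 0" "\<delta> < 1" "\<And>u w. u \<in> X \<inter> ball u0 \<delta> \<Longrightarrow> F u > F u0 \<Longrightarrow>
      frechet_ineq F X u w \<Longrightarrow> (F u - F u0) powr (1 - \<delta>) \<le> norm w"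
    using loj[OF u0X] by blast
  have u_lim: "u \<longlonglongrightarrow> u0"
  proof (rule converges_if_lojasiewicz_descent[OF a(1) b \<delta>(1,2)])
    show "(\<lambda>k. F (u k) - F u0) \<longlonglongrightarrow> 0" using l(1) by (simp add: lF LIM_zero_iff)
    show "(F (u (Suc k)) - F u0) powr (1 - \<delta>) \<le> b * norm (u (Suc k) - u k)"
      if "u (Suc k) \<in> ball u0 \<delta>" "0 < F (u (Suc k)) - F u0" for k
      using \<delta>(3)[OF _ _ fr[of k]] that uX w_le[of k] by (meson IntI diff_gt_0_iff_gt order_trans)
    show "(\<lambda>j. u (\<sigma> j)) \<longlonglongrightarrow> u0" using \<sigma>(2) by (simp add: o_def)
  qed (use \<sigma>(1) l(2) lF descent in auto)
  have "w \<longlonglongrightarrow> 0"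
  proof (rule Lim_null_comparison)
    show "eventually (\<lambda>k. norm (w k) \<le> b * norm (u (Suc k) - u k)) sequentially" using w_le by simp
    have "(\<lambda>k. b * norm (u (Suc k) - u k)) \<longlonglongrightarrow> b * norm (u0 - u0)"
      by (intro tendsto_intros LIMSEQ_Suc u_lim)
    then show "(\<lambda>k. b * norm (u (Suc k) - u k)) \<longlonglongrightarrow> 0" by simp
  qed
  with u0X u_lim fr show ?thesis by blast
qed

section \<open>The tensor objective\<close>

text \<open>Outside \<open>X\<close> the quotient is \<open>\<infinity>\<close>, so only points of
  \<open>X\<close> can lower the limit inferior, and there it is at least \<open>- e\<close> near
  \<open>u\<close>.\<close>

lemma frechet_subdiff_if_frechet_ineq:
  assumes u: "u \<in> X" and w: "frechet_ineq F X u w"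
  shows "w \<in> frechet_subdiff (\<lambda>z. if z \<in> X then ereal (F z) else \<infinity>) u"
proof -
  define Q where "Q = (\<lambda>z. ((if z \<in> X then ereal (F z) else \<infinity>) - (if u \<in> X then ereal (F u) else \<infinity>)
      - ereal (w \<bullet> (z - u))) / ereal (norm (z - u)))"
  have "ereal (- e) \<le> Liminf (at u) Q" if e: "e > 0" for e
  proof (rule Liminf_bounded)
    obtain r where r: "r > 0" "\<And>z. z \<in> X \<Longrightarrow> z \<in> ball u r \<Longrightarrow> F z - F u - w \<bullet> (z - u) \<ge> - e * norm (z - u)"
      using w e unfolding frechet_ineq_def by blast
    have "ereal (- e) \<le> Q z" if z: "z \<noteq> u" "dist z u < r" for z
    proof (cases "z \<in> X")
      case True
      have "- e \<le> (F z - F u - w \<bullet> (z - u)) / norm (z - u)"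
        using r(2)[OF True] z by (simp add: pos_le_divide_eq dist_commute)
      then show ?thesis using True u z(1) by (simp add: Q_def)
    next
      case False
      then have "Q z = \<infinity>" using u z(1) by (simp add: Q_def)
      then show ?thesis by simp
    qed
    then show "eventually (\<lambda>z. ereal (- e) \<le> Q z) (at u)"
      unfolding eventually_at using r(1) by blast
  qed
  note le = this
  have "0 \<le> Liminf (at u) Q"
  proof (rule ereal_le_epsilon2)
    fix e :: real assume "e > 0"
    from add_right_mono[OF le[OF this], of "ereal e"] show "0 \<le> Liminf (at u) Q + ereal e"
      by (simp add: zero_ereal_def)
  qed
  then show ?thesis using u by (simp add: frechet_subdiff_def Q_def)
qed

section \<open>Polynomial and linear dependence of tensor products on their factors\<close>

lemma polynomial_var_prod:
  assumes "\<And>i. real_polynomial_function (\<lambda>u. a u i)" "\<And>i. real_polynomial_function (\<lambda>u. b u i)"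
  shows "real_polynomial_function (\<lambda>u. var_prod p v (a u) (b u) k)"
proof (cases "k \<in> {1..p}")
  case True
  have "finite {(i, j). i \<in> {1..p} \<and> j \<in> {1..p} \<and> [int i + int j - int k - 1 = 0] (mod int v)}"
    by (rule finite_subset[of _ "{1..p} \<times> {1..p}"]) auto
  then have "real_polynomial_function (\<lambda>u. \<Sum>t\<in>{(i, j). i \<in> {1..p} \<and> j \<in> {1..p} \<and>
      [int i + int j - int k - 1 = 0] (mod int v)}. a u (fst t) * b u (snd t))"
    using assms by (intro real_polynomial_function_sum real_polynomial_function.intros(4)) auto
  then show ?thesis using True by (simp add: var_prod_def case_prod_unfold)
next
  case False
  then have "var_prod p v (a u) (b u) k = 0" for u by (auto simp: var_prod_def)
  then show ?thesis by (simp add: real_polynomial_function.intros(2))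
qed

lemma polynomial_var_tprod:
  assumes "\<And>i j k. real_polynomial_function (\<lambda>u. A u i j k)" "\<And>i j k. real_polynomial_function (\<lambda>u. B u i j k)"
  shows "real_polynomial_function (\<lambda>u. var_tprod m q n p v (A u) (B u) i j k)"
proof (cases "i \<in> {1..m} \<and> j \<in> {1..n}")
  case True
  have "real_polynomial_function (\<lambda>u. \<Sum>l = 1..q. var_prod p v (A u i l) (B u l j) k)"
    using assms by (intro real_polynomial_function_sum polynomial_var_prod) auto
  then show ?thesis using True by (simp add: var_tprod_def)
next
  case False
  then have "var_tprod m q n p v (A u) (B u) i j k = 0" for u by (auto simp: var_tprod_def)
  then show ?thesis by (simp add: real_polynomial_function.intros(2))
qed

lemma bounded_linear_var_prod_left:
  assumes "\<And>i. bounded_linear (\<lambda>c. a c i)"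
  shows "bounded_linear (\<lambda>c. var_prod p v (a c) b k)"
proof (cases "k \<in> {1..p}")
  case True
  have "bounded_linear (\<lambda>c. \<Sum>t\<in>{(i, j). i \<in> {1..p} \<and> j \<in> {1..p} \<and>
      [int i + int j - int k - 1 = 0] (mod int v)}. a c (fst t) * b (snd t))"
    using assms by (intro bounded_linear_sum bounded_linear_mult_const) auto
  then show ?thesis using True by (simp add: var_prod_def case_prod_unfold)
next
  case False
  then have "var_prod p v (a c) b k = 0" for c by (auto simp: var_prod_def)
  then show ?thesis by simp
qed

lemma bounded_linear_var_prod_right:
  assumes "\<And>i. bounded_linear (\<lambda>c. a c i)"
  shows "bounded_linear (\<lambda>c. var_prod p v b (a c) k)"
proof (cases "k \<in> {1..p}")
  case True
  have "bounded_linear (\<lambda>c. \<Sum>t\<in>{(i, j). i \<in> {1..p} \<and> j \<in> {1..p} \<and>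
      [int i + int j - int k - 1 = 0] (mod int v)}. b (fst t) * a c (snd t))"
    using assms by (intro bounded_linear_sum bounded_linear_const_mult) auto
  then show ?thesis using True by (simp add: var_prod_def case_prod_unfold)
next
  case False
  then have "var_prod p v b (a c) k = 0" for c by (auto simp: var_prod_def)
  then show ?thesis by simp
qed

lemma bounded_linear_var_tprod:
  assumes A: "\<And>i j k. bounded_linear (\<lambda>c. A c i j k)"
  shows "bounded_linear (\<lambda>c. var_tprod m q n p v (A c) B i j k)"
    "bounded_linear (\<lambda>c. var_tprod m q n p v B (A c) i j k)"
proof -
  have "bounded_linear (\<lambda>c. \<Sum>l = 1..q. var_prod p v (A c i l) (B l j) k)"
    "bounded_linear (\<lambda>c. \<Sum>l = 1..q. var_prod p v (B i l) (A c l j) k)"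
    using A by (intro bounded_linear_sum bounded_linear_var_prod_left bounded_linear_var_prod_right; simp)+
  then show "bounded_linear (\<lambda>c. var_tprod m q n p v (A c) B i j k)"
    "bounded_linear (\<lambda>c. var_tprod m q n p v B (A c) i j k)"
    by (cases "i \<in> {1..m} \<and> j \<in> {1..n}"; force simp: var_tprod_def)+
qed

lemma bounded_linear_unvectorize: "bounded_linear (\<lambda>x. unvectorize m n p e x i j k)"
  by (cases "(i, j, k) \<in> tensor_idx m n p") (auto simp: unvectorize_def bounded_linear_vec_nth)

lemma finite_tensor_idx [simp]: "finite (tensor_idx m n p)"
  by (simp add: tensor_idx_def)

lemma tensor_l2_power2: "(tensor_l2 m n p A)\<^sup>2 = (\<Sum>t\<in>tensor_idx m n p. (case t of (i, j, k) \<Rightarrow> A i j k)\<^sup>2)"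
proof -
  have "(\<Sum>(i, j, k)\<in>tensor_idx m n p. (A i j k)\<^sup>2) = (\<Sum>t\<in>tensor_idx m n p. (case t of (i, j, k) \<Rightarrow> A i j k)\<^sup>2)"
    by (simp add: case_prod_unfold)
  then show ?thesis unfolding tensor_l2_def by (simp add: sum_nonneg)
qed

lemma polynomial_fit_term:
  "real_polynomial_function (\<lambda>u. fit_term m n p q v e1 e2 e3 (fst u) (fst (snd u)) (snd (snd u)))"
proof -
  have un: "real_polynomial_function (\<lambda>u. unvectorize m' n' p' e (L u) i j k)"
    if "bounded_linear L" for m' n' p' i j k and e :: "_ \<Rightarrow> 'x::finite" and L :: "'y::real_normed_vector \<Rightarrow> _"
    using bounded_linear_compose[OF bounded_linear_unvectorize that] by (rule real_polynomial_function.intros(1))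
  have "real_polynomial_function (\<lambda>u. (case t of (i, j, k) \<Rightarrow>
      var_tprod m q n p v (unvectorize m q p e1 (fst u)) (unvectorize q n p e2 (fst (snd u))) i j k
        - unvectorize m n p e3 (snd (snd u)) i j k))" for t
    by (cases t) (auto intro!: real_polynomial_function_diff polynomial_var_tprod un bounded_linear_fst
        bounded_linear_fst_comp bounded_linear_snd_comp bounded_linear_snd)
  then have "real_polynomial_function (\<lambda>u. 1 / 2 * (\<Sum>t\<in>tensor_idx m n p. (case t of (i, j, k) \<Rightarrow>
      var_tprod m q n p v (unvectorize m q p e1 (fst u)) (unvectorize q n p e2 (fst (snd u))) i j k
        - unvectorize m n p e3 (snd (snd u)) i j k)\<^sup>2))"
    by (intro real_polynomial_function.intros(4)[OF real_polynomial_function.intros(2)]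
        real_polynomial_function_sum real_polynomial_function_power finite_tensor_idx)
  then show ?thesis unfolding fit_term_def tensor_l2_power2 .
qed

lemma continuous_on_reg_term: "continuous_on UNIV (reg_term m n p v e3 \<alpha>1 \<alpha>2)"
  unfolding reg_term_def[abs_def] tensor_l1_def case_prod_unfold
  by (intro continuous_intros linear_continuous_on bounded_linear_var_tprod bounded_linear_unvectorize)

text \<open>An observed coordinate is a degenerate interval, any other one the unit interval. This
  form yields closedness and the list of coordinate constraints.\<close>

lemma feasible_box_eq_cbox:
  fixes e3 :: "_ \<Rightarrow> 'd::finite"
  shows "feasible_box m n p e3 G \<Omega> =
     cbox (\<chi> s. if s \<in> e3 ` \<Omega> then vectorize m n p e3 G $ s else 0)
       (\<chi> s. if s \<in> e3 ` \<Omega> then vectorize m n p e3 G $ s else 1)"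
proof (rule set_eqI)
  fix w :: "real ^ 'd"
  have pointwise: "(s \<in> A \<longrightarrow> w $ s = a) \<and> (s \<notin> A \<longrightarrow> w $ s \<in> {0..1}) \<longleftrightarrow>
      (if s \<in> A then a else 0) \<le> w $ s \<and> w $ s \<le> (if s \<in> A then a else 1)" for s A and a :: real
    by (cases "s \<in> A") auto
  have "w \<in> feasible_box m n p e3 G \<Omega> \<longleftrightarrow> (\<forall>s. (s \<in> e3 ` \<Omega> \<longrightarrow> w $ s = vectorize m n p e3 G $ s) \<and>
      (s \<notin> e3 ` \<Omega> \<longrightarrow> w $ s \<in> {0..1}))"
    unfolding feasible_box_def mem_Collect_eq by blast
  then show "w \<in> feasible_box m n p e3 G \<Omega> \<longleftrightarrow> w \<in> cbox (\<chi> s. if s \<in> e3 ` \<Omega> then vectorize m n p e3 G $ s else 0)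
       (\<chi> s. if s \<in> e3 ` \<Omega> then vectorize m n p e3 G $ s else 1)"
    unfolding pointwise by (simp only: mem_box_cart vec_lambda_beta)
qed

text \<open>The hyperplanes are the zero sets of the entries of the two difference terms and the
  faces of the box. On a cell each absolute value is a fixed sign times a linear form, so the
  objective is polynomial.\<close>

lemma objective_lojasiewicz:
  fixes m n p q v :: nat and \<alpha>1 \<alpha>2 :: real
    and e1 :: "_ \<Rightarrow> 'd1::finite" and e2 :: "_ \<Rightarrow> 'd2::finite" and e3 :: "_ \<Rightarrow> 'd3::finite"
    and G :: tensor and \<Omega> :: "(nat \<times> nat \<times> nat) set"
  defines "F \<equiv> \<lambda>u. fit_term m n p q v e1 e2 e3 (fst u) (fst (snd u)) (snd (snd u)) +
      reg_term m n p v e3 \<alpha>1 \<alpha>2 (snd (snd u))"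
    and "X \<equiv> UNIV \<times> UNIV \<times> feasible_box m n p e3 G \<Omega>"
  assumes "u0 \<in> X"
  shows "\<exists>\<delta>>0. \<delta> < 1 \<and> (\<forall>u\<in>X \<inter> ball u0 \<delta>. \<forall>w. F u > F u0 \<longrightarrow>
      frechet_ineq F X u w \<longrightarrow> (F u - F u0) powr (1 - \<delta>) \<le> norm w)"
proof -
  let ?idx = "tensor_idx m n p"
  define lo where "lo = (\<lambda>s. if s \<in> e3 ` \<Omega> then vectorize m n p e3 G $ s else 0)"
  define hi where "hi = (\<lambda>s. if s \<in> e3 ` \<Omega> then vectorize m n p e3 G $ s else 1)"
  define A1 where "A1 = (\<lambda>t (u :: (real ^ 'd1) \<times> (real ^ 'd2) \<times> (real ^ 'd3)). case t of (i, j, k) \<Rightarrow>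
      var_tprod m m n p v (diff_tensor1 m) (unvectorize m n p e3 (snd (snd u))) i j k)"
  define A2 where "A2 = (\<lambda>t (u :: (real ^ 'd1) \<times> (real ^ 'd2) \<times> (real ^ 'd3)). case t of (i, j, k) \<Rightarrow>
      var_tprod m n n p v (unvectorize m n p e3 (snd (snd u))) (diff_tensor2 n) i j k)"
  \<comment> \<open>The four summands of the index type: entries of the first and of the second
    difference term, then lower and upper bounds of the box.\<close>
  define l where "l = case_sum (case_sum A1 A2) (case_sum (\<lambda>s u. snd (snd u) $ s) (\<lambda>s u. snd (snd u) $ s))"
  define \<beta> where "\<beta> = case_sum (case_sum (\<lambda>_ :: nat \<times> nat \<times> nat. 0) (\<lambda>_ :: nat \<times> nat \<times> nat. 0)) (case_sum lo hi)"
  define I where "I = (?idx <+> ?idx) <+> ((UNIV :: 'd3 set) <+> (UNIV :: 'd3 set))"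
  \<comment> \<open>The sign vector supplies the weights, since
    \<open>\<bar>a\<bar> = sgn a * a\<close>.\<close>
  define P where "P = (\<lambda>(\<sigma> :: ((nat \<times> nat \<times> nat) + (nat \<times> nat \<times> nat)) + ('d3 + 'd3) \<Rightarrow> real) u. fit_term m n p q v e1 e2 e3 (fst u) (fst (snd u)) (snd (snd u)) +
      (\<alpha>1 * (\<Sum>t\<in>?idx. \<sigma> (Inl (Inl t)) * A1 t u) + \<alpha>2 * (\<Sum>t\<in>?idx. \<sigma> (Inl (Inr t)) * A2 t u)))"
  have F_alt: "F u = fit_term m n p q v e1 e2 e3 (fst u) (fst (snd u)) (snd (snd u)) +
      (\<alpha>1 * (\<Sum>t\<in>?idx. \<bar>A1 t u\<bar>) + \<alpha>2 * (\<Sum>t\<in>?idx. \<bar>A2 t u\<bar>))" for u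
    by (simp add: F_def reg_term_def tensor_l1_def A1_def A2_def case_prod_unfold)
  have snd2: "bounded_linear (\<lambda>u :: (real ^ 'd1) \<times> (real ^ 'd2) \<times> (real ^ 'd3). snd (snd u))"
    by (intro bounded_linear_snd_comp bounded_linear_snd)
  have blA: "bounded_linear (A1 t)" "bounded_linear (A2 t)" for t
    unfolding A1_def A2_def using snd2
    by (cases t; auto intro!: bounded_linear_var_tprod bounded_linear_compose[OF bounded_linear_unvectorize])+
  \<comment> \<open>Membership in \<open>X\<close> is expressed by signs alone, which gives
    saturation.\<close>
  have X_iff: "u \<in> X \<longleftrightarrow> (\<forall>s. 0 \<le> sgn (snd (snd u) $ s - lo s) \<and> sgn (snd (snd u) $ s - hi s) \<le> 0)" for u
    unfolding X_def feasible_box_eq_cbox lo_def hi_def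
    by (cases u) (auto simp: mem_box_cart zero_le_sgn_iff sgn_le_0_iff)
  have "finite I" by (simp add: I_def)
  moreover have "bounded_linear (l i)" if "i \<in> I" for i
    using blA bounded_linear_compose[OF bounded_linear_vec_nth snd2]
    by (cases i) (auto simp: l_def split: sum.split)
  moreover have "u' \<in> X" if "u \<in> X" and sg: "\<forall>i\<in>I. sgn (l i u' - \<beta> i) = sgn (l i u - \<beta> i)" for u u'
  proof -
    have "Inr (Inl s) \<in> I" "Inr (Inr s) \<in> I" for s by (auto simp: I_def)
    from bspec[OF sg this(1)] bspec[OF sg this(2)]
    have "sgn (snd (snd u') $ s - lo s) = sgn (snd (snd u) $ s - lo s)"
      "sgn (snd (snd u') $ s - hi s) = sgn (snd (snd u) $ s - hi s)" for s
      by (simp_all add: l_def \<beta>_def)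
    then show ?thesis using \<open>u \<in> X\<close> by (simp add: X_iff)
  qed
  moreover have "real_polynomial_function (P \<sigma>)" for \<sigma>
    unfolding P_def
    by (intro real_polynomial_function.intros(3) polynomial_fit_term
        real_polynomial_function.intros(4)[OF real_polynomial_function.intros(2)]
        real_polynomial_function_sum finite_tensor_idx real_polynomial_function.intros(1)[OF blA(1)]
        real_polynomial_function.intros(1)[OF blA(2)])
  moreover have "F u = P (restrict (\<lambda>i. sgn (l i u - \<beta> i)) I) u" if "u \<in> X" for u
  proof -
    have "restrict (\<lambda>i. sgn (l i u - \<beta> i)) I (Inl (Inl t)) * A1 t u = \<bar>A1 t u\<bar>"
      "restrict (\<lambda>i. sgn (l i u - \<beta> i)) I (Inl (Inr t)) * A2 t u = \<bar>A2 t u\<bar>" if "t \<in> ?idx" for t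
    proof -
      have "Inl (Inl t) \<in> I" "Inl (Inr t) \<in> I" using that by (auto simp: I_def)
      then show "restrict (\<lambda>i. sgn (l i u - \<beta> i)) I (Inl (Inl t)) * A1 t u = \<bar>A1 t u\<bar>"
        "restrict (\<lambda>i. sgn (l i u - \<beta> i)) I (Inl (Inr t)) * A2 t u = \<bar>A2 t u\<bar>"
        by (simp_all add: l_def \<beta>_def abs_sgn mult.commute)
    qed
    then show ?thesis unfolding F_alt P_def by simp
  qed
  moreover have "continuous_on X F"
  proof -
    have "continuous_on UNIV F"
      unfolding F_def
      by (intro continuous_on_add continuous_on_compose2[OF continuous_on_reg_term] continuous_intros
          continuous_on_polymonial_function)
         (use polynomial_fit_term in \<open>auto simp: real_polynomial_function_eq\<close>)
    then show ?thesis by (rule continuous_on_subset) simp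
  qed
  ultimately interpret piecewise_polynomial F X I l \<beta> P
    by (rule piecewise_polynomial.intro)
  show ?thesis using assms(3) by (rule lojasiewicz_inequality)
qed

theorem theoremD4:
  fixes m n p q v :: nat
    and e1 :: "nat \<times> nat \<times> nat \<Rightarrow> 'd1::finite"
    and e2 :: "nat \<times> nat \<times> nat \<Rightarrow> 'd2::finite"
    and e3 :: "nat \<times> nat \<times> nat \<Rightarrow> 'd3::finite"
    and G :: tensor
    and \<Omega> :: "(nat \<times> nat \<times> nat) set"
    and \<alpha>1 \<alpha>2 \<rho>1 \<rho>2 \<rho>3 :: real
    and F :: "(real ^ 'd1) \<times> (real ^ 'd2) \<times> (real ^ 'd3) \<Rightarrow> ereal"
    and x :: "nat \<Rightarrow> real ^ 'd1"
    and y :: "nat \<Rightarrow> real ^ 'd2"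
    and c :: "nat \<Rightarrow> real ^ 'd3"
  assumes "m > 0" "n > 0" "p > 0" "q > 0" "v > p"
    and "bij_betw e1 (tensor_idx m q p) UNIV"
    and "bij_betw e2 (tensor_idx q n p) UNIV"
    and "bij_betw e3 (tensor_idx m n p) UNIV"
    and "G \<in> tensors m n p"
    and "\<Omega> \<subseteq> tensor_idx m n p"
    and "\<alpha>1 \<ge> 0" "\<alpha>2 \<ge> 0"
    and "\<rho>1 > 0" "\<rho>2 > 0" "\<rho>3 > 0"
    and "F = objective m n p q v e1 e2 e3 G \<Omega> \<alpha>1 \<alpha>2"
    and "\<And>k. is_arg_min (\<lambda>z. F (z, y k, c k) + ereal (\<rho>1 / 2 * (norm (z - x k))\<^sup>2))
               (\<lambda>_. True) (x (Suc k))"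
    and "\<And>k. is_arg_min (\<lambda>z. F (x (Suc k), z, c k) + ereal (\<rho>2 / 2 * (norm (z - y k))\<^sup>2))
               (\<lambda>_. True) (y (Suc k))"
    and "\<And>k. is_arg_min (\<lambda>z. F (x (Suc k), y (Suc k), z) + ereal (\<rho>3 / 2 * (norm (z - c k))\<^sup>2))
               (\<lambda>_. True) (c (Suc k))"
    and "bounded (range (\<lambda>k. (x k, y k, c k)))"
  shows "\<exists>u. (\<lambda>k. (x k, y k, c k)) \<longlonglongrightarrow> u \<and> 0 \<in> limiting_subdiff F u"
proof -
  let ?C = "feasible_box m n p e3 G \<Omega>"
  define g where "g = (\<lambda>u. fit_term m n p q v e1 e2 e3 (fst u) (fst (snd u)) (snd (snd u)))"
  define h where "h = reg_term m n p v e3 \<alpha>1 \<alpha>2"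
  have F: "F (a, b, d) = (if d \<in> ?C then ereal (g (a, b, d) + h d) else \<infinity>)" for a b d
    by (simp add: assms(16) objective_def box_ind_def g_def h_def)
  have le_x: "F (x (Suc k), y k, c k) + ereal (\<rho>1 / 2 * (norm (x (Suc k) - x k))\<^sup>2) \<le>
      F (z, y k, c k) + ereal (\<rho>1 / 2 * (norm (z - x k))\<^sup>2)" for k z
    using assms(17)[of k] by (simp add: is_arg_min_def not_less)
  have le_y: "F (x (Suc k), y (Suc k), c k) + ereal (\<rho>2 / 2 * (norm (y (Suc k) - y k))\<^sup>2) \<le>
      F (x (Suc k), z, c k) + ereal (\<rho>2 / 2 * (norm (z - y k))\<^sup>2)" for k z
    using assms(18)[of k] by (simp add: is_arg_min_def not_less)
  have le_c: "F (x (Suc k), y (Suc k), c (Suc k)) + ereal (\<rho>3 / 2 * (norm (c (Suc k) - c k))\<^sup>2) \<le>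
      F (x (Suc k), y (Suc k), z) + ereal (\<rho>3 / 2 * (norm (z - c k))\<^sup>2)" for k z
    using assms(19)[of k] by (simp add: is_arg_min_def not_less)
  \<comment> \<open>A feasible point shows that the third subproblem has a finite minimum, so every
    \<open>c (Suc k)\<close> is feasible.\<close>
  have "(\<chi> s. if s \<in> e3 ` \<Omega> then vectorize m n p e3 G $ s else 0) \<in> ?C"
    by (simp add: feasible_box_eq_cbox mem_box_cart)
  then obtain c0 where c0: "c0 \<in> ?C" by blast
  have c_in: "c (Suc k) \<in> ?C" for k
    using le_c[of k c0] c0 by (auto simp: F split: if_splits)
  \<comment> \<open>The initial \<open>c 0\<close> may be infeasible, and the first two subproblems
    at \<open>k = 0\<close> are then infinite throughout; hence the sequence is shifted by
    one.\<close>
  have "\<exists>u0 w. u0 \<in> UNIV \<times> UNIV \<times> ?C \<and>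
      (\<lambda>k. (x (Suc k), y (Suc k), c (Suc k))) \<longlonglongrightarrow> u0 \<and> w \<longlonglongrightarrow> 0 \<and>
      (\<forall>k. frechet_ineq (\<lambda>u. g u + h (snd (snd u))) (UNIV \<times> UNIV \<times> ?C)
        (x (Suc (Suc k)), y (Suc (Suc k)), c (Suc (Suc k))) (w k))"
  proof (rule proximal_alternating_minimization)
    show "real_polynomial_function g" unfolding g_def by (rule polynomial_fit_term)
    show "g u \<ge> 0" for u by (simp add: g_def fit_term_def)
    show "h d \<ge> 0" for d
      using assms(11,12) by (auto simp: h_def reg_term_def tensor_l1_def intro!: add_nonneg_nonneg mult_nonneg_nonneg sum_nonneg)
    show "continuous_on UNIV h" unfolding h_def by (rule continuous_on_reg_term)
    show "closed ?C" by (simp add: feasible_box_eq_cbox closed_cbox)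
    show "\<exists>\<delta>>0. \<delta> < 1 \<and> (\<forall>u\<in>(UNIV \<times> UNIV \<times> ?C) \<inter> ball u0 \<delta>. \<forall>w.
        g u0 + h (snd (snd u0)) < g u + h (snd (snd u)) \<longrightarrow>
        frechet_ineq (\<lambda>u. g u + h (snd (snd u))) (UNIV \<times> UNIV \<times> ?C) u w \<longrightarrow>
        (g u + h (snd (snd u)) - (g u0 + h (snd (snd u0)))) powr (1 - \<delta>) \<le> norm w)"
      if "u0 \<in> UNIV \<times> UNIV \<times> ?C" for u0
      using objective_lojasiewicz[OF that] unfolding g_def h_def .
    show "\<rho>1 > 0" "\<rho>2 > 0" "\<rho>3 > 0" by fact+
    show "c (Suc k) \<in> ?C" for k by (rule c_in)
    show "g (x (Suc (Suc k)), y (Suc k), c (Suc k)) + \<rho>1 / 2 * (norm (x (Suc (Suc k)) - x (Suc k)))\<^sup>2 \<le>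
        g (z, y (Suc k), c (Suc k)) + \<rho>1 / 2 * (norm (z - x (Suc k)))\<^sup>2" for k z
      using le_x[of "Suc k" z] c_in by (simp add: F)
    show "g (x (Suc (Suc k)), y (Suc (Suc k)), c (Suc k)) + \<rho>2 / 2 * (norm (y (Suc (Suc k)) - y (Suc k)))\<^sup>2 \<le>
        g (x (Suc (Suc k)), z, c (Suc k)) + \<rho>2 / 2 * (norm (z - y (Suc k)))\<^sup>2" for k z
      using le_y[of "Suc k" z] c_in by (simp add: F)
    show "g (x (Suc (Suc k)), y (Suc (Suc k)), c (Suc (Suc k))) + h (c (Suc (Suc k))) +
        \<rho>3 / 2 * (norm (c (Suc (Suc k)) - c (Suc k)))\<^sup>2 \<le>
        g (x (Suc (Suc k)), y (Suc (Suc k)), z) + h z + \<rho>3 / 2 * (norm (z - c (Suc k)))\<^sup>2"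
      if "z \<in> ?C" for k z
      using le_c[of "Suc k" z] c_in that by (simp add: F)
    show "bounded (range (\<lambda>k. (x (Suc k), y (Suc k), c (Suc k))))"
      by (rule bounded_subset[OF assms(20)]) auto
  qed
  then obtain u0 w where u0: "u0 \<in> UNIV \<times> UNIV \<times> ?C"
    and lim: "(\<lambda>k. (x (Suc k), y (Suc k), c (Suc k))) \<longlonglongrightarrow> u0" and w: "w \<longlonglongrightarrow> 0"
    and fr: "\<And>k. frechet_ineq (\<lambda>u. g u + h (snd (snd u))) (UNIV \<times> UNIV \<times> ?C)
        (x (Suc (Suc k)), y (Suc (Suc k)), c (Suc (Suc k))) (w k)"
    by blast
  have F_if: "F = (\<lambda>z. if z \<in> UNIV \<times> UNIV \<times> ?C then ereal (g z + h (snd (snd z))) else \<infinity>)"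
    by (auto simp: F fun_eq_iff)
  have lim2: "(\<lambda>k. (x (Suc (Suc k)), y (Suc (Suc k)), c (Suc (Suc k)))) \<longlonglongrightarrow> u0"
    using LIMSEQ_Suc[OF lim] .
  have cont: "continuous_on UNIV (\<lambda>u. g u + h (snd (snd u)))"
    unfolding g_def h_def
    by (intro continuous_on_add continuous_on_compose2[OF continuous_on_reg_term] continuous_intros
        continuous_on_polymonial_function)
       (use polynomial_fit_term in \<open>auto simp: real_polynomial_function_eq\<close>)
  have "0 \<in> limiting_subdiff F u0"
    unfolding limiting_subdiff_def
  proof (intro CollectI conjI exI allI)
    show "F u0 < \<infinity>" using u0 by (simp add: F_if)
    show "w k \<in> frechet_subdiff F (x (Suc (Suc k)), y (Suc (Suc k)), c (Suc (Suc k)))" for k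
      unfolding F_if using c_in by (intro frechet_subdiff_if_frechet_ineq fr) auto
    have "(\<lambda>k. ereal (g (x (Suc (Suc k)), y (Suc (Suc k)), c (Suc (Suc k))) + h (c (Suc (Suc k)))))
        \<longlonglongrightarrow> ereal (g u0 + h (snd (snd u0)))"
      using continuous_on_tendsto_compose[OF cont lim2] by simp
    then show "(\<lambda>k. F (x (Suc (Suc k)), y (Suc (Suc k)), c (Suc (Suc k)))) \<longlonglongrightarrow> F u0"
      using u0 c_in by (simp add: F_if)
  qed (use lim2 w in auto)
  moreover have "(\<lambda>k. (x k, y k, c k)) \<longlonglongrightarrow> u0" using lim by (rule LIMSEQ_imp_Suc)
  ultimately show ?thesis by blast
qed

end
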